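(* The real polynomial Hardy--Littlewood constants satisfy $$2\le\liminf_{m\to\infty}\ \inf_{m<p\le\infty}\bigl(H^{\mathrm{pol}}_{m,p}(\mathbb R)\bigr)^{1/m}\le\limsup_{m\to\infty}\ \sup_{m<p\le\infty}\bigl(H^{\mathrm{pol}}_{m,p}(\mathbb R)\bigr)^{1/m}\le2\sqrt2.$$ If $(R_m)$ is a sequence with $R_m\to\infty$, then $$\sup_{p\ge mR_m}\left|\bigl(H^{\mathrm{pol}}_{m,p}(\mathbb R)\bigr)^{1/m}-2\right|\longrightarrow0\qquad(m\to\infty).$$
   Context: Convention: $1/\infty=0$; the exponent $p$ may equal $\infty$. For $m,n\in\mathbb N=\{1,2,\dots\}$, let $\mathcal M_m(n)=\{\alpha\in\mathbb N_0^n:\ |\alpha|=\alpha_1+\cdots+\alpha_n=m\}$, and let $\mathcal P_m(\mathbb R^n)$ be the space of real $m$-homogeneous polynomials $P(x)=\sum_{\alpha\in\mathcal M_m(n)}a_\alpha x^\alpha$ on $\mathbb R^n$. Put $\|P\|_p=\sup\{|P(x)|: x\in\mathbb R^n,\ \|x\|_p\le1\}$, where $\|x\|_p=(\sum_j|x_j|^p)^{1/p}$ for $p<\infty$ and $\|x\|_\infty=\max_j|x_j|$, and $|P|_r=(\sum_\alpha|a_\alpha|^r)^{1/r}$ for $1\le r<\infty$. For $m<p\le\infty$ set $q(m,p)=\frac{p}{p-m}$ if $m<p<2m$; $q(m,p)=\frac{2mp}{mp+p-2m}$ if $2m\le p<\infty$; $q(m,p)=\frac{2m}{m+1}$ if $p=\infty$.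 $H^{\mathrm{pol}}_{m,p}(\mathbb R)$ denotes the least constant $C$ such that $|P|_{q(m,p)}\le C\|P\|_p$ for all $n\in\mathbb N$ and all $P\in\mathcal P_m(\mathbb R^n)$ (finite by the polynomial Hardy--Littlewood inequality). *)

theory Defs
  imports "HOL-Analysis.Analysis"
begin

text \<open>
  Vectors of \<open>\<real>\<^sup>n\<close> are functions \<open>nat \<Rightarrow> real\<close> of which only the values at indices \<open>< n\<close> are read,
  since the constants below quantify over all dimensions \<open>n\<close>.  Exponents \<open>p\<close> range over
  \<^typ>\<open>ereal\<close>, so that \<open>p = \<infinity>\<close> is allowed.
\<close>

definition multi_indices :: "nat \<Rightarrow> nat \<Rightarrow> (nat \<Rightarrow> nat) set" where
  "multi_indices m n = {\<alpha>. (\<forall>i\<ge>n. \<alpha> i = 0) \<and> (\<Sum>i<n. \<alpha> i) = m}"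

text \<open>
  An \<open>m\<close>-homogeneous polynomial in \<open>n\<close> real variables is given by its coefficient family \<open>a\<close>, of
  which only the values on \<^term>\<open>multi_indices m n\<close> are read.
\<close>

definition hom_poly :: "nat \<Rightarrow> nat \<Rightarrow> ((nat \<Rightarrow> nat) \<Rightarrow> real) \<Rightarrow> (nat \<Rightarrow> real) \<Rightarrow> real" where
  "hom_poly m n a x = (\<Sum>\<alpha>\<in>multi_indices m n. a \<alpha> * (\<Prod>i<n. x i ^ \<alpha> i))"

definition lp_norm :: "nat \<Rightarrow> ereal \<Rightarrow> (nat \<Rightarrow> real) \<Rightarrow> real" where
  "lp_norm n p x =
     (if p = \<infinity> then Max ((\<lambda>j. \<bar>x j\<bar>) ` {..<n})
      else (\<Sum>j<n. \<bar>x j\<bar> powr real_of_ereal p) powr (1 / real_of_ereal p))"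

text \<open>
  For \<open>n \<ge> 1\<close> and \<open>p > 0\<close> the supremum below is over a nonempty bounded set, as \<^term>\<open>lp_norm n p x \<le> 1\<close>
  forces all coordinates into \<open>[-1, 1]\<close>.
\<close>

definition poly_sup_norm :: "nat \<Rightarrow> nat \<Rightarrow> ereal \<Rightarrow> ((nat \<Rightarrow> nat) \<Rightarrow> real) \<Rightarrow> real" where
  "poly_sup_norm m n p a = (SUP x\<in>{x. lp_norm n p x \<le> 1}. \<bar>hom_poly m n a x\<bar>)"

definition poly_coeff_norm :: "nat \<Rightarrow> nat \<Rightarrow> real \<Rightarrow> ((nat \<Rightarrow> nat) \<Rightarrow> real) \<Rightarrow> real" where
  "poly_coeff_norm m n r a = (\<Sum>\<alpha>\<in>multi_indices m n. \<bar>a \<alpha>\<bar> powr r) powr (1 / r)"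

text \<open>Only meaningful for \<open>m < p\<close>.\<close>

definition hl_exponent :: "nat \<Rightarrow> ereal \<Rightarrow> real" where
  "hl_exponent m p =
     (if p = \<infinity> then 2 * real m / (real m + 1)
      else let r = real_of_ereal p in
        if r < 2 * real m then r / (r - real m)
        else 2 * real m * r / (real m * r + r - 2 * real m))"

text \<open>
  The least admissible constant.  The set of admissible constants is closed and bounded below (test
  \<open>x\<^sub>1\<^sup>m\<close>), and for \<open>m < p\<close> it is nonempty by the polynomial Hardy--Littlewood inequality, so the
  infimum is a minimum.
\<close>

definition hl_pol_const :: "nat \<Rightarrow> ereal \<Rightarrow> real" where
  "hl_pol_const m p =
     Inf {C. \<forall>n\<ge>1. \<forall>a. poly_coeff_norm m n (hl_exponent m p) a \<le> C * poly_sup_norm m n p a}"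

end

theory Submission
  imports Defs
    "HOL-Complex_Analysis.Complex_Analysis"
    "HOL-Computational_Algebra.Fundamental_Theorem_Algebra"
    "HOL-Real_Asymp.Real_Asymp"
    "Jordan_Normal_Form.Determinant"
begin

text \<open>
  Lower bound.  On the unit cube the polynomial \<open>\<Prod>\<^bsub>j<k\<^esub> (x\<^sub>j\<^sup>2 - x\<^sub>k\<^sup>2)\<close> in \<open>N\<close> variables has degree
  \<open>m = N (N - 1)\<close> and is a Vandermonde determinant in numbers of \<open>[0, 1]\<close>.  Replacing powers by
  Chebyshev polynomials of \<open>[0, 1]\<close> extracts the factor \<open>2^(-(N - 1)\<^sup>2)\<close>, which is \<open>2^(-m + O(sqrt m))\<close>
  (this is the transfinite diameter \<open>1/4\<close> of the interval), and leaves a determinant of size at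
  most \<open>N!\<close>.  Some coefficient equals \<open>1\<close>, and the \<open>l\<^sub>p\<close> ball lies in the cube, so every constant is at
  least \<open>2^(m - o(m))\<close>, uniformly in \<open>p\<close> (\<open>vandermonde_bound\<close>, \<open>admissible_constant_lower_bound\<close>).
  Degrees between two values \<open>N (N - 1)\<close> are reached by multiplying with a power of \<open>x\<^sub>0\<close>.

  Upper bound.  A real polynomial extends to the complex \<open>l\<^sub>p\<close> ball at the price of \<open>2^m\<close>
  (\<open>complexification_bound\<close>).  It remains to bound the coefficients of a complex polynomial by
  \<open>sqrt 2^m\<close> for every \<open>p > m\<close>, and by a subexponential factor when \<open>p / m\<close> is large.

  For a vector \<open>y\<close> in the \<open>l\<^sub>p\<close> ball, split off \<open>k\<close> letters of each monomial and take the \<open>l\<^sup>2\<close> norm over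
  the other letters; by Parseval on the torus this is an \<open>L\<^sup>2\<close> norm.  Replacing it by an \<open>L\<^sup>\<rho>\<close> norm
  with \<open>\<rho> = 2k / (k + 1)\<close> and polarising bounds the resulting mixed norm of the coefficients
  weighted with \<open>y\<close>.  For \<open>k = 1\<close> the cost is \<open>sqrt 2^(m - 1)\<close>, from the sharp \<open>L\<^sup>1\<close>-\<open>L\<^sup>2\<close> inequality
  (\<open>L1_L2_inequality\<close>, a consequence of Carleman's inequality); for larger \<open>k\<close> it is
  \<open>2^(m / k)\<close>, from interpolation with \<open>L\<^sup>4\<close> (\<open>Lrho_L2_inequality\<close>).

  To pass from mixed norms to the \<open>l\<^sub>q\<close> norm, let \<open>\<nu>\<close> be the probability law on monomials that is
  proportional to the \<open>q\<close>-th powers of the coefficients, realised on words of length \<open>m\<close> with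
  random order, let \<open>H\<^sub>k\<close> be the entropy of its first \<open>k\<close> letters, and test with
  \<open>y\<^sub>j = (\<nu>-probability of the letter j) powr (1 / p)\<close>.  Jensen's inequality for the logarithm, used
  once for each of the two sums of the mixed norm, shows that for \<open>p \<ge> 2m\<close> the mixed norm with \<open>k\<close>
  free letters is, up to a polynomial factor in \<open>m\<close>, at least the \<open>l\<^sub>q\<close> norm times the exponential of
  \<open>H\<^sub>k / (2k) - H\<^sub>m / (2m) - (m H\<^sub>1 - H\<^sub>m) / p\<close>
  (\<open>mixed_norm_entropy_bound\<close>).  For \<open>k = 1\<close> the choice of \<open>q\<close> turns
  this expression into \<open>(1/2 - m/p) (H\<^sub>1 - H\<^sub>m / m)\<close>, which is nonnegative by subadditivity of
  entropy.  That gives \<open>sqrt 2^m\<close> for all \<open>p \<ge> 2m\<close>, and a similar computation covers \<open>m < p < 2m\<close>.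
  For large \<open>p\<close> the cheap estimate with \<open>k\<close> letters fails only by \<open>m/p (H\<^sub>1 - H\<^sub>m / m)\<close>, so a
  geometric mean in which the expensive estimate \<open>k = 1\<close> has weight about \<open>2m/p\<close> suffices
  (\<open>coeff_norm_bound_blocks\<close>).  Its cost \<open>2^(m/k) sqrt 2^(2m\<^sup>2/p)\<close> has \<open>m\<close>-th root close to \<open>1\<close> once \<open>k\<close> and
  \<open>p / m\<close> are large.
\<close>

section \<open>Words and entropy of exchangeable letters\<close>

definition tuples :: "nat \<Rightarrow> nat \<Rightarrow> nat list set" where
  "tuples n m = {xs. set xs \<subseteq> {..<n} \<and> length xs = m}"

text \<open>
  A homogeneous polynomial is handled as a function on words that depends only on the multiset of
  letters: the symmetric tensor behind the polynomial.  Splitting off some variables of a monomial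
  is then concatenation of words.
\<close>

definition symmetric :: "('a list \<Rightarrow> 'b) \<Rightarrow> bool" where
  "symmetric f \<longleftrightarrow> (\<forall>xs ys. mset xs = mset ys \<longrightarrow> f xs = f ys)"

lemma symmetricD: "symmetric f \<Longrightarrow> mset xs = mset ys \<Longrightarrow> f xs = f ys"
  unfolding symmetric_def by blast

lemma finite_tuples [simp]: "finite (tuples n m)"
  unfolding tuples_def using finite_lists_length_eq[of "{..<n}" m] by (simp add: conj_commute)

lemma tuples_0 [simp]: "tuples n 0 = {[]}"
  by (auto simp: tuples_def)

lemma tuples_Suc: "tuples n (Suc m) = (\<lambda>(j, xs). j # xs) ` ({..<n} \<times> tuples n m)"
proof -
  have "xs \<in> (\<lambda>(j, xs). j # xs) ` ({..<n} \<times> tuples n m)" if "xs \<in> tuples n (Suc m)" for xs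
    using that by (cases xs) (auto simp: tuples_def)
  then show ?thesis by (auto simp: tuples_def)
qed

lemma sum_tuples_Suc:
  "(\<Sum>xs\<in>tuples n (Suc m). F xs) = (\<Sum>j<n. \<Sum>xs\<in>tuples n m. F (j # xs))"
proof -
  have "inj_on (\<lambda>(j, xs). j # xs) ({..<n} \<times> tuples n m)" by (auto simp: inj_on_def)
  then show ?thesis
    by (simp add: tuples_Suc sum.reindex sum.cartesian_product case_prod_unfold)
qed

lemma sum_tuples_append:
  "(\<Sum>xs\<in>tuples n (k + l). F xs) = (\<Sum>u\<in>tuples n k. \<Sum>v\<in>tuples n l. F (u @ v))"
  by (induction k arbitrary: F) (simp_all add: sum_tuples_Suc)

lemma append_in_tuples: "u \<in> tuples n k \<Longrightarrow> v \<in> tuples n l \<Longrightarrow> u @ v \<in> tuples n (k + l)"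
  by (auto simp: tuples_def)

lemma sum_tuples_1: "(\<Sum>xs\<in>tuples n (Suc 0). F xs) = (\<Sum>j<n. F [j])"
  by (simp add: sum_tuples_Suc)

text \<open>
  Jensen's inequality for the logarithm, without normalisation so that it can be applied to each
  conditional law separately.
\<close>

lemma log_sum_inequality:
  fixes p x :: "'a \<Rightarrow> real"
  assumes S: "finite S" and p: "\<And>i. i \<in> S \<Longrightarrow> 0 \<le> p i" and x: "\<And>i. i \<in> S \<Longrightarrow> 0 \<le> x i"
    and px: "\<And>i. i \<in> S \<Longrightarrow> 0 < p i \<Longrightarrow> 0 < x i"
  shows "(\<Sum>i\<in>S. p i * (ln (x i) - ln (p i))) \<le> sum p S * (ln (sum x S) - ln (sum p S))"
proof (cases "sum p S = 0")
  case True
  then have "\<forall>i\<in>S. p i = 0" using S p by (simp add: sum_nonneg_eq_0_iff)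
  then show ?thesis using True by simp
next
  case False
  define P where "P = sum p S"
  define X where "X = sum x S"
  have P: "P > 0" using False p by (simp add: P_def sum_nonneg order_less_le)
  obtain j where j: "j \<in> S" "p j \<noteq> 0" using False by (meson sum.neutral)
  then have "0 < x j" using px[of j] p[of j] by simp
  then have X: "X > 0" unfolding X_def using j S x by (intro sum_pos2[of S j]) auto
  have term_le: "p i * (ln (x i) - ln (p i)) \<le> P * x i / X - p i + p i * (ln X - ln P)" if i: "i \<in> S" for i
  proof (cases "p i = 0")
    case True then show ?thesis using x[OF i] P X by simp
  next
    case False
    then have pi: "p i > 0" using p[OF i] by simp
    have xi: "x i > 0" using px[OF i pi] .
    have "ln (x i * P / (p i * X)) \<le> x i * P / (p i * X) - 1"
      using pi xi P X by (intro ln_le_minus_one) simp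
    then have "ln (x i) + ln P - ln (p i) - ln X \<le> x i * P / (p i * X) - 1"
      using pi xi P X by (simp add: ln_div ln_mult)
    then have "p i * (ln (x i) + ln P - ln (p i) - ln X) \<le> p i * (x i * P / (p i * X) - 1)"
      using pi by (intro mult_left_mono) auto
    also have "\<dots> = P * x i / X - p i" using pi X by (simp add: field_simps)
    finally show ?thesis by (simp add: algebra_simps)
  qed
  have "(\<Sum>i\<in>S. p i * (ln (x i) - ln (p i))) \<le> (\<Sum>i\<in>S. P * x i / X - p i + p i * (ln X - ln P))"
    by (intro sum_mono term_le)
  also have "\<dots> = P * X / X - P + P * (ln X - ln P)"
    unfolding sum.distrib sum_subtractf P_def X_def
    by (simp add: sum_distrib_left sum_distrib_right sum_divide_distrib)
  also have "\<dots> = P * (ln X - ln P)" using X by simp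
  finally show ?thesis by (simp add: P_def X_def)
qed

text \<open>
  For a symmetric law all sets of \<open>k\<close> positions have the same marginal, so prefixes suffice.
\<close>

definition marginal :: "nat \<Rightarrow> nat \<Rightarrow> (nat list \<Rightarrow> real) \<Rightarrow> nat \<Rightarrow> nat list \<Rightarrow> real" where
  "marginal n m \<nu> k u = (\<Sum>v\<in>tuples n (m - k). \<nu> (u @ v))"

definition entropy :: "nat \<Rightarrow> nat \<Rightarrow> (nat list \<Rightarrow> real) \<Rightarrow> nat \<Rightarrow> real" where
  "entropy n m \<nu> k = - (\<Sum>u\<in>tuples n k. marginal n m \<nu> k u * ln (marginal n m \<nu> k u))"

locale symmetric_law =
  fixes n m :: nat and \<nu> :: "nat list \<Rightarrow> real"
  assumes nonneg: "0 \<le> \<nu> xs" and total: "(\<Sum>xs\<in>tuples n m. \<nu> xs) = 1"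
    and sym: "symmetric \<nu>"
begin

abbreviation "\<phi> \<equiv> marginal n m \<nu>"
abbreviation "H \<equiv> entropy n m \<nu>"

lemma marginal_nonneg: "0 \<le> \<phi> k u"
  by (simp add: marginal_def sum_nonneg nonneg)

lemma marginal_full: "\<phi> m u = \<nu> u"
  by (simp add: marginal_def)

lemma marginal_symmetric: "symmetric (\<phi> k)"
  unfolding symmetric_def marginal_def
  by (auto intro!: sum.cong symmetricD[OF sym])

lemma marginal_append: "k + l \<le> m \<Longrightarrow> (\<Sum>v\<in>tuples n l. \<phi> (k + l) (u @ v)) = \<phi> k u"
  unfolding marginal_def using sum_tuples_append[of "\<lambda>w. \<nu> (u @ w)" n l "m - (k + l)"]
  by simp

lemma marginal_append':
  assumes "k + l \<le> m"
  shows "(\<Sum>u\<in>tuples n k. \<phi> (k + l) (u @ v)) = \<phi> l v"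
proof -
  have "(\<Sum>u\<in>tuples n k. \<phi> (k + l) (u @ v)) = (\<Sum>u\<in>tuples n k. \<phi> (l + k) (v @ u))"
    by (intro sum.cong refl) (simp add: add.commute symmetricD[OF marginal_symmetric])
  also have "\<dots> = \<phi> l v" using assms by (intro marginal_append) simp
  finally show ?thesis .
qed

lemma marginal_total: "k \<le> m \<Longrightarrow> (\<Sum>u\<in>tuples n k. \<phi> k u) = 1"
  using marginal_append[of 0 k "[]"] total by (simp add: marginal_def)

lemma marginal_prefix_pos: "k + l \<le> m \<Longrightarrow> v \<in> tuples n l \<Longrightarrow> 0 < \<phi> (k + l) (u @ v) \<Longrightarrow> 0 < \<phi> k u"
  unfolding marginal_append[of k l u, symmetric]
  by (intro sum_pos2[of _ v]) (auto simp: marginal_nonneg)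

lemma marginal_suffix_pos:
  "k + l \<le> m \<Longrightarrow> u \<in> tuples n k \<Longrightarrow> 0 < \<phi> (k + l) (u @ v) \<Longrightarrow> 0 < \<phi> l v"
  unfolding marginal_append'[of k l v, symmetric]
  by (intro sum_pos2[of _ u]) (auto simp: marginal_nonneg)

text \<open>
  The relative entropy with respect to the product of two marginals is nonnegative; a suffix of
  length \<open>l\<close> has the same law as a prefix of that length.
\<close>

lemma entropy_subadditive:
  assumes kl: "k + l \<le> m"
  shows "H (k + l) \<le> H k + H l"
proof -
  let ?T = "tuples n k \<times> tuples n l"
  have "(\<Sum>(u,v)\<in>?T. \<phi> (k+l) (u @ v) * (ln (\<phi> k u * \<phi> l v) - ln (\<phi> (k+l) (u @ v))))
     \<le> (\<Sum>(u,v)\<in>?T. \<phi> (k+l) (u @ v)) * (ln (\<Sum>(u,v)\<in>?T. \<phi> k u * \<phi> l v) - ln (\<Sum>(u,v)\<in>?T. \<phi> (k+l) (u @ v)))"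
    unfolding case_prod_unfold
    by (intro log_sum_inequality)
       (auto simp: marginal_nonneg intro!: mult_pos_pos marginal_prefix_pos[OF kl] marginal_suffix_pos[OF kl])
  also have "(\<Sum>(u,v)\<in>?T. \<phi> (k+l) (u @ v)) = 1"
    using marginal_total[OF kl] by (simp add: sum_tuples_append flip: sum.cartesian_product)
  also have "(\<Sum>(u,v)\<in>?T. \<phi> k u * \<phi> l v) = 1"
    using marginal_total[of k] marginal_total[of l] kl
    by (simp flip: sum.cartesian_product add: sum_product[symmetric])
  finally have le: "(\<Sum>(u,v)\<in>?T. \<phi> (k+l) (u @ v) * (ln (\<phi> k u * \<phi> l v) - ln (\<phi> (k+l) (u @ v)))) \<le> 0"
    by simp
  have "(\<Sum>(u,v)\<in>?T. \<phi> (k+l) (u @ v) * (ln (\<phi> k u * \<phi> l v) - ln (\<phi> (k+l) (u @ v))))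
      = (\<Sum>(u,v)\<in>?T. \<phi> (k+l) (u @ v) * ln (\<phi> k u) + \<phi> (k+l) (u @ v) * ln (\<phi> l v)
            - \<phi> (k+l) (u @ v) * ln (\<phi> (k+l) (u @ v)))"
  proof (intro sum.cong refl, clarify)
    fix u v assume u: "u \<in> tuples n k" and v: "v \<in> tuples n l"
    show "\<phi> (k+l) (u @ v) * (ln (\<phi> k u * \<phi> l v) - ln (\<phi> (k+l) (u @ v)))
       = \<phi> (k+l) (u @ v) * ln (\<phi> k u) + \<phi> (k+l) (u @ v) * ln (\<phi> l v)
            - \<phi> (k+l) (u @ v) * ln (\<phi> (k+l) (u @ v))"
    proof (cases "\<phi> (k+l) (u @ v) = 0")
      case False
      then have pos: "0 < \<phi> (k+l) (u @ v)" using marginal_nonneg[of "k+l" "u@v"] by linarith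
      show ?thesis
        using marginal_prefix_pos[OF kl v pos] marginal_suffix_pos[OF kl u pos]
        by (simp add: ln_mult algebra_simps)
    qed simp
  qed
  also have "\<dots> = (\<Sum>u\<in>tuples n k. (\<Sum>v\<in>tuples n l. \<phi> (k+l) (u @ v)) * ln (\<phi> k u))
     + (\<Sum>v\<in>tuples n l. (\<Sum>u\<in>tuples n k. \<phi> (k+l) (u @ v)) * ln (\<phi> l v)) + H (k + l)"
  proof -
    have "(\<Sum>u\<in>tuples n k. \<Sum>v\<in>tuples n l. \<phi> (k+l) (u @ v) * ln (\<phi> l v))
      = (\<Sum>v\<in>tuples n l. (\<Sum>u\<in>tuples n k. \<phi> (k+l) (u @ v)) * ln (\<phi> l v))"
      unfolding sum_distrib_right by (rule sum.swap)
    then show ?thesis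
      unfolding entropy_def sum_tuples_append
      by (simp add: sum.distrib sum_subtractf sum_distrib_right flip: sum.cartesian_product)
  qed
  also have "\<dots> = - H k - H l + H (k + l)"
    unfolding marginal_append[OF kl] marginal_append'[OF kl] by (simp add: entropy_def)
  finally show ?thesis using le by linarith
qed

lemma entropy_0: "H 0 = 0"
  using marginal_total[of 0] by (simp add: entropy_def)

text \<open>
  The single letters left over by the blocks keep the estimate exact when \<open>k\<close> does not divide \<open>m\<close>;
  rounding \<open>m\<close> would lose a multiple of an entropy, and entropies are not bounded in terms of \<open>m\<close>.
\<close>

lemma entropy_blocks: "A * k + r \<le> m \<Longrightarrow> H (A * k + r) \<le> A * H k + r * H 1"
proof (induction A)
  case 0
  then have "r \<le> m" by simp
  then have "H r \<le> r * H 1"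
  proof (induction r)
    case 0 then show ?case by (simp add: entropy_0)
  next
    case (Suc r)
    then have "H (r + 1) \<le> H r + H 1" by (intro entropy_subadditive) simp
    then show ?case using Suc by (simp add: algebra_simps)
  qed
  then show ?case by simp
next
  case (Suc A)
  have "H (k + (A * k + r)) \<le> H k + H (A * k + r)" using Suc.prems by (intro entropy_subadditive) simp
  also have "\<dots> \<le> H k + (A * H k + r * H 1)" using Suc by simp
  finally show ?case by (simp add: algebra_simps)
qed

lemma expectation_sum_list:
  fixes f :: "nat \<Rightarrow> real"
  shows "k \<le> m \<Longrightarrow> (\<Sum>xs\<in>tuples n k. \<phi> k xs * sum_list (map f xs)) = k * (\<Sum>j<n. \<phi> 1 [j] * f j)"
proof (induction k)
  case 0 then show ?case by simp
next
  case (Suc k)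
  have 1: "(\<Sum>xs\<in>tuples n k. \<phi> (Suc k) (j # xs)) = \<phi> 1 [j]" for j
    using marginal_append[of 1 k "[j]"] Suc by simp
  have 2: "(\<Sum>j<n. \<phi> (Suc k) (j # xs)) = \<phi> k xs" for xs
    using marginal_append'[of 1 k xs] Suc by (simp add: sum_tuples_1)
  have "(\<Sum>xs\<in>tuples n (Suc k). \<phi> (Suc k) xs * sum_list (map f xs))
     = (\<Sum>j<n. (\<Sum>xs\<in>tuples n k. \<phi> (Suc k) (j # xs)) * f j)
       + (\<Sum>j<n. \<Sum>xs\<in>tuples n k. \<phi> (Suc k) (j # xs) * sum_list (map f xs))"
    by (simp add: sum_tuples_Suc algebra_simps sum.distrib sum_distrib_left sum_distrib_right)
  also have "(\<Sum>j<n. \<Sum>xs\<in>tuples n k. \<phi> (Suc k) (j # xs) * sum_list (map f xs))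
     = (\<Sum>xs\<in>tuples n k. (\<Sum>j<n. \<phi> (Suc k) (j # xs)) * sum_list (map f xs))"
    unfolding sum_distrib_right by (rule sum.swap)
  finally show ?case using Suc by (simp add: 1 2 algebra_simps)
qed

text \<open>
  Needed because \<open>ln 0 = 0\<close>: lower bounds for the logarithm of a mixed norm say nothing about a
  mixed norm that vanishes.
\<close>

lemma mixed_norm_positive:
  fixes c :: "nat list \<Rightarrow> nat list \<Rightarrow> real" and g :: "nat list \<Rightarrow> real" and \<rho> \<sigma> :: real
  assumes k: "k \<le> m"
    and c: "\<And>u v. 0 \<le> c (u @ v) v" and g: "\<And>u. 0 \<le> g u"
    and cpos: "\<And>u v. u \<in> tuples n k \<Longrightarrow> v \<in> tuples n (m - k) \<Longrightarrow> 0 < \<nu> (u @ v) \<Longrightarrow> 0 < c (u @ v) v"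
    and gpos: "\<And>u. u \<in> tuples n k \<Longrightarrow> 0 < \<phi> k u \<Longrightarrow> 0 < g u"
  shows "0 < (\<Sum>u\<in>tuples n k. g u powr \<rho> * (\<Sum>v\<in>tuples n (m - k). c (u @ v) v) powr \<sigma>)"
proof -
  have "(\<Sum>u\<in>tuples n k. \<phi> k u) \<noteq> 0" using marginal_total[OF k] by simp
  then obtain u where u: "u \<in> tuples n k" "\<phi> k u \<noteq> 0" by (rule sum.not_neutral_contains_not_neutral)
  then have u0: "0 < \<phi> k u" using marginal_nonneg[of k u] by simp
  have "(\<Sum>v\<in>tuples n (m - k). \<nu> (u @ v)) \<noteq> 0" using u by (simp add: marginal_def)
  then obtain v where v: "v \<in> tuples n (m - k)" "\<nu> (u @ v) \<noteq> 0" by (rule sum.not_neutral_contains_not_neutral)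
  then have "0 < \<nu> (u @ v)" using nonneg[of "u @ v"] by simp
  then have "0 < (\<Sum>v\<in>tuples n (m - k). c (u @ v) v)"
    using v cpos[OF u(1) v(1)] c by (intro sum_pos2[of _ v]) auto
  then show ?thesis using u gpos[OF u(1) u0] by (intro sum_pos2[of _ u]) auto
qed

text \<open>
  The logarithm of a sum of positive terms is the maximum, over probability laws, of the expected
  logarithm of the terms plus the entropy.  The bound tests the inner sum with the conditional law of
  the last letters given the first ones and the outer sum with the law of the first letters; the
  chain rule for entropy merges the two contributions.
\<close>

lemma mixed_norm_lower_bound:
  assumes k: "k \<le> m" and \<rho>: "\<rho> > 0"
    and c: "\<And>u v. 0 \<le> c (u @ v) v" and g: "\<And>u. 0 \<le> g u"
    and cpos: "\<And>u v. u \<in> tuples n k \<Longrightarrow> v \<in> tuples n (m - k) \<Longrightarrow> 0 < \<nu> (u @ v) \<Longrightarrow> 0 < c (u @ v) v"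
    and gpos: "\<And>u. u \<in> tuples n k \<Longrightarrow> 0 < \<phi> k u \<Longrightarrow> 0 < g u"
  shows "(\<Sum>u\<in>tuples n k. \<phi> k u * ln (g u))
      + (\<Sum>u\<in>tuples n k. \<Sum>v\<in>tuples n (m - k). \<nu> (u @ v) * ln (c (u @ v) v)) / 2 + H m / 2 + (1 / \<rho> - 1 / 2) * H k
     \<le> ln (\<Sum>u\<in>tuples n k. g u powr \<rho> * (\<Sum>v\<in>tuples n (m - k). c (u @ v) v) powr (\<rho> / 2)) / \<rho>"
    (is "?G + ?C / 2 + _ + _ \<le> ln ?Z / \<rho>")
proof -
  define X where "X u = (\<Sum>v\<in>tuples n (m - k). c (u @ v) v)" for u
  have phi: "\<phi> k u = (\<Sum>v\<in>tuples n (m - k). \<nu> (u @ v))" for u by (simp add: marginal_def)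
  have Xpos: "0 < X u" if u: "u \<in> tuples n k" and p: "0 < \<phi> k u" for u
  proof -
    have "(\<Sum>v\<in>tuples n (m - k). \<nu> (u @ v)) \<noteq> 0" using p by (simp add: phi)
    then obtain v where v: "v \<in> tuples n (m - k)" "\<nu> (u @ v) \<noteq> 0" by (rule sum.not_neutral_contains_not_neutral)
    then have "\<nu> (u @ v) > 0" using nonneg[of "u @ v"] by simp
    show ?thesis unfolding X_def using v cpos[OF u v(1) \<open>\<nu> (u @ v) > 0\<close>] c by (intro sum_pos2[of _ v]) auto
  qed
  have inner: "(\<Sum>v\<in>tuples n (m - k). \<nu> (u @ v) * (ln (c (u @ v) v) - ln (\<nu> (u @ v))))
       \<le> \<phi> k u * (ln (X u) - ln (\<phi> k u))" if u: "u \<in> tuples n k" for u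
    unfolding phi X_def using u by (intro log_sum_inequality) (auto simp: nonneg c cpos)
  have HM: "H m = - (\<Sum>u\<in>tuples n k. \<Sum>v\<in>tuples n (m - k). \<nu> (u @ v) * ln (\<nu> (u @ v)))"
    unfolding entropy_def marginal_full using sum_tuples_append[of "\<lambda>x. \<nu> x * ln (\<nu> x)" n k "m - k"] k
    by simp
  have "?C + H m = (\<Sum>u\<in>tuples n k. (\<Sum>v\<in>tuples n (m - k). \<nu> (u @ v) * (ln (c (u @ v) v) - ln (\<nu> (u @ v)))))"
    unfolding HM by (simp add: right_diff_distrib sum_subtractf)
  also have "\<dots> \<le> (\<Sum>u\<in>tuples n k. \<phi> k u * (ln (X u) - ln (\<phi> k u)))"
    by (intro sum_mono inner)
  also have "\<dots> = (\<Sum>u\<in>tuples n k. \<phi> k u * ln (X u)) + H k"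
    by (simp add: right_diff_distrib sum_subtractf entropy_def)
  finally have 1: "?C + H m - H k \<le> (\<Sum>u\<in>tuples n k. \<phi> k u * ln (X u))" by simp
  have "(\<Sum>u\<in>tuples n k. \<phi> k u * (ln (g u powr \<rho> * X u powr (\<rho> / 2)) - ln (\<phi> k u)))
    \<le> (\<Sum>u\<in>tuples n k. \<phi> k u) * (ln (\<Sum>u\<in>tuples n k. g u powr \<rho> * X u powr (\<rho> / 2)) - ln (\<Sum>u\<in>tuples n k. \<phi> k u))"
    by (intro log_sum_inequality) (auto simp: marginal_nonneg intro!: mult_pos_pos dest: gpos Xpos)
  also have "\<dots> = ln ?Z" using marginal_total[OF k] by (simp add: X_def)
  finally have 2: "(\<Sum>u\<in>tuples n k. \<phi> k u * (ln (g u powr \<rho> * X u powr (\<rho> / 2)) - ln (\<phi> k u))) \<le> ln ?Z" .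
  have "(\<Sum>u\<in>tuples n k. \<phi> k u * (ln (g u powr \<rho> * X u powr (\<rho> / 2)) - ln (\<phi> k u)))
     = (\<Sum>u\<in>tuples n k. \<rho> * (\<phi> k u * ln (g u)) + \<rho> / 2 * (\<phi> k u * ln (X u)) - \<phi> k u * ln (\<phi> k u))"
  proof (intro sum.cong refl)
    fix u assume u: "u \<in> tuples n k"
    show "\<phi> k u * (ln (g u powr \<rho> * X u powr (\<rho> / 2)) - ln (\<phi> k u))
       = \<rho> * (\<phi> k u * ln (g u)) + \<rho> / 2 * (\<phi> k u * ln (X u)) - \<phi> k u * ln (\<phi> k u)"
    proof (cases "\<phi> k u = 0")
      case False
      then have p: "0 < \<phi> k u" using marginal_nonneg[of k u] by linarith
      show ?thesis using gpos[OF u p] Xpos[OF u p] by (simp add: ln_mult ln_powr algebra_simps)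
    qed simp
  qed
  also have "\<dots> = \<rho> * ?G + \<rho> / 2 * (\<Sum>u\<in>tuples n k. \<phi> k u * ln (X u)) + H k"
    by (simp add: sum.distrib sum_subtractf sum_distrib_left entropy_def)
  finally have "\<rho> * ?G + \<rho> / 2 * (\<Sum>u\<in>tuples n k. \<phi> k u * ln (X u)) + H k \<le> ln ?Z" using 2 by linarith
  moreover have "\<rho> / 2 * (?C + H m - H k) \<le> \<rho> / 2 * (\<Sum>u\<in>tuples n k. \<phi> k u * ln (X u))"
    using 1 \<rho> by (intro mult_left_mono) auto
  ultimately have "\<rho> * ?G + \<rho> / 2 * (?C + H m - H k) + H k \<le> ln ?Z" by linarith
  then have "(\<rho> * ?G + \<rho> / 2 * (?C + H m - H k) + H k) / \<rho> \<le> ln ?Z / \<rho>"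
    using \<rho> by (intro divide_right_mono) auto
  moreover have "(\<rho> * ?G + \<rho> / 2 * (?C + H m - H k) + H k) / \<rho> = ?G + ?C / 2 + H m / 2 + (1 / \<rho> - 1 / 2) * H k"
    using \<rho> by (simp add: field_simps)
  ultimately show ?thesis by simp
qed

end

section \<open>Carleman's inequality for polynomials in one variable\<close>

definition on_circle :: "real \<Rightarrow> complex" where
  "on_circle t = cis (2 * pi * t)"

lemma norm_on_circle [simp]: "cmod (on_circle t) = 1"
  by (simp add: on_circle_def)

lemma continuous_on_circle [continuous_intros]: "continuous_on S on_circle"
  unfolding on_circle_def by (intro continuous_intros)

lemma norm_on_circle_diff_le: "cmod (on_circle s - on_circle t) \<le> 2 * pi * \<bar>s - t\<bar>"
proof -
  have "on_circle t * cis (2 * pi * (s - t)) = on_circle s"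
    unfolding on_circle_def cis_mult by (simp add: algebra_simps)
  then have "on_circle s - on_circle t = on_circle t * (exp (\<i> * of_real (2 * pi * (s - t))) - 1)"
    unfolding cis_conv_exp by (simp add: right_diff_distrib)
  then have "cmod (on_circle s - on_circle t) = 2 * \<bar>sin (pi * (s - t))\<bar>"
    by (simp only: norm_mult norm_on_circle dist_exp_i_1) simp
  also have "\<dots> \<le> 2 * \<bar>pi * (s - t)\<bar>"
    using abs_sin_x_le_abs_x[of "pi * (s - t)"] by simp
  finally show ?thesis by (simp add: abs_mult)
qed

lemma poly_has_fps_expansion: "poly p has_fps_expansion fps_of_poly p" for p :: "complex poly"
proof -
  have "eval_fps (fps_of_poly p) = poly p" by (intro ext) simp
  then show ?thesis using eval_fps_has_fps_expansion[of "fps_of_poly p"] by simp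
qed

text \<open>
  Cauchy's formula for Taylor coefficients, with the contour integral written out as a Fourier
  coefficient.
\<close>

lemma cauchy_coefficient:
  assumes g: "g holomorphic_on ball 0 R" and R: "R > 1"
  shows "((\<lambda>t. g (on_circle t) * cnj (on_circle t ^ k)) has_integral fps_nth (fps_expansion g 0) k) {0..1}"
proof -
  have sub: "cball 0 1 \<subseteq> ball 0 R" using R by auto
  have "((\<lambda>u. g u / (u - 0) ^ Suc k) has_contour_integral (2 * pi * \<i>) / (fact k) * (deriv ^^ k) g 0) (circlepath 0 1)"
    using R by (intro Cauchy_has_contour_integral_higher_derivative_circlepath)
       (auto intro!: holomorphic_on_imp_continuous_on holomorphic_on_subset[OF g])
  then have "((\<lambda>x. g (circlepath 0 1 x) / circlepath 0 1 x ^ Suc k * vector_derivative (circlepath 0 1) (at x))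
      has_integral 2 * pi * \<i> * fps_nth (fps_expansion g 0) k) {0..1}"
    unfolding has_contour_integral by (simp add: fps_expansion_def)
  then have "((\<lambda>x. 2 * pi * \<i> * (g (on_circle x) * cnj (on_circle x ^ k)))
      has_integral 2 * pi * \<i> * fps_nth (fps_expansion g 0) k) {0..1}"
  proof (rule has_integral_eq[rotated])
    fix x :: real
    have c: "circlepath 0 1 x = on_circle x"
      by (simp add: circlepath on_circle_def cis_conv_exp mult_ac)
    have d: "vector_derivative (circlepath 0 1) (at x) = 2 * pi * \<i> * on_circle x"
      by (simp add: vector_derivative_circlepath on_circle_def cis_conv_exp mult_ac)
    have nz: "on_circle x \<noteq> 0" by (metis norm_on_circle norm_zero zero_neq_one)
    have inv: "cnj (on_circle x ^ k) = 1 / on_circle x ^ k"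
      using complex_norm_square[of "on_circle x ^ k"] nz by (simp add: norm_power field_simps)
    show "g (circlepath 0 1 x) / circlepath 0 1 x ^ Suc k * vector_derivative (circlepath 0 1) (at x)
        = 2 * pi * \<i> * (g (on_circle x) * cnj (on_circle x ^ k))"
      unfolding inv c d using nz by (simp add: field_simps)
  qed
  from has_integral_mult_right[OF this, of "1 / (2 * pi * \<i>)"] show ?thesis
    by (simp add: field_simps)
qed

text \<open>
  Expand \<open>\<bar>g - s\<bar>\<^sup>2 \<ge> 0\<close> on the circle, where \<open>s\<close> is the Taylor polynomial of \<open>g\<close>.
\<close>

lemma bessel_inequality_circle:
  assumes g: "g holomorphic_on ball 0 R" and R: "R > 1"
  shows "(\<Sum>k\<le>D. (cmod (fps_nth (fps_expansion g 0) k))\<^sup>2) \<le> integral {0..1} (\<lambda>t. (cmod (g (on_circle t)))\<^sup>2)"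
proof -
  define c where "c k = fps_nth (fps_expansion g 0) k" for k
  define s where "s z = (\<Sum>k\<le>D. c k * z ^ k)" for z
  have sh: "s holomorphic_on ball 0 R" unfolding s_def by (intro holomorphic_intros)
  have sc: "fps_nth (fps_expansion s 0) k = (if k \<le> D then c k else 0)" for k
  proof -
    let ?p = "Abs_poly (\<lambda>k. if k \<le> D then c k else 0)"
    have co: "coeff ?p = (\<lambda>k. if k \<le> D then c k else 0)"
      by (intro coeff_Abs_poly[of D]) auto
    have "poly ?p = s"
    proof
      fix z
      have "degree ?p \<le> D" by (intro degree_le) (simp add: co)
      then have "poly ?p z = (\<Sum>k\<le>D. coeff ?p k * z ^ k)"
        unfolding poly_altdef by (intro sum.mono_neutral_left) (auto simp: coeff_eq_0)
      also have "\<dots> = s z" unfolding s_def by (intro sum.cong) (auto simp: co)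
      finally show "poly ?p z = s z" .
    qed
    then have "s has_fps_expansion fps_of_poly ?p" using poly_has_fps_expansion[of ?p] by simp
    from fps_expansion_eqI[OF this] show ?thesis by (simp add: co)
  qed
  have gc: "continuous_on {0..1} (\<lambda>t. g (on_circle t))"
    by (rule continuous_on_compose2[OF holomorphic_on_imp_continuous_on[OF g]])
       (use R in \<open>auto intro!: continuous_intros\<close>)
  have inner: "((\<lambda>t. f (on_circle t) * cnj (s (on_circle t))) has_integral
      (\<Sum>k\<le>D. cnj (c k) * fps_nth (fps_expansion f 0) k)) {0..1}" if f: "f holomorphic_on ball 0 R" for f
  proof -
    have "((\<lambda>t. \<Sum>k\<le>D. cnj (c k) * (f (on_circle t) * cnj (on_circle t ^ k))) has_integral
      (\<Sum>k\<le>D. cnj (c k) * fps_nth (fps_expansion f 0) k)) {0..1}"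
      by (intro has_integral_sum has_integral_mult_right cauchy_coefficient[OF f R]) auto
    then show ?thesis
      by (rule has_integral_eq[rotated]) (simp add: s_def sum_distrib_left mult_ac)
  qed
  define S where "S = (\<Sum>k\<le>D. (cmod (c k))\<^sup>2)"
  have cc: "(\<Sum>k\<le>D. cnj (c k) * c k) = of_real S"
    unfolding S_def of_real_sum by (intro sum.cong refl) (metis complex_norm_square mult.commute)
  have "((\<lambda>t. Re (g (on_circle t) * cnj (s (on_circle t)))) has_integral S) {0..1}"
    using has_integral_Re[OF inner[OF g]] by (simp add: c_def[symmetric] cc)
  moreover have "((\<lambda>t. Re (s (on_circle t) * cnj (s (on_circle t)))) has_integral S) {0..1}"
    using has_integral_Re[OF inner[OF sh]] by (simp add: sc cc)
  ultimately have I: "((\<lambda>t. 2 * Re (g (on_circle t) * cnj (s (on_circle t))) - Re (s (on_circle t) * cnj (s (on_circle t)))) has_integral 2 * S - S) {0..1}"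
    by (intro has_integral_diff has_integral_mult_right)
  have "2 * S - S \<le> integral {0..1} (\<lambda>t. (cmod (g (on_circle t)))\<^sup>2)"
  proof (rule has_integral_le[OF I integrable_integral])
    show "(\<lambda>t. (cmod (g (on_circle t)))\<^sup>2) integrable_on {0..1}"
      by (intro integrable_continuous_interval continuous_intros gc)
  next
    fix t
    have "0 \<le> (cmod (g (on_circle t) - s (on_circle t)))\<^sup>2" by simp
    then show "2 * Re (g (on_circle t) * cnj (s (on_circle t))) - Re (s (on_circle t) * cnj (s (on_circle t)))
       \<le> (cmod (g (on_circle t)))\<^sup>2"
      unfolding cmod_power2 by (simp add: power2_eq_square algebra_simps)
  qed
  then show ?thesis by (simp add: S_def c_def)
qed

text \<open>
  The two factors share the modulus of \<open>f\<close> equally on the circle.  A root outside the disc gives each of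
  them a holomorphic square root of its linear factor.  For a root \<open>\<rho>\<close> inside, \<open>z - \<rho>\<close> has the same
  modulus on the circle as \<open>1 - cnj \<rho> * z\<close>, which has a square root; the quotient is a Blaschke
  factor and goes into \<open>g\<close>.
\<close>

lemma carleman_factorization:
  fixes f :: "complex poly"
  assumes "f \<noteq> 0" "\<And>z. poly f z = 0 \<Longrightarrow> cmod z \<noteq> 1"
  shows "\<exists>R>1. \<exists>g h. g holomorphic_on ball 0 R \<and> h holomorphic_on ball 0 R \<and>
     (\<forall>z\<in>ball 0 R. poly f z = g z * h z) \<and> (\<forall>z. cmod z = 1 \<longrightarrow> cmod (g z) = cmod (h z))"
  using assms
proof (induction "degree f" arbitrary: f)
  case 0
  then obtain c where c: "f = [:c:]" by (metis degree_eq_zeroE)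
  have "poly f z = csqrt c * csqrt c" for z
    using power2_csqrt[of c] by (simp only: c power2_eq_square) simp
  then have "(\<lambda>_. csqrt c) holomorphic_on ball 0 2 \<and> (\<lambda>_. csqrt c) holomorphic_on ball 0 2 \<and>
     (\<forall>z\<in>ball 0 2. poly f z = csqrt c * csqrt c) \<and> (\<forall>z::complex. cmod z = 1 \<longrightarrow> cmod (csqrt c) = cmod (csqrt c))"
    by (auto intro: holomorphic_on_const)
  then show ?case by (intro exI[of _ 2] conjI exI[of _ "\<lambda>_. csqrt c"]) auto
next
  case (Suc d)
  then have "\<nexists>a l. a \<noteq> 0 \<and> l = 0 \<and> f = pCons a l" by auto
  then obtain \<rho> where \<rho>: "poly f \<rho> = 0" using Fundamental_Theorem_Algebra.fundamental_theorem_of_algebra_alt by blast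
  then obtain f1 where f1: "f = [:-\<rho>, 1:] * f1" by (metis dvdE poly_eq_0_iff_dvd)
  have "f1 \<noteq> 0" using Suc f1 by auto
  then have "d = degree f1" using Suc.hyps(2) unfolding f1 by (subst (asm) degree_mult_eq) auto
  moreover have "cmod z \<noteq> 1" if "poly f1 z = 0" for z using Suc.prems(2)[of z] that by (simp add: f1)
  ultimately obtain R g h where R: "R > 1" and g: "g holomorphic_on ball 0 R" and h: "h holomorphic_on ball 0 R"
    and eq: "\<And>z. z \<in> ball 0 R \<Longrightarrow> poly f1 z = g z * h z" and n: "\<And>z. cmod z = 1 \<Longrightarrow> cmod (g z) = cmod (h z)"
    using Suc.hyps(1)[of f1] \<open>f1 \<noteq> 0\<close> by metis
  have pos: "1 - w \<notin> \<real>\<^sub>\<le>\<^sub>0" if "cmod w < 1" for w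
  proof -
    have "Re w < 1" using complex_Re_le_cmod[of w] that by linarith
    then show ?thesis by (auto simp: complex_nonpos_Reals_iff)
  qed
  have \<rho>1: "cmod \<rho> \<noteq> 1" using Suc.prems(2) \<rho> by blast
  show ?case
  proof (cases "cmod \<rho> > 1")
    case True
    define s where "s z = csqrt (- \<rho>) * csqrt (1 - z / \<rho>)" for z
    define R' where "R' = min R (cmod \<rho>)"
    have sub: "ball 0 R' \<subseteq> ball 0 R" by (auto simp: R'_def)
    have "s holomorphic_on ball 0 R'"
      unfolding s_def using True
      by (intro holomorphic_intros pos) (auto simp: R'_def norm_divide divide_simps)
    moreover have "s z * s z = z - \<rho>" for z
    proof -
      have "s z * s z = (csqrt (- \<rho>))\<^sup>2 * (csqrt (1 - z / \<rho>))\<^sup>2" by (simp add: s_def power2_eq_square)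
      also have "\<dots> = z - \<rho>" using True by (cases "\<rho> = 0") (auto simp: algebra_simps)
      finally show ?thesis .
    qed
    ultimately have s: "s holomorphic_on ball 0 R'" "\<And>z. s z * s z = z - \<rho>" by blast+
    have "poly f z = (g z * s z) * (h z * s z)" if "z \<in> ball 0 R'" for z
    proof -
      have "poly f z = (z - \<rho>) * poly f1 z" by (simp add: f1 algebra_simps)
      also have "\<dots> = (s z * s z) * (g z * h z)" using eq[OF subsetD[OF sub that]] s(2)[of z] by simp
      finally show ?thesis by (simp add: mult_ac)
    qed
    moreover have "(\<lambda>z. g z * s z) holomorphic_on ball 0 R'" "(\<lambda>z. h z * s z) holomorphic_on ball 0 R'"
      using holomorphic_on_subset[OF g sub] holomorphic_on_subset[OF h sub] s(1)
      by (auto intro: holomorphic_on_mult)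
    moreover have "cmod (g z * s z) = cmod (h z * s z)" if "cmod z = 1" for z
      using n[OF that] by (simp add: norm_mult)
    moreover have "R' > 1" using R True by (simp add: R'_def)
    ultimately show ?thesis by blast
  next
    case False
    then have r: "cmod \<rho> < 1" using \<rho>1 by simp
    define t where "t z = csqrt (1 - cnj \<rho> * z)" for z
    define R' where "R' = min R (2 / (1 + cmod \<rho>))"
    have sub: "ball 0 R' \<subseteq> ball 0 R" by (auto simp: R'_def)
    have p1: "1 + cmod \<rho> > 0" using norm_ge_zero[of \<rho>] by linarith
    have R'1: "R' > 1" using R r p1 by (simp add: R'_def field_simps)
    have small: "cmod (cnj \<rho> * z) < 1" if "z \<in> ball 0 R'" for z
    proof -
      have "cmod z * (1 + cmod \<rho>) < 2" using that p1 by (simp add: R'_def field_simps)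
      then have "cmod \<rho> * (cmod z * (1 + cmod \<rho>)) \<le> cmod \<rho> * 2" by (intro mult_left_mono) auto
      also have "\<dots> < 1 + cmod \<rho>" using r by simp
      finally have "(cmod \<rho> * cmod z) * (1 + cmod \<rho>) < 1 * (1 + cmod \<rho>)" by (simp add: mult_ac)
      then show ?thesis using p1 by (simp only: mult_less_cancel_right_pos norm_mult complex_mod_cnj)
    qed
    have th: "t holomorphic_on ball 0 R'"
      unfolding t_def by (intro holomorphic_intros pos small)
    have tsq: "t z * t z = 1 - cnj \<rho> * z" for z
      unfolding t_def power2_eq_square[symmetric] by (rule power2_csqrt)
    have tnz: "t z \<noteq> 0" if "z \<in> ball 0 R'" for z
      using small[OF that] tsq[of z] by auto
    have norm_eq: "cmod (g z * ((z - \<rho>) / t z)) = cmod (h z * t z)" if z: "cmod z = 1" for z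
    proof -
      have z': "z \<in> ball 0 R'" using z R'1 by simp
      have "cmod (z - \<rho>) = cmod (cnj z * (z - \<rho>))" using z by (simp add: norm_mult)
      also have "cnj z * (z - \<rho>) = cnj (1 - cnj \<rho> * z)"
      proof -
        have "cnj z * z = 1" using z complex_norm_square[of z] by (metis mult.commute of_real_1 power_one)
        then show ?thesis by (simp add: right_diff_distrib mult.commute)
      qed
      also have "cmod \<dots> = cmod (t z) * cmod (t z)"
        unfolding complex_mod_cnj norm_mult[symmetric] tsq ..
      finally show ?thesis using tnz[OF z'] n[OF z] by (simp add: norm_mult norm_divide)
    qed
    have "poly f z = (g z * ((z - \<rho>) / t z)) * (h z * t z)" if "z \<in> ball 0 R'" for z
    proof -
      have "poly f z = (z - \<rho>) * poly f1 z" by (simp add: f1 algebra_simps)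
      also have "\<dots> = (z - \<rho>) * (g z * h z)" using eq[OF subsetD[OF sub that]] by simp
      finally show ?thesis using tnz[OF that] by simp
    qed
    moreover have "(\<lambda>z. g z * ((z - \<rho>) / t z)) holomorphic_on ball 0 R'" "(\<lambda>z. h z * t z) holomorphic_on ball 0 R'"
      using holomorphic_on_subset[OF g sub] holomorphic_on_subset[OF h sub] th tnz
      by (auto intro!: holomorphic_intros)
    ultimately show ?thesis using R'1 norm_eq by blast
  qed
qed

text \<open>
  The \<open>l\<close>-th coefficient of a product \<open>g h\<close> is a sum of \<open>l + 1\<close> terms, so the Cauchy-Schwarz inequality
  bounds the left-hand side by the product of the \<open>L\<^sup>2\<close> norms of the factors, and both are equal to
  the square root of the \<open>L\<^sup>1\<close> norm of \<open>f\<close>.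
\<close>

lemma carleman_inequality_nonvanishing:
  fixes f :: "complex poly"
  assumes "f \<noteq> 0" "\<And>z. poly f z = 0 \<Longrightarrow> cmod z \<noteq> 1"
  shows "(\<Sum>l\<le>D. (cmod (coeff f l))\<^sup>2 / (real l + 1)) \<le> (integral {0..1} (\<lambda>t. cmod (poly f (on_circle t))))\<^sup>2"
proof -
  from carleman_factorization[OF assms] obtain R g h where R: "R > 1"
    and g: "g holomorphic_on ball 0 R" and h: "h holomorphic_on ball 0 R"
    and eq: "\<And>z. z \<in> ball 0 R \<Longrightarrow> poly f z = g z * h z" and n: "\<And>z. cmod z = 1 \<Longrightarrow> cmod (g z) = cmod (h z)"
    by metis
  define G where "G = fps_nth (fps_expansion g 0)"
  define K where "K = fps_nth (fps_expansion h 0)"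
  have "(\<lambda>z. g z * h z) has_fps_expansion fps_expansion g 0 * fps_expansion h 0"
    using R g h by (intro has_fps_expansion_mult has_fps_expansion_fps_expansion[of "ball 0 R"]) auto
  moreover note poly_has_fps_expansion[of f]
  moreover have "eventually (\<lambda>z. poly f z = g z * h z) (nhds 0)"
    using R eq by (intro eventually_nhds_in_open[THEN eventually_mono, of "ball 0 R"]) auto
  ultimately have "fps_expansion g 0 * fps_expansion h 0 = fps_of_poly f"
    using fps_expansion_unique_complex[of "poly f"] has_fps_expansion_cong[of "poly f" "\<lambda>z. g z * h z"]
    by blast
  then have "coeff f l = fps_nth (fps_expansion g 0 * fps_expansion h 0) l" for l by simp
  then have co: "coeff f l = (\<Sum>i=0..l. G i * K (l - i))" for l
    unfolding G_def K_def fps_mult_nth .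
  have term_le: "(cmod (coeff f l))\<^sup>2 / (real l + 1) \<le> (\<Sum>i=0..l. (cmod (G i))\<^sup>2 * (cmod (K (l - i)))\<^sup>2)" for l
  proof -
    have "(cmod (coeff f l))\<^sup>2 \<le> (\<Sum>i=0..l. cmod (G i * K (l - i)))\<^sup>2"
      unfolding co by (intro power_mono norm_sum) auto
    also have "\<dots> \<le> (real l + 1) * (\<Sum>i=0..l. (cmod (G i * K (l - i)))\<^sup>2)"
      using sum_squared_le_sum_of_squares[of "\<lambda>i. cmod (G i * K (l - i))" "{0..l}"] by (simp add: add.commute mult.commute)
    finally show ?thesis by (simp add: norm_mult power_mult_distrib field_simps)
  qed
  have "(\<Sum>l\<le>D. (cmod (coeff f l))\<^sup>2 / (real l + 1)) \<le> (\<Sum>l\<le>D. \<Sum>i=0..l. (cmod (G i))\<^sup>2 * (cmod (K (l - i)))\<^sup>2)"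
    by (intro sum_mono term_le)
  also have "\<dots> = (\<Sum>(i,j)\<in>{(i,j). i + j \<le> D}. (cmod (G i))\<^sup>2 * (cmod (K j))\<^sup>2)"
    by (simp add: sum.triangle_reindex_eq atMost_atLeast0)
  also have "\<dots> \<le> (\<Sum>(i,j)\<in>{..D} \<times> {..D}. (cmod (G i))\<^sup>2 * (cmod (K j))\<^sup>2)"
    by (intro sum_mono2) auto
  also have "\<dots> = (\<Sum>i\<le>D. (cmod (G i))\<^sup>2) * (\<Sum>i\<le>D. (cmod (K i))\<^sup>2)"
    by (simp add: sum_product sum.cartesian_product)
  also have "\<dots> \<le> integral {0..1} (\<lambda>t. (cmod (g (on_circle t)))\<^sup>2) * integral {0..1} (\<lambda>t. (cmod (h (on_circle t)))\<^sup>2)"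
    unfolding G_def K_def
    by (intro mult_mono bessel_inequality_circle[OF g R] bessel_inequality_circle[OF h R] sum_nonneg integral_nonneg)
      (use R in \<open>auto intro!: integrable_continuous_interval continuous_intros
         continuous_on_compose2[OF holomorphic_on_imp_continuous_on[OF g]]\<close>)
  also have "(\<lambda>t. (cmod (h (on_circle t)))\<^sup>2) = (\<lambda>t. cmod (poly f (on_circle t)))"
    using R by (auto simp: eq n norm_mult power2_eq_square)
  also have "(\<lambda>t. (cmod (g (on_circle t)))\<^sup>2) = (\<lambda>t. cmod (poly f (on_circle t)))"
    using R by (auto simp: eq n norm_mult power2_eq_square)
  finally show ?thesis by (simp add: power2_eq_square)
qed

text \<open>
  On the grid of \<open>N\<close>-th roots of unity, monomials of degree below \<open>N\<close> are still orthonormal.  Averages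
  over the grid will replace integrals.
\<close>

lemma unit_root_orthogonality:
  fixes a b N :: nat
  assumes ab: "a < N" "b < N"
  shows "(\<Sum>e<N. on_circle (real e / real N) ^ a * cnj (on_circle (real e / real N) ^ b)) = (if a = b then of_nat N else 0)"
proof -
  define \<zeta> where "\<zeta> = cis (2 * pi * (real a - real b) / N)"
  have N: "N > 0" using ab by simp
  have "on_circle (real e / real N) ^ a * cnj (on_circle (real e / real N) ^ b) = \<zeta> ^ e" for e :: nat
    unfolding \<zeta>_def on_circle_def Complex.DeMoivre cis_cnj cis_mult
    using N by (intro arg_cong[of _ _ cis]) (simp add: field_simps)
  then have eq: "(\<Sum>e<N. on_circle (real e / real N) ^ a * cnj (on_circle (real e / real N) ^ b)) = (\<Sum>e<N. \<zeta> ^ e)" by simp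
  show ?thesis
  proof (cases "a = b")
    case True then show ?thesis unfolding eq by (simp add: \<zeta>_def)
  next
    case False
    have "\<zeta> ^ N = cis (2 * pi * of_int (int a - int b))"
      unfolding \<zeta>_def Complex.DeMoivre using N by (intro arg_cong[of _ _ cis]) (simp add: field_simps)
    also have "\<dots> = 1" by (rule cis_multiple_2pi) simp
    finally have pow: "\<zeta> ^ N = 1" .
    have "\<zeta> \<noteq> 1"
    proof
      assume "\<zeta> = 1"
      then have "cos (2 * pi * (real a - real b) / N) = 1" by (simp add: \<zeta>_def complex_eq_iff)
      then obtain i :: int where "2 * pi * (real a - real b) / N = real_of_int i * 2 * pi"
        using cos_one_2pi_int by blast
      then have "(2 * pi) * ((real a - real b) / N) = (2 * pi) * real_of_int i" by (simp add: mult_ac)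
      then have "(real a - real b) / N = real_of_int i" using pi_gt_zero by (simp only: mult_cancel_left) simp
      then have "real a - real b = i * N" using N by (simp add: field_simps)
      then have i: "int a - int b = i * int N" by (metis of_int_diff of_int_eq_iff of_int_mult of_int_of_nat_eq)
      have "\<bar>int a - int b\<bar> < int N" using ab by linarith
      then have "\<bar>i\<bar> * int N < 1 * int N" using i by (simp add: abs_mult)
      then have "i = 0" using N by simp
      then show False using i False by simp
    qed
    then show ?thesis unfolding eq using False pow by (simp add: geometric_sum)
  qed
qed

lemma integral_le_grid_average:
  fixes F :: "real \<Rightarrow> real" and N :: nat
  assumes N: "N > 0" and F: "continuous_on {0..1} F"
    and le: "\<And>e t. e < N \<Longrightarrow> real e / N \<le> t \<Longrightarrow> t \<le> real (Suc e) / N \<Longrightarrow> F t \<le> c e"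
  shows "integral {0..1} F \<le> (\<Sum>e<N. c e) / N"
proof -
  have int: "F integrable_on {real a / N..real b / N}" if "b \<le> N" for a b
    using that N by (intro integrable_continuous_interval continuous_on_subset[OF F]) (auto simp: field_simps)
  have "integral {0..real k / N} F \<le> (\<Sum>e<k. c e) / N" if "k \<le> N" for k
    using that
  proof (induction k)
    case 0 then show ?case by simp
  next
    case (Suc k)
    have "integral {0..real (Suc k) / N} F = integral {0..real k / N} F + integral {real k / N..real (Suc k) / N} F"
      using int[of "Suc k" 0] Suc.prems by (intro Henstock_Kurzweil_Integration.integral_combine[symmetric]) (auto simp: divide_right_mono)
    also have "integral {real k / N..real (Suc k) / N} F \<le> integral {real k / N..real (Suc k) / N} (\<lambda>_. c k)"
      using Suc.prems by (intro integral_le int le) auto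
    also have "\<dots> = c k / N" by (simp add: divide_right_mono diff_divide_distrib[symmetric])
    finally show ?case using Suc by (simp add: add_divide_distrib)
  qed
  from this[of N] show ?thesis using N by simp
qed

lemma coeff_le_grid_average:
  fixes f :: "complex poly"
  assumes D: "degree f \<le> D" and N: "D < N"
  shows "cmod (coeff f l) \<le> (\<Sum>e<N. cmod (poly f (on_circle (real e / real N)))) / N"
proof (cases "l \<le> D")
  case True
  have "(\<Sum>e<N. poly f (on_circle (real e / real N)) * cnj (on_circle (real e / real N) ^ l))
      = (\<Sum>e<N. \<Sum>i\<le>D. coeff f i * (on_circle (real e / real N) ^ i * cnj (on_circle (real e / real N) ^ l)))"
  proof (intro sum.cong refl)
    fix e
    have "poly f x = (\<Sum>i\<le>D. coeff f i * x ^ i)" for x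
      unfolding poly_altdef using D by (intro sum.mono_neutral_left) (auto simp: coeff_eq_0)
    then show "poly f (on_circle (real e / N)) * cnj (on_circle (real e / real N) ^ l) = (\<Sum>i\<le>D. coeff f i * (on_circle (real e / real N) ^ i * cnj (on_circle (real e / real N) ^ l)))"
      by (simp add: sum_distrib_right mult.assoc)
  qed
  also have "\<dots> = (\<Sum>i\<le>D. coeff f i * (\<Sum>e<N. on_circle (real e / real N) ^ i * cnj (on_circle (real e / real N) ^ l)))"
    unfolding sum_distrib_left by (rule sum.swap)
  also have "\<dots> = (\<Sum>i\<le>D. coeff f i * (if i = l then of_nat N else 0))"
  proof (intro sum.cong refl)
    fix i assume "i \<in> {..D}"
    then have "i < N" "l < N" using N True by auto
    from unit_root_orthogonality[OF this]
    show "coeff f i * (\<Sum>e<N. on_circle (real e / real N) ^ i * cnj (on_circle (real e / real N) ^ l)) = coeff f i * (if i = l then of_nat N else 0)"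
      by simp
  qed
  also have "\<dots> = coeff f l * of_nat N" using True by (simp add: if_distrib[of "\<lambda>x. _ * x"] cong: if_cong)
  finally have "coeff f l = (\<Sum>e<N. poly f (on_circle (real e / real N)) * cnj (on_circle (real e / real N) ^ l)) / of_nat N"
    using N by (simp add: field_simps)
  also have "cmod \<dots> \<le> (\<Sum>e<N. cmod (poly f (on_circle (real e / real N)) * cnj (on_circle (real e / real N) ^ l))) / N"
    unfolding norm_divide by (simp add: divide_right_mono norm_sum)
  also have "\<dots> = (\<Sum>e<N. cmod (poly f (on_circle (real e / real N)))) / N"
    by (simp add: norm_mult norm_power)
  finally show ?thesis .
next
  case False
  then show ?thesis using D by (simp add: coeff_eq_0 sum_nonneg)
qed

text \<open>
  The price of replacing the integral of \<open>\<bar>f\<bar>\<close> over the circle by its average over \<open>N\<close>-th roots of unity,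
  for polynomials of degree at most \<open>D\<close>.  It tends to \<open>1\<close>, so that even its power over all the variables
  disappears in the limit.
\<close>

definition grid_distortion :: "nat \<Rightarrow> nat \<Rightarrow> real" where
  "grid_distortion D N = 1 + 2 * pi * (D * (D + 1)) / N"

lemma grid_distortion_tendsto: "(\<lambda>N. grid_distortion D N) \<longlonglongrightarrow> 1"
  unfolding grid_distortion_def by real_asymp

text \<open>
  Zeros on the unit circle are avoided by passing to \<open>f (r z)\<close> with \<open>r < 1\<close> close to \<open>1\<close>.  The Lipschitz
  constant of \<open>f\<close>, needed to compare the circle with the grid, is at most \<open>D (D + 1)\<close> times the average
  of \<open>\<bar>f\<bar>\<close> because every coefficient is bounded by that average.  The weights \<open>l + 1\<close> are weakened to
  \<open>2 ^ l\<close> because these are multiplicative in several variables and constant on homogeneous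
  polynomials.
\<close>

lemma carleman_inequality_grid:
  fixes f :: "complex poly"
  assumes D: "degree f \<le> D" and N: "D < N"
  shows "(\<Sum>l\<le>D. (cmod (coeff f l))\<^sup>2 / 2 ^ l)
     \<le> (grid_distortion D N * ((\<Sum>e<N. cmod (poly f (on_circle (real e / real N)))) / N))\<^sup>2"
proof (cases "f = 0")
  case True then show ?thesis by simp
next
  case False
  define avg where "avg = (\<Sum>e<N. cmod (poly f (on_circle (real e / real N)))) / N"
  have avg: "avg \<ge> 0" by (simp add: avg_def sum_nonneg)
  define L where "L = (\<Sum>l\<le>D. real l * cmod (coeff f l))"
  have L: "L \<ge> 0" by (simp add: L_def sum_nonneg)
  have lip: "cmod (poly f z - poly f w) \<le> L * cmod (z - w)" if "cmod z \<le> 1" "cmod w \<le> 1" for z w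
  proof -
    have "poly f x = (\<Sum>i\<le>D. coeff f i * x ^ i)" for x
      unfolding poly_altdef using D by (intro sum.mono_neutral_left) (auto simp: coeff_eq_0)
    then have "poly f z - poly f w = (\<Sum>i\<le>D. coeff f i * (z ^ i - w ^ i))"
      by (simp add: right_diff_distrib sum_subtractf)
    also have "cmod \<dots> \<le> (\<Sum>i\<le>D. cmod (coeff f i) * (i * cmod (z - w)))"
      by (intro sum_norm_le) (simp add: norm_mult mult_left_mono norm_power_diff that)
    also have "\<dots> = L * cmod (z - w)" by (simp add: L_def sum_distrib_left sum_distrib_right mult_ac)
    finally show ?thesis .
  qed
  have scaled: "(\<Sum>l\<le>D. (cmod (coeff f l) * r ^ l)\<^sup>2 / (real l + 1)) \<le> (avg + L * (2 * pi / N + (1 - r)))\<^sup>2"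
    if r: "0 < r" "r < 1" and nv: "\<And>z. poly f z = 0 \<Longrightarrow> cmod z \<noteq> r" for r
  proof -
    define h where "h = pcompose f [:0, of_real r:]"
    have hc: "coeff h l = coeff f l * of_real r ^ l" for l
      by (simp add: h_def coeff_pcompose_linear)
    have hp: "poly h z = poly f (of_real r * z)" for z by (simp add: h_def poly_pcompose mult.commute)
    have h0: "h \<noteq> 0"
    proof
      assume "h = 0"
      then have "coeff f l = 0" for l using hc[of l] r by simp
      then show False using False by (simp add: poly_eq_iff)
    qed
    have "(\<Sum>l\<le>D. (cmod (coeff h l))\<^sup>2 / (real l + 1)) \<le> (integral {0..1} (\<lambda>t. cmod (poly h (on_circle t))))\<^sup>2"
    proof (rule carleman_inequality_nonvanishing[OF h0])
      fix z assume "poly h z = 0"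
      then have "cmod (of_real r * z) \<noteq> r" using nv by (simp add: hp)
      then show "cmod z \<noteq> 1" using r by (simp add: norm_mult)
    qed
    then have 1: "(\<Sum>l\<le>D. (cmod (coeff h l))\<^sup>2 / (real l + 1)) \<le> (integral {0..1} (\<lambda>t. cmod (poly h (on_circle t))))\<^sup>2" .
    have "integral {0..1} (\<lambda>t. cmod (poly h (on_circle t)))
       \<le> (\<Sum>e<N. cmod (poly f (on_circle (real e / real N))) + L * (2 * pi / N + (1 - r))) / N"
    proof (rule integral_le_grid_average)
      show "N > 0" using N by simp
      show "continuous_on {0..1} (\<lambda>t. cmod (poly h (on_circle t)))" by (intro continuous_intros)
      fix e t assume t: "real e / N \<le> t" "t \<le> real (Suc e) / N"
      have "cmod (of_real r * on_circle t - on_circle (real e / real N))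
         \<le> cmod ((of_real r - 1) * on_circle t) + cmod (on_circle t - on_circle (real e / real N))"
        by (intro order_trans[OF _ norm_triangle_ineq]) (simp add: algebra_simps)
      also have "cmod ((of_real r - 1) * on_circle t) = 1 - r"
        using r norm_of_real[of "r - 1", where 'a = complex] by (simp add: norm_mult)
      also have "cmod (on_circle t - on_circle (real e / real N)) \<le> 2 * pi * \<bar>t - e / N\<bar>" by (rule norm_on_circle_diff_le)
      also have "\<bar>t - e / N\<bar> \<le> 1 / N" using t by (simp add: add_divide_distrib)
      finally have "cmod (of_real r * on_circle t - on_circle (real e / real N)) \<le> 2 * pi / N + (1 - r)"
        by (simp add: mult_left_mono)
      then have "cmod (poly f (of_real r * on_circle t) - poly f (on_circle (real e / real N))) \<le> L * (2 * pi / N + (1 - r))"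
        using r L by (intro order_trans[OF lip] mult_left_mono) (auto simp: norm_mult)
      then show "cmod (poly h (on_circle t)) \<le> cmod (poly f (on_circle (real e / real N))) + L * (2 * pi / N + (1 - r))"
        unfolding hp using norm_triangle_sub[of "poly f (of_real r * on_circle t)" "poly f (on_circle (real e / real N))"] by linarith
    qed
    also have "\<dots> = avg + L * (2 * pi / N + (1 - r))"
      using N by (simp add: avg_def sum.distrib add_divide_distrib)
    finally have "(integral {0..1} (\<lambda>t. cmod (poly h (on_circle t))))\<^sup>2 \<le> (avg + L * (2 * pi / N + (1 - r)))\<^sup>2"
      by (intro power_mono integral_nonneg integrable_continuous_interval continuous_intros) auto
    with 1 show ?thesis using r by (simp add: hc norm_mult norm_power)
  qed
  have "finite (cmod ` {z. poly f z = 0})" using poly_roots_finite[OF False] by simp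
  then have "\<forall>\<^sub>F r in at_left (1::real). r \<notin> cmod ` {z. poly f z = 0}"
    using islimpt_finite[of "cmod ` {z. poly f z = 0}" 1] unfolding islimpt_iff_eventually
    by (auto simp: eventually_at_filter eventually_at_left elim: eventually_mono)
  moreover have "\<forall>\<^sub>F r in at_left (1::real). r \<in> {0<..<1}"
    by (intro eventually_at_leftI[of 0]) auto
  ultimately have ev: "\<forall>\<^sub>F r in at_left (1::real).
      (\<Sum>l\<le>D. (cmod (coeff f l) * r ^ l)\<^sup>2 / (real l + 1)) \<le> (avg + L * (2 * pi / N + (1 - r)))\<^sup>2"
    by eventually_elim (intro scaled, auto)
  have "(\<Sum>l\<le>D. (cmod (coeff f l) * 1 ^ l)\<^sup>2 / (real l + 1)) \<le> (avg + L * (2 * pi / N + (1 - 1)))\<^sup>2"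
    by (rule tendsto_le[OF _ _ _ ev]) (auto intro!: tendsto_eq_intros)
  moreover have "L \<le> D * (D + 1) * avg"
  proof -
    have "L \<le> (\<Sum>l\<le>D. D * avg)" unfolding L_def
      using coeff_le_grid_average[OF D N] avg by (intro sum_mono mult_mono) (auto simp: avg_def)
    then show ?thesis by (simp add: algebra_simps)
  qed
  then have "L * (2 * pi / N) \<le> D * (D + 1) * avg * (2 * pi / N)" by (intro mult_right_mono) auto
  then have "avg + L * (2 * pi / N) \<le> grid_distortion D N * avg"
    by (simp add: grid_distortion_def algebra_simps add_divide_distrib)
  then have "(avg + L * (2 * pi / N))\<^sup>2 \<le> (grid_distortion D N * avg)\<^sup>2"
    using avg L by (intro power_mono) auto
  moreover have "(\<Sum>l\<le>D. (cmod (coeff f l))\<^sup>2 / 2 ^ l) \<le> (\<Sum>l\<le>D. (cmod (coeff f l))\<^sup>2 / (real l + 1))"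
  proof (intro sum_mono divide_left_mono)
    fix l :: nat
    have "Suc l \<le> 2 ^ l" by (simp add: Suc_leI)
    then have "real (Suc l) \<le> real (2 ^ l)" by (rule of_nat_mono)
    then show "real l + 1 \<le> 2 ^ l" by simp
  qed auto
  ultimately show ?thesis by (simp add: avg_def)
qed

section \<open>Norm comparison on the discrete torus\<close>

text \<open>
  An iterated finite average instead of an integral over the torus: it is linear and monotone for
  arbitrary functions.
\<close>

fun torus_avg :: "nat \<Rightarrow> nat \<Rightarrow> ((nat \<Rightarrow> complex) \<Rightarrow> 'a::real_vector) \<Rightarrow> 'a" where
  "torus_avg N 0 f = f (\<lambda>_. 1)"
| "torus_avg N (Suc n) f = (1 / real N) *\<^sub>R (\<Sum>e<N. torus_avg N n (\<lambda>z. f (z(n := on_circle (real e / real N)))))"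

lemma torus_avg_sum: "torus_avg N n (\<lambda>z. \<Sum>i\<in>I. f i z) = (\<Sum>i\<in>I. torus_avg N n (f i))"
proof (induction n arbitrary: f)
  case 0 then show ?case by simp
next
  case (Suc n)
  then show ?case by (simp add: scaleR_sum_right sum.swap[of _ I])
qed

lemma torus_avg_bounded_linear:
  assumes "bounded_linear h"
  shows "torus_avg N n (\<lambda>z. h (f z)) = h (torus_avg N n f)"
proof (induction n arbitrary: f)
  case 0 then show ?case by simp
next
  case (Suc n)
  interpret bounded_linear h by fact
  show ?case by (simp add: Suc sum scaleR)
qed

lemmas torus_avg_mult_left = torus_avg_bounded_linear[OF bounded_linear_mult_right]
lemmas torus_avg_of_real = torus_avg_bounded_linear[OF bounded_linear_of_real]

lemma torus_avg_mono:
  fixes f g :: "(nat \<Rightarrow> complex) \<Rightarrow> real"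
  assumes "\<And>z. (\<And>j. cmod (z j) = 1) \<Longrightarrow> f z \<le> g z"
  shows "torus_avg N n f \<le> torus_avg N n g"
  using assms
proof (induction n arbitrary: f g)
  case 0 then show ?case by simp
next
  case (Suc n)
  show ?case by (auto intro!: divide_right_mono sum_mono Suc)
qed

lemma torus_avg_const: "N > 0 \<Longrightarrow> torus_avg N n (\<lambda>_. c) = c"
  by (induction n) (simp_all add: scaleR_left.sum[symmetric] sum_constant_scaleR del: sum_constant)

lemma torus_avg_nonneg:
  fixes f :: "(nat \<Rightarrow> complex) \<Rightarrow> real"
  shows "(\<And>z. 0 \<le> f z) \<Longrightarrow> 0 \<le> torus_avg N n f"
  by (induction n arbitrary: f) (auto intro!: sum_nonneg divide_nonneg_nonneg)

lemma torus_avg_le_const: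
  fixes f :: "(nat \<Rightarrow> complex) \<Rightarrow> real"
  assumes "N > 0" "\<And>z. (\<And>j. cmod (z j) = 1) \<Longrightarrow> f z \<le> c"
  shows "torus_avg N n f \<le> c"
  using torus_avg_mono[of f "\<lambda>_. c" N n] assms by (simp add: torus_avg_const)

text \<open>
  Test the vector of averages against itself and apply the Cauchy-Schwarz inequality pointwise.
\<close>

lemma torus_avg_minkowski:
  fixes F :: "'i \<Rightarrow> (nat \<Rightarrow> complex) \<Rightarrow> real"
  shows "L2_set (\<lambda>k. torus_avg N n (F k)) S \<le> torus_avg N n (\<lambda>z. L2_set (\<lambda>k. F k z) S)"
proof -
  define c where "c k = torus_avg N n (F k)" for k
  define C where "C = L2_set c S"
  have C0: "C \<ge> 0" by (simp add: C_def)
  have "C\<^sup>2 = (\<Sum>k\<in>S. c k * torus_avg N n (F k))"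
    by (simp add: C_def c_def L2_set_def sum_nonneg power2_eq_square)
  also have "\<dots> = torus_avg N n (\<lambda>z. \<Sum>k\<in>S. c k * F k z)"
    by (simp add: torus_avg_sum torus_avg_mult_left)
  also have "\<dots> \<le> torus_avg N n (\<lambda>z. C * L2_set (\<lambda>k. F k z) S)"
  proof (rule torus_avg_mono)
    fix z
    have "(\<Sum>k\<in>S. c k * F k z) \<le> (\<Sum>k\<in>S. \<bar>c k\<bar> * \<bar>F k z\<bar>)"
      by (intro sum_mono) (metis abs_ge_self abs_mult)
    also have "\<dots> \<le> C * L2_set (\<lambda>k. F k z) S" unfolding C_def by (rule L2_set_mult_ineq)
    finally show "(\<Sum>k\<in>S. c k * F k z) \<le> C * L2_set (\<lambda>k. F k z) S" .
  qed
  also have "\<dots> = C * torus_avg N n (\<lambda>z. L2_set (\<lambda>k. F k z) S)" by (rule torus_avg_mult_left)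
  finally have "C * C \<le> C * torus_avg N n (\<lambda>z. L2_set (\<lambda>k. F k z) S)" by (simp add: power2_eq_square)
  then have "C \<le> torus_avg N n (\<lambda>z. L2_set (\<lambda>k. F k z) S)"
    using C0 by (cases "C = 0") (auto intro!: torus_avg_nonneg simp: mult_le_cancel_left)
  then show ?thesis by (simp add: C_def c_def[abs_def])
qed

definition box_below :: "(nat \<Rightarrow> nat) \<Rightarrow> nat \<Rightarrow> (nat \<Rightarrow> nat) set" where
  "box_below \<gamma> n = {\<alpha>. (\<forall>i\<ge>n. \<alpha> i = 0) \<and> (\<forall>i<n. \<alpha> i \<le> \<gamma> i)}"

abbreviation "ebox D n \<equiv> box_below (\<lambda>_. D) n"

lemma box_below_0 [simp]: "box_below \<gamma> 0 = {\<lambda>_. 0}"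
  by (auto simp: box_below_def)

lemma box_below_Suc:
  "box_below \<gamma> (Suc n) = (\<lambda>(k, \<alpha>). \<alpha>(n := k)) ` ({..\<gamma> n} \<times> box_below \<gamma> n)"
proof -
  have "\<alpha> \<in> (\<lambda>(k, \<alpha>). \<alpha>(n := k)) ` ({..\<gamma> n} \<times> box_below \<gamma> n)" if "\<alpha> \<in> box_below \<gamma> (Suc n)" for \<alpha>
    using that by (intro image_eqI[of _ _ "(\<alpha> n, \<alpha>(n := 0))"]) (auto simp: box_below_def)
  then show ?thesis by (auto simp: box_below_def not_less less_Suc_eq)
qed

lemma finite_box_below [simp]: "finite (box_below \<gamma> n)"
  by (induction n) (auto simp: box_below_Suc)

lemma sum_box_below_Suc:
  "(\<Sum>\<alpha>\<in>box_below \<gamma> (Suc n). F \<alpha>) = (\<Sum>k\<le>\<gamma> n. \<Sum>\<alpha>\<in>box_below \<gamma> n. F (\<alpha>(n := k)))"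
proof -
  have "inj_on (\<lambda>(k, \<alpha>). \<alpha>(n := k)) ({..\<gamma> n} \<times> box_below \<gamma> n)"
  proof (rule inj_onI, clarify)
    fix k \<alpha> l \<beta>
    assume *: "\<alpha> \<in> box_below \<gamma> n" "\<beta> \<in> box_below \<gamma> n" and eq: "\<alpha>(n := k) = \<beta>(n := l)"
    have "\<alpha> i = \<beta> i" for i
      using * fun_cong[OF eq, of i] by (cases "i = n") (auto simp: box_below_def)
    moreover have "k = l" using fun_cong[OF eq, of n] by simp
    ultimately show "k = l \<and> \<alpha> = \<beta>" by auto
  qed
  then show ?thesis by (simp add: box_below_Suc sum.reindex sum.cartesian_product case_prod_unfold)
qed

lemma card_box_below_le: "card (box_below \<gamma> n) \<le> 2 ^ (\<Sum>i<n. \<gamma> i)"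
proof (induction n)
  case 0 then show ?case by simp
next
  case (Suc n)
  have "card (box_below \<gamma> (Suc n)) = (\<Sum>k\<le>\<gamma> n. \<Sum>\<alpha>\<in>box_below \<gamma> n. 1)"
    unfolding card_eq_sum by (rule sum_box_below_Suc)
  also have "\<dots> = Suc (\<gamma> n) * card (box_below \<gamma> n)" by simp
  also have "\<dots> \<le> 2 ^ \<gamma> n * 2 ^ (\<Sum>i<n. \<gamma> i)"
    using Suc by (intro mult_mono) (auto simp: Suc_leI)
  finally show ?case by (simp add: power_add mult.commute)
qed

definition monomial :: "nat \<Rightarrow> (nat \<Rightarrow> nat) \<Rightarrow> (nat \<Rightarrow> complex) \<Rightarrow> complex" where
  "monomial n \<alpha> z = (\<Prod>i<n. z i ^ \<alpha> i)"

definition box_poly :: "nat \<Rightarrow> nat \<Rightarrow> ((nat \<Rightarrow> nat) \<Rightarrow> complex) \<Rightarrow> (nat \<Rightarrow> complex) \<Rightarrow> complex" where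
  "box_poly D n a z = (\<Sum>\<alpha>\<in>ebox D n. a \<alpha> * monomial n \<alpha> z)"

lemma monomial_Suc: "monomial (Suc n) (\<alpha>(n := k)) (z(n := w)) = w ^ k * monomial n \<alpha> z"
  by (simp add: monomial_def mult.commute)

lemma box_poly_Suc:
  "box_poly D (Suc n) a (z(n := w)) = (\<Sum>k\<le>D. w ^ k * box_poly D n (\<lambda>\<alpha>. a (\<alpha>(n := k))) z)"
  unfolding box_poly_def sum_box_below_Suc monomial_Suc by (simp add: sum_distrib_left mult_ac)

lemma sum_exponents_Suc: "(\<Sum>i<Suc n. (\<alpha>(n := k)) i) = k + (\<Sum>i<n. \<alpha> i)" for \<alpha> :: "nat \<Rightarrow> nat"
  by simp

text \<open>
  Contractivity from \<open>L\<^sup>1\<close> to \<open>L\<^sup>2\<close> tensorises: apply the induction hypothesis to the coefficients in the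
  last variable, exchange the \<open>l\<^sup>2\<close> norm with the average by Minkowski's inequality, and use the
  one-variable inequality inside the average.
\<close>

lemma L1_L2_inequality_box:
  assumes N: "D < N"
  shows "(\<Sum>\<alpha>\<in>ebox D n. (cmod (a \<alpha>))\<^sup>2 / 2 ^ (\<Sum>i<n. \<alpha> i))
     \<le> (grid_distortion D N ^ n * torus_avg N n (\<lambda>z. cmod (box_poly D n a z)))\<^sup>2"
proof (induction n arbitrary: a)
  case 0 then show ?case by (simp add: box_poly_def monomial_def)
next
  case (Suc n)
  define \<kappa> where "\<kappa> = grid_distortion D N"
  have \<kappa>: "\<kappa> \<ge> 0" by (simp add: \<kappa>_def grid_distortion_def)
  define B where "B k = box_poly D n (\<lambda>\<alpha>. a (\<alpha>(n := k)))" for k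
  have "(\<Sum>\<alpha>\<in>ebox D (Suc n). (cmod (a \<alpha>))\<^sup>2 / 2 ^ (\<Sum>i<Suc n. \<alpha> i))
     = (\<Sum>k\<le>D. (\<Sum>\<alpha>\<in>ebox D n. (cmod (a (\<alpha>(n := k))))\<^sup>2 / 2 ^ (\<Sum>i<n. \<alpha> i)) / 2 ^ k)"
    unfolding sum_box_below_Suc sum_exponents_Suc by (simp add: power_add sum_divide_distrib mult.commute)
  also have "\<dots> \<le> (\<Sum>k\<le>D. (\<kappa> ^ n * torus_avg N n (\<lambda>z. cmod (B k z)))\<^sup>2 / 2 ^ k)"
    unfolding \<kappa>_def B_def by (intro sum_mono divide_right_mono Suc) auto
  also have "\<dots> = (\<kappa> ^ n)\<^sup>2 * (L2_set (\<lambda>k. torus_avg N n (\<lambda>z. (1 / sqrt (2 ^ k)) * cmod (B k z))) {..D})\<^sup>2"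
    unfolding torus_avg_mult_left
    by (simp add: L2_set_def sum_nonneg sum_distrib_left power_mult_distrib power_divide field_simps)
  also have "\<dots> \<le> (\<kappa> ^ n)\<^sup>2 * (torus_avg N n (\<lambda>z. L2_set (\<lambda>k. (1 / sqrt (2 ^ k)) * cmod (B k z)) {..D}))\<^sup>2"
    by (intro mult_left_mono power_mono torus_avg_minkowski) auto
  also have "\<dots> \<le> (\<kappa> ^ n)\<^sup>2 * (torus_avg N n (\<lambda>z. \<kappa> * ((\<Sum>e<N. cmod (box_poly D (Suc n) a (z(n := on_circle (real e / real N))))) / N)))\<^sup>2"
  proof (intro mult_left_mono power_mono torus_avg_mono torus_avg_nonneg)
    fix z :: "nat \<Rightarrow> complex"
    define f where "f = Abs_poly (\<lambda>k. if k \<le> D then B k z else 0)"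
    have co: "coeff f = (\<lambda>k. if k \<le> D then B k z else 0)"
      unfolding f_def by (intro coeff_Abs_poly[of D]) auto
    have deg: "degree f \<le> D" by (intro degree_le) (simp add: co)
    have pf: "poly f w = box_poly D (Suc n) a (z(n := w))" for w
    proof -
      have "poly f w = (\<Sum>k\<le>D. coeff f k * w ^ k)"
        unfolding poly_altdef using deg by (intro sum.mono_neutral_left) (auto simp: coeff_eq_0)
      then show ?thesis by (simp add: box_poly_Suc co B_def mult.commute)
    qed
    have "(\<Sum>l\<le>D. (cmod (coeff f l))\<^sup>2 / 2 ^ l)
     \<le> (\<kappa> * ((\<Sum>e<N. cmod (poly f (on_circle (real e / real N)))) / N))\<^sup>2"
      unfolding \<kappa>_def by (rule carleman_inequality_grid[OF deg N])
    then have "sqrt (\<Sum>l\<le>D. (cmod (B l z))\<^sup>2 / 2 ^ l)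
     \<le> \<kappa> * ((\<Sum>e<N. cmod (box_poly D (Suc n) a (z(n := on_circle (real e / real N))))) / N)"
      using \<kappa> by (intro real_le_lsqrt) (auto simp: co pf sum_nonneg)
    then show "L2_set (\<lambda>k. (1 / sqrt (2 ^ k)) * cmod (B k z)) {..D}
     \<le> \<kappa> * ((\<Sum>e<N. cmod (box_poly D (Suc n) a (z(n := on_circle (real e / real N))))) / N)"
      by (simp add: L2_set_def power_divide)
  qed auto
  also have "\<dots> = (\<kappa> ^ Suc n * torus_avg N (Suc n) (\<lambda>z. cmod (box_poly D (Suc n) a z)))\<^sup>2"
    using torus_avg_sum[of N n "\<lambda>e z. cmod (box_poly D (Suc n) a (z(n := on_circle (real e / real N))))" "{..<N}"]
      torus_avg_mult_left[of N n "\<kappa> / N"]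
    by (simp add: power_mult_distrib mult_ac power2_eq_square power_divide)
  finally show ?case by (simp add: \<kappa>_def)
qed

lemma torus_avg_monomials:
  assumes D: "D < N" and \<alpha>: "\<alpha> \<in> ebox D n" and \<beta>: "\<beta> \<in> ebox D n"
  shows "torus_avg N n (\<lambda>z. monomial n \<alpha> z * cnj (monomial n \<beta> z)) = (if \<alpha> = \<beta> then 1 else 0)"
  using \<alpha> \<beta>
proof (induction n arbitrary: \<alpha> \<beta>)
  case 0 then show ?case by (simp add: monomial_def)
next
  case (Suc n)
  from Suc.prems obtain k \<alpha>' l \<beta>' where \<alpha>: "\<alpha> = \<alpha>'(n := k)" "k \<le> D" "\<alpha>' \<in> ebox D n"
    and \<beta>: "\<beta> = \<beta>'(n := l)" "l \<le> D" "\<beta>' \<in> ebox D n"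
    unfolding box_below_Suc by auto
  have kl: "k < N" "l < N" using \<alpha> \<beta> D by auto
  have eq: "\<alpha> = \<beta> \<longleftrightarrow> k = l \<and> \<alpha>' = \<beta>'"
  proof
    assume e: "\<alpha> = \<beta>"
    then have "\<alpha>' i = \<beta>' i" for i
      using \<alpha>(3) \<beta>(3) fun_cong[OF e[unfolded \<alpha>(1) \<beta>(1)], of i] by (cases "i = n") (auto simp: box_below_def)
    moreover have "k = l" using fun_cong[OF e[unfolded \<alpha>(1) \<beta>(1)], of n] by simp
    ultimately show "k = l \<and> \<alpha>' = \<beta>'" by auto
  qed (simp add: \<alpha>(1) \<beta>(1))
  have "torus_avg N (Suc n) (\<lambda>z. monomial (Suc n) \<alpha> z * cnj (monomial (Suc n) \<beta> z))
    = (1 / real N) *\<^sub>R (\<Sum>e<N. torus_avg N n (\<lambda>z. (on_circle (real e / real N) ^ k * cnj (on_circle (real e / real N) ^ l)) * (monomial n \<alpha>' z * cnj (monomial n \<beta>' z))))"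
    by (simp add: \<alpha>(1) \<beta>(1) monomial_Suc mult_ac)
  also have "\<dots> = (1 / real N) *\<^sub>R ((\<Sum>e<N. on_circle (real e / real N) ^ k * cnj (on_circle (real e / real N) ^ l)) * (if \<alpha>' = \<beta>' then 1 else 0))"
    unfolding torus_avg_mult_left Suc.IH[OF \<alpha>(3) \<beta>(3)] sum_distrib_right ..
  also have "\<dots> = (if \<alpha> = \<beta> then 1 else 0)"
    unfolding unit_root_orthogonality[OF kl] eq using D by (simp add: scaleR_conv_of_real)
  finally show ?case .
qed

lemma parseval_box:
  assumes D: "D < N"
  shows "torus_avg N n (\<lambda>z. (cmod (box_poly D n a z))\<^sup>2) = (\<Sum>\<alpha>\<in>ebox D n. (cmod (a \<alpha>))\<^sup>2)"
proof -
  have "complex_of_real (torus_avg N n (\<lambda>z. (cmod (box_poly D n a z))\<^sup>2))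
     = torus_avg N n (\<lambda>z. box_poly D n a z * cnj (box_poly D n a z))"
    unfolding torus_avg_of_real[symmetric] complex_norm_square ..
  also have "\<dots> = torus_avg N n (\<lambda>z. \<Sum>\<alpha>\<in>ebox D n. \<Sum>\<beta>\<in>ebox D n. (a \<alpha> * cnj (a \<beta>)) * (monomial n \<alpha> z * cnj (monomial n \<beta> z)))"
    unfolding box_poly_def cnj_sum sum_product by (simp add: mult_ac)
  also have "\<dots> = (\<Sum>\<alpha>\<in>ebox D n. \<Sum>\<beta>\<in>ebox D n. (a \<alpha> * cnj (a \<beta>)) * torus_avg N n (\<lambda>z. monomial n \<alpha> z * cnj (monomial n \<beta> z)))"
    unfolding torus_avg_sum torus_avg_mult_left ..
  also have "\<dots> = (\<Sum>\<alpha>\<in>ebox D n. \<Sum>\<beta>\<in>ebox D n. (a \<alpha> * cnj (a \<beta>)) * (if \<alpha> = \<beta> then 1 else 0))"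
    by (intro sum.cong refl) (simp only: torus_avg_monomials[OF D])
  also have "\<dots> = (\<Sum>\<alpha>\<in>ebox D n. complex_of_real ((cmod (a \<alpha>))\<^sup>2))"
    by (simp add: if_distrib[of "\<lambda>x. _ * x"] complex_norm_square del: of_real_power cong: if_cong)
  finally show ?thesis unfolding of_real_sum[symmetric] of_real_eq_iff .
qed

text \<open>
  The \<open>L\<^sup>4\<close> norm is the \<open>L\<^sup>2\<close> norm of the square, and an exponent \<open>\<gamma>\<close> is the sum of two exponents in at most
  \<open>\<Prod>i. \<gamma> i + 1 \<le> 2 ^ \<bar>\<gamma>\<bar>\<close> ways.
\<close>

lemma L4_L2_inequality_box:
  assumes N: "2 * D < N"
  shows "torus_avg N n (\<lambda>z. (cmod (box_poly D n a z)) ^ 4) \<le> (\<Sum>\<alpha>\<in>ebox D n. 2 ^ (\<Sum>i<n. \<alpha> i) * (cmod (a \<alpha>))\<^sup>2)\<^sup>2"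
proof -
  define P where "P = ebox D n \<times> ebox D n"
  define s where "s = (\<lambda>(\<alpha> :: nat \<Rightarrow> nat, \<beta> :: nat \<Rightarrow> nat) i. \<alpha> i + \<beta> i)"
  define Q where "Q \<gamma> = {p \<in> P. s p = \<gamma>}" for \<gamma>
  define c where "c \<gamma> = (\<Sum>(\<alpha>, \<beta>)\<in>Q \<gamma>. a \<alpha> * a \<beta>)" for \<gamma>
  have fin: "finite P" by (simp add: P_def)
  have sP: "s ` P \<subseteq> ebox (2 * D) n" by (fastforce simp: P_def s_def box_below_def)
  have sq: "(box_poly D n a z)\<^sup>2 = box_poly (2 * D) n c z" for z
  proof -
    have "(box_poly D n a z)\<^sup>2 = (\<Sum>(\<alpha>, \<beta>)\<in>P. (a \<alpha> * a \<beta>) * monomial n (s (\<alpha>, \<beta>)) z)"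
      unfolding power2_eq_square box_poly_def sum_product P_def sum.cartesian_product
      by (intro sum.cong refl) (auto simp: s_def monomial_def power_add prod.distrib)
    also have "\<dots> = (\<Sum>\<gamma>\<in>ebox (2 * D) n. \<Sum>p\<in>Q \<gamma>. (case p of (\<alpha>, \<beta>) \<Rightarrow> (a \<alpha> * a \<beta>) * monomial n (s (\<alpha>, \<beta>)) z))"
      unfolding Q_def by (rule sum.group[OF fin finite_box_below sP, symmetric])
    also have "\<dots> = box_poly (2 * D) n c z"
      unfolding box_poly_def c_def sum_distrib_right
      by (intro sum.cong refl) (auto simp: Q_def)
    finally show ?thesis .
  qed
  have card: "real (card (Q \<gamma>)) \<le> 2 ^ (\<Sum>i<n. \<gamma> i)" for \<gamma>
  proof -
    have "inj_on fst (Q \<gamma>)"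
      by (auto simp: inj_on_def Q_def s_def fun_eq_iff) (metis add_left_cancel)
    moreover have "fst ` Q \<gamma> \<subseteq> box_below \<gamma> n"
      by (auto simp: Q_def P_def s_def box_below_def)
    ultimately have "card (Q \<gamma>) \<le> card (box_below \<gamma> n)" by (intro card_inj_on_le) auto
    also have "\<dots> \<le> 2 ^ (\<Sum>i<n. \<gamma> i)" by (rule card_box_below_le)
    finally have "real (card (Q \<gamma>)) \<le> real (2 ^ (\<Sum>i<n. \<gamma> i))" by (rule of_nat_mono)
    then show ?thesis by simp
  qed
  have c_le: "(cmod (c \<gamma>))\<^sup>2 \<le> (\<Sum>(\<alpha>, \<beta>)\<in>Q \<gamma>. (2 ^ (\<Sum>i<n. \<alpha> i) * (cmod (a \<alpha>))\<^sup>2) * (2 ^ (\<Sum>i<n. \<beta> i) * (cmod (a \<beta>))\<^sup>2))" for \<gamma>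
  proof -
    have "(cmod (c \<gamma>))\<^sup>2 \<le> (\<Sum>p\<in>Q \<gamma>. cmod (a (fst p) * a (snd p)))\<^sup>2"
      unfolding c_def case_prod_unfold by (intro power_mono norm_sum) auto
    also have "\<dots> \<le> real (card (Q \<gamma>)) * (\<Sum>p\<in>Q \<gamma>. (cmod (a (fst p) * a (snd p)))\<^sup>2)"
      by (subst mult.commute, rule sum_squared_le_sum_of_squares)
    also have "\<dots> \<le> 2 ^ (\<Sum>i<n. \<gamma> i) * (\<Sum>p\<in>Q \<gamma>. (cmod (a (fst p) * a (snd p)))\<^sup>2)"
      by (intro mult_right_mono card sum_nonneg) auto
    also have "\<dots> = (\<Sum>(\<alpha>, \<beta>)\<in>Q \<gamma>. (2 ^ (\<Sum>i<n. \<alpha> i) * (cmod (a \<alpha>))\<^sup>2) * (2 ^ (\<Sum>i<n. \<beta> i) * (cmod (a \<beta>))\<^sup>2))"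
      unfolding sum_distrib_left
      by (intro sum.cong refl) (auto simp: Q_def s_def sum.distrib power_add norm_mult power_mult_distrib)
    finally show ?thesis .
  qed
  have "torus_avg N n (\<lambda>z. (cmod (box_poly D n a z)) ^ 4) = torus_avg N n (\<lambda>z. (cmod (box_poly (2 * D) n c z))\<^sup>2)"
    by (simp add: sq[symmetric] norm_power flip: power_mult)
  also have "\<dots> = (\<Sum>\<gamma>\<in>ebox (2 * D) n. (cmod (c \<gamma>))\<^sup>2)" by (rule parseval_box[OF N])
  also have "\<dots> \<le> (\<Sum>\<gamma>\<in>ebox (2 * D) n. \<Sum>(\<alpha>, \<beta>)\<in>Q \<gamma>. (2 ^ (\<Sum>i<n. \<alpha> i) * (cmod (a \<alpha>))\<^sup>2) * (2 ^ (\<Sum>i<n. \<beta> i) * (cmod (a \<beta>))\<^sup>2))"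
    by (intro sum_mono c_le)
  also have "\<dots> = (\<Sum>(\<alpha>, \<beta>)\<in>P. (2 ^ (\<Sum>i<n. \<alpha> i) * (cmod (a \<alpha>))\<^sup>2) * (2 ^ (\<Sum>i<n. \<beta> i) * (cmod (a \<beta>))\<^sup>2))"
    unfolding Q_def by (rule sum.group[OF fin finite_box_below sP])
  also have "\<dots> = (\<Sum>\<alpha>\<in>ebox D n. 2 ^ (\<Sum>i<n. \<alpha> i) * (cmod (a \<alpha>))\<^sup>2)\<^sup>2"
    unfolding P_def power2_eq_square sum_product sum.cartesian_product ..
  finally show ?thesis .
qed

section \<open>Polynomials given by symmetric tensors\<close>

definition tuple_poly :: "nat \<Rightarrow> nat \<Rightarrow> (nat list \<Rightarrow> complex) \<Rightarrow> (nat \<Rightarrow> complex) \<Rightarrow> complex" where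
  "tuple_poly n m b z = (\<Sum>xs\<in>tuples n m. b xs * prod_list (map z xs))"

text \<open>
  The multinomial coefficient of the monomial spelled by a word, so that the coefficient of this
  monomial in a symmetric \<open>tuple_poly\<close> is the entry of the tensor times \<open>orderings\<close>.
\<close>

definition orderings :: "'a list \<Rightarrow> nat" where
  "orderings xs = card {ys. mset ys = mset xs}"

lemma orderings_cong: "mset xs = mset ys \<Longrightarrow> orderings xs = orderings ys"
  by (simp add: orderings_def)

lemma finite_orderings [simp]: "finite {ys. mset ys = M}"
proof (rule finite_subset)
  show "{ys. mset ys = M} \<subseteq> {ys. set ys \<subseteq> set_mset M \<and> length ys = size M}" by auto
qed (simp add: finite_lists_length_eq)

lemma orderings_pos: "orderings xs > 0"
  unfolding orderings_def by (subst card_gt_0_iff) auto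

lemma orderings_Cons_le: "orderings (x # xs) \<le> Suc (length xs) * orderings xs"
proof -
  let ?ins = "\<lambda>(i, ys). take i ys @ x # drop i ys"
  have "{ys. mset ys = mset (x # xs)} \<subseteq> ?ins ` ({..length xs} \<times> {ys. mset ys = mset xs})"
  proof
    fix ys assume "ys \<in> {ys. mset ys = mset (x # xs)}"
    then have ys: "mset ys = mset (x # xs)" by simp
    then have "x \<in> set ys" by (metis list.set_intros(1) set_mset_mset)
    then obtain us vs where us: "ys = us @ x # vs" by (meson split_list)
    have m: "mset (us @ vs) = mset xs" using ys by (simp add: us)
    then have "length us \<le> length xs" by (metis le_add1 length_append mset_eq_length)
    then show "ys \<in> ?ins ` ({..length xs} \<times> {ys. mset ys = mset xs})"
      using us m by (intro image_eqI[of _ _ "(length us, us @ vs)"]) auto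
  qed
  then have "orderings (x # xs) \<le> card (?ins ` ({..length xs} \<times> {ys. mset ys = mset xs}))"
    unfolding orderings_def by (intro card_mono finite_imageI finite_cartesian_product) auto
  also have "\<dots> \<le> card ({..length xs} \<times> {ys. mset ys = mset xs})"
    by (intro card_image_le finite_cartesian_product) auto
  finally show ?thesis by (simp add: orderings_def card_cartesian_product)
qed

text \<open>
  For words of length \<open>m\<close>, splitting off \<open>k\<close> letters changes multinomial coefficients by at most
  \<open>m ^ k\<close>, which is harmless after taking \<open>m\<close>-th roots.
\<close>

lemma orderings_append_le: "orderings (u @ v) \<le> (length u + length v) ^ length u * orderings v"
proof (induction u)
  case Nil then show ?case by simp
next
  case (Cons x u)
  have "orderings (x # (u @ v)) \<le> Suc (length (u @ v)) * orderings (u @ v)" by (rule orderings_Cons_le)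
  also have "\<dots> \<le> Suc (length (u @ v)) * ((length u + length v) ^ length u * orderings v)"
    by (intro mult_left_mono Cons) auto
  also have "\<dots> \<le> Suc (length (u @ v)) * (Suc (length u + length v) ^ length u * orderings v)"
    by (intro mult_left_mono mult_right_mono power_mono) auto
  finally show ?case by (simp add: mult_ac)
qed

lemma prod_list_tuple:
  assumes "xs \<in> tuples n m"
  shows "prod_list (map z xs) = monomial n (count_list xs) z"
  using assms
proof (induction xs arbitrary: m)
  case Nil then show ?case by (simp add: monomial_def)
next
  case (Cons x xs)
  then have x: "x < n" and IH: "prod_list (map z xs) = monomial n (count_list xs) z"
    by (auto simp: tuples_def)
  have "monomial n (count_list (x # xs)) z = (\<Prod>i<n. (if i = x then z i else 1) * z i ^ count_list xs i)"
    unfolding monomial_def by (intro prod.cong) auto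
  also have "\<dots> = z x * monomial n (count_list xs) z"
    using x by (simp add: prod.distrib monomial_def)
  finally show ?case by (simp only: IH list.map prod_list.Cons)
qed

lemma count_list_tuple:
  assumes "xs \<in> tuples n m"
  shows "count_list xs \<in> ebox m n" "(\<Sum>i<n. count_list xs i) = m"
proof -
  show "count_list xs \<in> ebox m n"
    using assms count_le_length[of xs] by (auto simp: tuples_def box_below_def count_list_0_iff subset_eq)
  show "(\<Sum>i<n. count_list xs i) = m"
    using assms sum_count_set[of xs "{..<n}"] by (auto simp: tuples_def)
qed

lemma count_list_eq_iff_mset: "count_list xs = count_list ys \<longleftrightarrow> mset xs = mset ys"
  by (simp add: multiset_eq_iff fun_eq_iff count_mset)

lemma mset_eq_in_tuples: "mset xs = mset ys \<Longrightarrow> xs \<in> tuples n m \<Longrightarrow> ys \<in> tuples n m"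
  by (auto simp: tuples_def dest: mset_eq_setD mset_eq_length)

text \<open>
  The coefficient of the monomial with exponent \<open>\<alpha>\<close> in a \<open>tuple_poly\<close>.
\<close>

definition collected :: "nat \<Rightarrow> nat \<Rightarrow> (nat list \<Rightarrow> complex) \<Rightarrow> (nat \<Rightarrow> nat) \<Rightarrow> complex" where
  "collected n m b \<alpha> = (\<Sum>xs\<in>{xs \<in> tuples n m. count_list xs = \<alpha>}. b xs)"

lemma tuple_fibre:
  assumes "xs \<in> tuples n m"
  shows "{ys \<in> tuples n m. count_list ys = count_list xs} = {ys. mset ys = mset xs}"
  using assms mset_eq_in_tuples[of xs _ n m] by (auto simp: count_list_eq_iff_mset)

lemma sum_tuples_by_exponent:
  "(\<Sum>\<alpha>\<in>ebox m n. \<Sum>xs\<in>{xs \<in> tuples n m. count_list xs = \<alpha>}. F xs) = (\<Sum>xs\<in>tuples n m. F xs)"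
  by (rule sum.group) (auto simp: count_list_tuple)

lemma tuple_poly_eq_box_poly: "tuple_poly n m b = box_poly m n (collected n m b)"
proof
  fix z
  have "tuple_poly n m b z = (\<Sum>\<alpha>\<in>ebox m n. \<Sum>xs\<in>{xs \<in> tuples n m. count_list xs = \<alpha>}. b xs * prod_list (map z xs))"
    unfolding tuple_poly_def by (rule sum_tuples_by_exponent[symmetric])
  also have "\<dots> = box_poly m n (collected n m b) z"
    unfolding box_poly_def collected_def sum_distrib_right
    by (intro sum.cong refl) (auto simp: prod_list_tuple)
  finally show "tuple_poly n m b z = box_poly m n (collected n m b) z" .
qed

lemma collected_eq_0: "(\<Sum>i<n. \<alpha> i) \<noteq> m \<Longrightarrow> collected n m b \<alpha> = 0"
  unfolding collected_def using count_list_tuple(2) by (intro sum.neutral) auto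

lemma collected_symmetric:
  assumes b: "symmetric b" and xs: "xs \<in> tuples n m"
  shows "collected n m b (count_list xs) = of_nat (orderings xs) * b xs"
proof -
  have "collected n m b (count_list xs) = (\<Sum>ys\<in>{ys. mset ys = mset xs}. b xs)"
    unfolding collected_def tuple_fibre[OF xs] by (intro sum.cong refl symmetricD[OF b]) simp
  then show ?thesis by (simp add: orderings_def)
qed

lemma sum_collected_sq:
  assumes b: "symmetric b"
  shows "(\<Sum>\<alpha>\<in>ebox m n. (cmod (collected n m b \<alpha>))\<^sup>2) = (\<Sum>xs\<in>tuples n m. real (orderings xs) * (cmod (b xs))\<^sup>2)"
proof -
  have "(cmod (collected n m b \<alpha>))\<^sup>2
     = (\<Sum>xs\<in>{xs \<in> tuples n m. count_list xs = \<alpha>}. real (orderings xs) * (cmod (b xs))\<^sup>2)" for \<alpha>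
  proof (cases "{xs \<in> tuples n m. count_list xs = \<alpha>} = {}")
    case True then show ?thesis by (simp only: collected_def) simp
  next
    case False
    then obtain xs where xs: "xs \<in> tuples n m" and \<alpha>: "\<alpha> = count_list xs" by auto
    have "(\<Sum>ys\<in>{ys \<in> tuples n m. count_list ys = \<alpha>}. real (orderings ys) * (cmod (b ys))\<^sup>2)
       = (\<Sum>ys\<in>{ys. mset ys = mset xs}. real (orderings xs) * (cmod (b xs))\<^sup>2)"
      unfolding \<alpha> tuple_fibre[OF xs]
      by (intro sum.cong refl arg_cong2[of _ _ _ _ "\<lambda>i c. real i * (cmod c)\<^sup>2"] orderings_cong symmetricD[OF b]) auto
    also have "\<dots> = (real (orderings xs))\<^sup>2 * (cmod (b xs))\<^sup>2"
      by (simp add: orderings_def power2_eq_square)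
    finally show ?thesis
      by (simp add: \<alpha> collected_symmetric[OF b xs] norm_mult power_mult_distrib)
  qed
  then show ?thesis by (simp add: sum_tuples_by_exponent)
qed

lemma parseval_tuple_poly:
  assumes "symmetric b" "m < N"
  shows "torus_avg N n (\<lambda>z. (cmod (tuple_poly n m b z))\<^sup>2) = (\<Sum>xs\<in>tuples n m. real (orderings xs) * (cmod (b xs))\<^sup>2)"
  unfolding tuple_poly_eq_box_poly parseval_box[OF assms(2)] by (rule sum_collected_sq[OF assms(1)])

lemma L1_L2_inequality:
  assumes N: "m < N"
  shows "torus_avg N n (\<lambda>z. (cmod (tuple_poly n m b z))\<^sup>2)
     \<le> 2 ^ m * (grid_distortion m N ^ n * torus_avg N n (\<lambda>z. cmod (tuple_poly n m b z)))\<^sup>2"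
proof -
  have "torus_avg N n (\<lambda>z. (cmod (tuple_poly n m b z))\<^sup>2) = (\<Sum>\<alpha>\<in>ebox m n. (cmod (collected n m b \<alpha>))\<^sup>2)"
    unfolding tuple_poly_eq_box_poly parseval_box[OF N] ..
  also have "\<dots> = 2 ^ m * (\<Sum>\<alpha>\<in>ebox m n. (cmod (collected n m b \<alpha>))\<^sup>2 / 2 ^ (\<Sum>i<n. \<alpha> i))"
    unfolding sum_distrib_left
  proof (intro sum.cong refl)
    fix \<alpha>
    show "(cmod (collected n m b \<alpha>))\<^sup>2 = 2 ^ m * ((cmod (collected n m b \<alpha>))\<^sup>2 / 2 ^ (\<Sum>i<n. \<alpha> i))"
      by (cases "(\<Sum>i<n. \<alpha> i) = m") (auto simp: collected_eq_0)
  qed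
  also have "\<dots> \<le> 2 ^ m * (grid_distortion m N ^ n * torus_avg N n (\<lambda>z. cmod (tuple_poly n m b z)))\<^sup>2"
    unfolding tuple_poly_eq_box_poly by (intro mult_left_mono L1_L2_inequality_box[OF N]) auto
  finally show ?thesis .
qed

lemma L4_L2_inequality:
  assumes N: "2 * m < N"
  shows "torus_avg N n (\<lambda>z. (cmod (tuple_poly n m b z)) ^ 4)
     \<le> 4 ^ m * (torus_avg N n (\<lambda>z. (cmod (tuple_poly n m b z))\<^sup>2))\<^sup>2"
proof -
  have N': "m < N" using N by simp
  have "torus_avg N n (\<lambda>z. (cmod (tuple_poly n m b z)) ^ 4)
     \<le> (\<Sum>\<alpha>\<in>ebox m n. 2 ^ (\<Sum>i<n. \<alpha> i) * (cmod (collected n m b \<alpha>))\<^sup>2)\<^sup>2"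
    unfolding tuple_poly_eq_box_poly by (rule L4_L2_inequality_box[OF N])
  also have "(\<Sum>\<alpha>\<in>ebox m n. 2 ^ (\<Sum>i<n. \<alpha> i) * (cmod (collected n m b \<alpha>))\<^sup>2)
      = 2 ^ m * (\<Sum>\<alpha>\<in>ebox m n. (cmod (collected n m b \<alpha>))\<^sup>2)"
    unfolding sum_distrib_left
  proof (intro sum.cong refl)
    fix \<alpha>
    show "2 ^ (\<Sum>i<n. \<alpha> i) * (cmod (collected n m b \<alpha>))\<^sup>2 = 2 ^ m * (cmod (collected n m b \<alpha>))\<^sup>2"
      by (cases "(\<Sum>i<n. \<alpha> i) = m") (auto simp: collected_eq_0)
  qed
  also have "(\<Sum>\<alpha>\<in>ebox m n. (cmod (collected n m b \<alpha>))\<^sup>2) = torus_avg N n (\<lambda>z. (cmod (tuple_poly n m b z))\<^sup>2)"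
    unfolding tuple_poly_eq_box_poly parseval_box[OF N'] ..
  also have "(2 ^ m * X)\<^sup>2 = 4 ^ m * X\<^sup>2" for X :: real
  proof -
    have "(2::real) ^ m * 2 ^ m = 4 ^ m" by (simp flip: power_mult_distrib)
    moreover have "(2 ^ m * X)\<^sup>2 = (2 ^ m * 2 ^ m) * X\<^sup>2" by (simp only: power2_eq_square mult_ac)
    ultimately show ?thesis by simp
  qed
  finally show ?thesis .
qed

text \<open>
  Hoelder interpolation of \<open>L\<^sup>2\<close> between \<open>L\<^sup>\<rho>\<close> and \<open>L\<^sup>4\<close>.  As \<open>\<rho>\<close> approaches \<open>2\<close> the weight of \<open>L\<^sup>4\<close> tends to \<open>0\<close>,
  and the cost \<open>2 ^ (m / k)\<close> of the passage has \<open>m\<close>-th root near \<open>1\<close> for large \<open>k\<close>.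
\<close>

lemma Lrho_L2_inequality:
  fixes k :: nat
  assumes N: "2 * m < N" and k: "k \<ge> 1" and \<rho>: "\<rho> = 2 * real k / (real k + 1)"
  shows "torus_avg N n (\<lambda>z. (cmod (tuple_poly n m b z))\<^sup>2) powr (\<rho> / 2)
     \<le> 2 powr (real m * \<rho> / k) * torus_avg N n (\<lambda>z. cmod (tuple_poly n m b z) powr \<rho>)"
proof -
  define X where "X = torus_avg N n (\<lambda>z. (cmod (tuple_poly n m b z))\<^sup>2)"
  define A where "A = torus_avg N n (\<lambda>z. cmod (tuple_poly n m b z) powr \<rho>)"
  define B where "B = 4 ^ m * X\<^sup>2"
  define K where "K = 2 powr (real m * \<rho> / k)"
  have \<rho>b: "0 < \<rho>" "\<rho> < 2" using k by (auto simp: \<rho> field_simps)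
  have X0: "X \<ge> 0" unfolding X_def by (intro torus_avg_nonneg) auto
  have A0: "A \<ge> 0" unfolding A_def by (intro torus_avg_nonneg) auto
  have K0: "K > 0" by (simp add: K_def)
  have "X powr (\<rho> / 2) / K \<le> A"
  proof (cases "X = 0")
    case True then show ?thesis using A0 by simp
  next
    case False
    then have X: "X > 0" using X0 by simp
    then have B: "B > 0" by (simp add: B_def)
    show ?thesis
    (* The average A may vanish, so Young's inequality is applied with a larger A'. *)
    proof (rule dense_ge)
      fix A' assume A': "A < A'"
      then have A'0: "A' > 0" using A0 by simp
      define s where "s = 2 / (4 - \<rho>)"
      define s' where "s' = (2 - \<rho>) / (4 - \<rho>)"
      have s: "0 \<le> s" "0 \<le> s'" using \<rho>b by (auto simp: s_def s'_def)
      have "s + s' = (2 + (2 - \<rho>)) / (4 - \<rho>)" by (simp only: s_def s'_def add_divide_distrib)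
      also have "\<dots> = 1" using \<rho>b by simp
      finally have s1: "s + s' = 1" .
      define W where "W = A' powr s * B powr s'"
      have W: "W > 0" using A'0 B by (simp add: W_def)
      have pt: "x\<^sup>2 / W \<le> s * (x powr \<rho> / A') + s' * (x ^ 4 / B)" if "x \<ge> 0" for x :: real
      proof (cases "x = 0")
        case True then show ?thesis using \<rho>b by simp
      next
        case False
        then have x: "x > 0" using that by simp
        have "\<rho> * s + 4 * s' = (\<rho> * 2 + 4 * (2 - \<rho>)) / (4 - \<rho>)"
          unfolding s_def s'_def add_divide_distrib times_divide_eq_right ..
        also have "\<dots> = 2" using \<rho>b by (subst divide_eq_eq) simp
        finally have "\<rho> * s + 4 * s' = 2" .
        then have "x\<^sup>2 = x powr (\<rho> * s) * x powr (4 * s')"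
          using x by (simp add: powr_add[symmetric])
        also have "\<dots> = (x powr \<rho>) powr s * (x ^ 4) powr s'"
        proof -
          have "x ^ 4 = x powr 4" using x by simp
          then show ?thesis by (simp only: powr_powr)
        qed
        finally have "x\<^sup>2 / W = (x powr \<rho> / A') powr s * (x ^ 4 / B) powr s'"
          using x A'0 B by (simp add: W_def powr_divide)
        also have "\<dots> \<le> s * (x powr \<rho> / A') + s' * (x ^ 4 / B)"
          using x A'0 B s s1 by (intro Youngs_inequality_0) auto
        finally show ?thesis .
      qed
      have "X / W = torus_avg N n (\<lambda>z. (1 / W) * (cmod (tuple_poly n m b z))\<^sup>2)"
        unfolding torus_avg_mult_left X_def by simp
      also have "\<dots> \<le> torus_avg N n (\<lambda>z. \<Sum>i\<in>{0::nat,1}. if i = 0 then (s / A') * (cmod (tuple_poly n m b z) powr \<rho>) else (s' / B) * (cmod (tuple_poly n m b z)) ^ 4)"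
        using pt by (intro torus_avg_mono) simp
      also have "\<dots> = (s / A') * A + (s' / B) * torus_avg N n (\<lambda>z. (cmod (tuple_poly n m b z)) ^ 4)"
        unfolding torus_avg_sum by (simp add: torus_avg_mult_left[of N n "s / A'", simplified] torus_avg_mult_left[of N n "s' / B", simplified] A_def)
      also have "\<dots> \<le> s + s'"
      proof (intro add_mono)
        have "A / A' \<le> 1" using A' A'0 by simp
        then have "s * (A / A') \<le> s * 1" using s by (intro mult_left_mono) auto
        then show "s / A' * A \<le> s" by simp
        have "torus_avg N n (\<lambda>z. (cmod (tuple_poly n m b z)) ^ 4) \<le> B"
          unfolding B_def X_def by (rule L4_L2_inequality[OF N])
        then have "torus_avg N n (\<lambda>z. (cmod (tuple_poly n m b z)) ^ 4) / B \<le> 1" using B by simp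
        then have "s' * (torus_avg N n (\<lambda>z. (cmod (tuple_poly n m b z)) ^ 4) / B) \<le> s' * 1" using s by (intro mult_left_mono) auto
        then show "s' / B * torus_avg N n (\<lambda>z. (cmod (tuple_poly n m b z)) ^ 4) \<le> s'" by simp
      qed
      finally have "X \<le> W" using s1 W by simp
      then have "ln X \<le> ln W" using X by simp
      also have "ln W = s * ln A' + s' * (m * ln 4 + 2 * ln X)"
        using A'0 B X by (simp add: W_def ln_mult ln_powr B_def ln_realpow)
      finally have "(4 - \<rho>) * ln X \<le> (4 - \<rho>) * (s * ln A' + s' * (m * ln 4 + 2 * ln X))"
        using \<rho>b by (intro mult_left_mono) auto
      also have "\<dots> = 2 * ln A' + (2 - \<rho>) * (m * ln 4 + 2 * ln X)"
      proof -
        have nz: "4 - \<rho> \<noteq> 0" using \<rho>b by simp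
        have "(4 - \<rho>) * s = 2" "(4 - \<rho>) * s' = 2 - \<rho>"
          by (simp_all only: s_def s'_def times_divide_eq_right nonzero_mult_div_cancel_left[OF nz])
        then show ?thesis by (simp only: distrib_left mult.assoc[symmetric])
      qed
      finally have "\<rho> * ln X \<le> 2 * ln A' + (2 - \<rho>) * (m * ln 4)" by (simp add: algebra_simps)
      also have "2 - \<rho> = \<rho> / k"
      proof -
        have "2 - \<rho> = 2 / (real k + 1)" by (simp add: \<rho> field_simps)
        also have "\<dots> = \<rho> / k" using k by (simp add: \<rho>)
        finally show ?thesis .
      qed
      also have "ln (4::real) = 2 * ln 2" using ln_realpow[of "2::real" 2] by simp
      finally have "\<rho> / 2 * ln X \<le> ln A' + real m * \<rho> / k * ln 2" by (simp add: field_simps)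
      then have "ln (X powr (\<rho> / 2)) \<le> ln (A' * K)"
        using X A'0 by (simp add: ln_powr ln_mult K_def)
      then have "X powr (\<rho> / 2) \<le> A' * K" using X A'0 K0 by (subst (asm) ln_le_cancel_iff) auto
      then show "X powr (\<rho> / 2) / K \<le> A'" using K0 by (simp add: field_simps)
    qed
  qed
  then show ?thesis using K0 by (simp add: X_def A_def K_def field_simps)
qed

section \<open>Polarisation\<close>

lemma tuple_poly_Suc: "tuple_poly n (Suc m) b z = (\<Sum>j<n. z j * tuple_poly n m (\<lambda>xs. b (j # xs)) z)"
  by (simp add: tuple_poly_def sum_tuples_Suc sum_distrib_left mult_ac)

lemma symmetric_Cons: "symmetric b \<Longrightarrow> symmetric (\<lambda>xs. b (j # xs))"
  by (simp add: symmetric_def)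

lemma symmetric_append: "symmetric b \<Longrightarrow> symmetric (\<lambda>v. b (u @ v))"
  by (simp add: symmetric_def)

lemma tuple_poly_scale: "tuple_poly n m b (\<lambda>j. c * z j) = c ^ m * tuple_poly n m b z"
proof -
  have "prod_list (map (\<lambda>j. c * z j) xs) = c ^ length xs * prod_list (map z xs)" for xs
    by (induction xs) auto
  then show ?thesis by (auto simp: tuple_poly_def tuples_def sum_distrib_left mult_ac intro!: sum.cong)
qed

lemma tuple_poly_deriv:
  assumes "symmetric b"
  shows "((\<lambda>t. tuple_poly n (Suc m) b (\<lambda>j. z j + t * w j)) has_field_derivative
     of_nat (Suc m) * (\<Sum>j<n. w j * tuple_poly n m (\<lambda>xs. b (j # xs)) z)) (at 0)"
  using assms
proof (induction m arbitrary: b)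
  case 0
  have "tuple_poly n 0 c x = c []" for c x by (simp add: tuple_poly_def)
  then show ?case by (auto simp: tuple_poly_Suc intro!: derivative_eq_intros)
next
  case (Suc m)
  define D where "D j = of_nat (Suc m) * (\<Sum>i<n. w i * tuple_poly n m (\<lambda>xs. b (j # i # xs)) z)" for j
  have IH: "((\<lambda>t. tuple_poly n (Suc m) (\<lambda>xs. b (j # xs)) (\<lambda>j. z j + t * w j)) has_field_derivative D j) (at 0)" for j
    unfolding D_def by (rule Suc.IH[OF symmetric_Cons[OF Suc.prems]])
  have "((\<lambda>t. \<Sum>j<n. (z j + t * w j) * tuple_poly n (Suc m) (\<lambda>xs. b (j # xs)) (\<lambda>j. z j + t * w j)) has_field_derivative
     (\<Sum>j<n. z j * D j + w j * tuple_poly n (Suc m) (\<lambda>xs. b (j # xs)) z)) (at 0)"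
    by (intro DERIV_sum) (auto intro!: derivative_eq_intros IH)
  also have "(\<Sum>j<n. z j * D j + w j * tuple_poly n (Suc m) (\<lambda>xs. b (j # xs)) z)
     = of_nat (Suc (Suc m)) * (\<Sum>j<n. w j * tuple_poly n (Suc m) (\<lambda>xs. b (j # xs)) z)"
  proof -
    have sw: "b (j # i # xs) = b (i # j # xs)" for i j xs by (rule symmetricD[OF Suc.prems]) simp
    have "(\<Sum>j<n. z j * D j) = of_nat (Suc m) * (\<Sum>j<n. \<Sum>i<n. w i * (z j * tuple_poly n m (\<lambda>xs. b (i # j # xs)) z))"
      unfolding D_def sw by (simp add: sum_distrib_left mult_ac)
    also have "\<dots> = of_nat (Suc m) * (\<Sum>i<n. w i * tuple_poly n (Suc m) (\<lambda>xs. b (i # xs)) z)"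
      unfolding tuple_poly_Suc[of n m] sum_distrib_left by (subst sum.swap) simp
    finally show ?thesis by (simp add: sum.distrib algebra_simps)
  qed
  finally show ?case unfolding tuple_poly_Suc[of n "Suc m"] .
qed

lemma tuple_poly_line_holomorphic: "(\<lambda>t. tuple_poly n m b (\<lambda>j. z j + t * w j)) holomorphic_on A"
proof -
  have "(\<lambda>t. prod_list (map (\<lambda>j. z j + t * w j) xs)) holomorphic_on A" for xs
    by (induction xs) (auto intro!: holomorphic_intros)
  then show ?thesis unfolding tuple_poly_def by (intro holomorphic_intros)
qed

text \<open>
  The only properties of \<open>l\<^sub>p\<close> balls that matter for upper bounds of mixed norms.  In this way one
  argument serves \<open>p < \<infinity>\<close>, \<open>p = \<infinity>\<close> and the polydisc.
\<close>

locale solid_convex =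
  fixes n :: nat and K :: "(nat \<Rightarrow> real) set"
  assumes solid: "y \<in> K \<Longrightarrow> (\<And>j. j < n \<Longrightarrow> \<bar>x j\<bar> \<le> \<bar>y j\<bar>) \<Longrightarrow> x \<in> K"
    and convex: "x \<in> K \<Longrightarrow> y \<in> K \<Longrightarrow> 0 \<le> t \<Longrightarrow> t \<le> 1 \<Longrightarrow> (\<lambda>j. (1 - t) * x j + t * y j) \<in> K"
begin

definition in_ball :: "(nat \<Rightarrow> complex) \<Rightarrow> bool" where
  "in_ball z \<longleftrightarrow> (\<lambda>j. cmod (z j)) \<in> K"

text \<open>
  The left-hand side is the derivative of \<open>t \<mapsto> P (z + t w)\<close> at \<open>0\<close>, divided by the degree.  Cauchy's
  estimate on the circle of radius \<open>1 / degree\<close> loses only \<open>(1 + 1 / degree) ^ degree \<le> e\<close>, so fixing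
  \<open>k\<close> of the arguments costs \<open>e ^ k\<close> whatever the degree is.
\<close>

lemma polarization_step:
  assumes b: "symmetric b" and M: "\<And>z. in_ball z \<Longrightarrow> cmod (tuple_poly n (Suc m) b z) \<le> M"
    and z: "in_ball z" and w: "in_ball w"
  shows "cmod (\<Sum>j<n. w j * tuple_poly n m (\<lambda>xs. b (j # xs)) z) \<le> exp 1 * M"
proof -
  define f where "f t = tuple_poly n (Suc m) b (\<lambda>j. z j + t * w j)" for t
  define r where "r = 1 / real (Suc m)"
  have r: "r > 0" by (simp add: r_def)
  have M0: "M \<ge> 0" using M[OF z] norm_ge_zero order_trans by blast
  have f_holo: "f holomorphic_on A" for A
    unfolding f_def by (rule tuple_poly_line_holomorphic)
  have bound: "cmod (f t) \<le> exp 1 * M" if t: "cmod (0 - t) = r" for t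
  proof -
    define v where "v j = (z j + t * w j) / of_real (1 + r)" for j
    have "(\<lambda>j. (1 - r / (1 + r)) * cmod (z j) + r / (1 + r) * cmod (w j)) \<in> K"
      using z w r by (intro convex) (auto simp: in_ball_def)
    then have v: "in_ball v"
      unfolding in_ball_def
    proof (rule solid)
      fix j
      have "cmod (v j) \<le> (cmod (z j) + r * cmod (w j)) / (1 + r)"
        using norm_triangle_ineq[of "z j" "t * w j"] r t
        by (simp add: v_def norm_divide norm_mult divide_right_mono del: of_real_add)
      also have "\<dots> = (1 - r / (1 + r)) * cmod (z j) + r / (1 + r) * cmod (w j)"
      proof -
        have 1: "1 - r / (1 + r) = 1 / (1 + r)" using r by (simp add: field_simps)
        show ?thesis by (simp add: 1 add_divide_distrib)
      qed
      finally show "\<bar>cmod (v j)\<bar> \<le> \<bar>(1 - r / (1 + r)) * cmod (z j) + r / (1 + r) * cmod (w j)\<bar>" by simp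
    qed
    have "f t = tuple_poly n (Suc m) b (\<lambda>j. of_real (1 + r) * v j)"
      unfolding f_def v_def using r by (intro arg_cong[of _ _ "tuple_poly n (Suc m) b"] ext) (simp del: of_real_add)
    also have "\<dots> = of_real (1 + r) ^ Suc m * tuple_poly n (Suc m) b v" by (rule tuple_poly_scale)
    also have "cmod \<dots> = (1 + r) ^ Suc m * cmod (tuple_poly n (Suc m) b v)"
      using r by (simp add: norm_mult norm_power del: of_real_add)
    also have "\<dots> \<le> exp 1 * M"
    proof (intro mult_mono M[OF v])
      have "(1 + r) ^ Suc m \<le> exp r ^ Suc m" using r by (intro power_mono exp_ge_add_one_self) auto
      also have "\<dots> = exp 1" by (simp only: exp_of_nat_mult[symmetric]) (simp add: r_def)
      finally show "(1 + r) ^ Suc m \<le> exp 1" .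
    qed auto
    finally show ?thesis .
  qed
  have "cmod ((deriv ^^ 1) f 0) \<le> fact 1 * (exp 1 * M) / r ^ 1"
    using r by (intro Cauchy_inequality f_holo holomorphic_on_imp_continuous_on bound)
  moreover have "deriv f 0 = of_nat (Suc m) * (\<Sum>j<n. w j * tuple_poly n m (\<lambda>xs. b (j # xs)) z)"
    unfolding f_def by (intro DERIV_imp_deriv tuple_poly_deriv b)
  ultimately have "real (Suc m) * cmod (\<Sum>j<n. w j * tuple_poly n m (\<lambda>xs. b (j # xs)) z) \<le> real (Suc m) * (exp 1 * M)"
    by (simp add: norm_mult r_def mult_ac del: of_nat_Suc)
  then show ?thesis by (simp del: of_nat_Suc)
qed

lemma polarization:
  assumes "symmetric b" "\<And>z. in_ball z \<Longrightarrow> cmod (tuple_poly n (k + m) b z) \<le> M"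
    and z: "in_ball z" and w: "in_ball w"
  shows "cmod (\<Sum>u\<in>tuples n k. prod_list (map w u) * tuple_poly n m (\<lambda>v. b (u @ v)) z) \<le> exp k * M"
  using assms(1,2)
proof (induction k arbitrary: b M)
  case 0 then show ?case using z by simp
next
  case (Suc k)
  define b' where "b' xs = (\<Sum>j<n. w j * b (j # xs))" for xs
  have tp: "tuple_poly n l (\<lambda>v. b' (u @ v)) x = (\<Sum>j<n. w j * tuple_poly n l (\<lambda>v. b (j # u @ v)) x)" for l u x
    unfolding tuple_poly_def b'_def sum_distrib_left sum_distrib_right
    by (subst sum.swap) (simp add: mult_ac)
  have "symmetric b'"
    unfolding symmetric_def b'_def
    by (intro allI impI sum.cong refl arg_cong2[of _ _ _ _ "(*)"] symmetricD[OF Suc.prems(1)]) simp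
  moreover have "cmod (tuple_poly n (k + m) b' x) \<le> exp 1 * M" if x: "in_ball x" for x
  proof -
    have "tuple_poly n (k + m) b' x = (\<Sum>j<n. w j * tuple_poly n (k + m) (\<lambda>v. b (j # v)) x)"
      using tp[of "k + m" "[]"] by simp
    then show ?thesis using polarization_step[OF Suc.prems(1) _ x w, of "k + m" M] Suc.prems(2) by simp
  qed
  ultimately have "cmod (\<Sum>u\<in>tuples n k. prod_list (map w u) * tuple_poly n m (\<lambda>v. b' (u @ v)) z) \<le> exp k * (exp 1 * M)"
    by (rule Suc.IH)
  also have "(\<Sum>u\<in>tuples n k. prod_list (map w u) * tuple_poly n m (\<lambda>v. b' (u @ v)) z)
     = (\<Sum>u\<in>tuples n (Suc k). prod_list (map w u) * tuple_poly n m (\<lambda>v. b (u @ v)) z)"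
    unfolding tp sum_tuples_Suc sum_distrib_left by (subst sum.swap) (simp add: mult_ac)
  finally show ?case by (simp add: exp_add mult_ac)
qed

end

section \<open>Mixed norms of the coefficients\<close>

text \<open>
  The weights \<open>orderings v\<close> make the inner sum the squared \<open>L\<^sup>2\<close> norm on the torus of the polynomial
  with tensor \<open>v \<mapsto> b (u @ v)\<close>, dilated by \<open>y\<close>.
\<close>

definition mixed_norm :: "nat \<Rightarrow> nat \<Rightarrow> (nat list \<Rightarrow> complex) \<Rightarrow> (nat \<Rightarrow> real) \<Rightarrow> nat \<Rightarrow> real \<Rightarrow> real" where
  "mixed_norm n m b y k \<rho> =
     (\<Sum>u\<in>tuples n k. prod_list (map y u) powr \<rho> *
        (\<Sum>v\<in>tuples n (m - k). real (orderings v) * (cmod (b (u @ v)))\<^sup>2 * (prod_list (map y v))\<^sup>2) powr (\<rho> / 2))"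

lemma prod_list_map_mult:
  fixes f g :: "nat \<Rightarrow> 'a::comm_monoid_mult"
  shows "prod_list (map (\<lambda>j. f j * g j) xs) = prod_list (map f xs) * prod_list (map g xs)"
  by (induction xs) (simp_all add: mult_ac)

lemma prod_list_map_of_real: "prod_list (map (\<lambda>j. of_real (y j)) xs) = of_real (prod_list (map y xs))"
  by (induction xs) simp_all

lemma prod_list_nonneg: "(\<And>j. (0::real) \<le> y j) \<Longrightarrow> 0 \<le> prod_list (map y xs)"
  by (induction xs) simp_all

lemma symmetric_prod_list: "symmetric (\<lambda>xs. prod_list (map (y :: nat \<Rightarrow> real) xs))"
  unfolding symmetric_def by (metis mset_map prod_mset_prod_list)

lemma tuple_poly_dilate:
  "tuple_poly n m b (\<lambda>j. of_real (y j) * z j) = tuple_poly n m (\<lambda>v. b v * of_real (prod_list (map y v))) z"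
  by (simp add: tuple_poly_def prod_list_map_mult prod_list_map_of_real mult.assoc)

lemma parseval_dilated:
  assumes b: "symmetric b" and N: "m < N"
  shows "torus_avg N n (\<lambda>z. (cmod (tuple_poly n m b (\<lambda>j. of_real (y j) * z j)))\<^sup>2)
    = (\<Sum>v\<in>tuples n m. real (orderings v) * (cmod (b v))\<^sup>2 * (prod_list (map y v))\<^sup>2)"
proof -
  have "symmetric (\<lambda>v. b v * of_real (prod_list (map y v)))"
    using b symmetric_prod_list[of y] unfolding symmetric_def by metis
  from parseval_tuple_poly[OF this N] show ?thesis
    unfolding tuple_poly_dilate by (simp add: norm_mult power_mult_distrib mult_ac)
qed

context solid_convex begin

lemma in_ball_dilate:
  assumes "y \<in> K" "\<And>j. cmod (z j) \<le> 1"
  shows "in_ball (\<lambda>j. of_real (y j) * z j)"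
  unfolding in_ball_def
  by (rule solid[OF assms(1)]) (simp add: norm_mult mult_left_le assms(2))

text \<open>
  The \<open>L\<^sup>1\<close>-\<open>L\<^sup>2\<close> inequality replaces the inner \<open>L\<^sup>2\<close> norms by averages of moduli.  At each point of the
  torus the sum of these moduli, with suitable phases \<open>w\<close>, is a polarised value of the polynomial.
  The distortion of the grid disappears as \<open>N\<close> tends to infinity.
\<close>

lemma mixed_norm_1_bound:
  assumes b: "symmetric b" and m: "m \<ge> 1"
    and M: "\<And>z. in_ball z \<Longrightarrow> cmod (tuple_poly n m b z) \<le> M"
    and y: "y \<in> K" "\<And>j. 0 \<le> y j"
  shows "mixed_norm n m b y 1 1 \<le> exp 1 * sqrt 2 ^ (m - 1) * M"
proof -
  define X where "X j = (\<Sum>v\<in>tuples n (m - 1). real (orderings v) * (cmod (b (j # v)))\<^sup>2 * (prod_list (map y v))\<^sup>2)" for j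
  have X0: "X j \<ge> 0" for j by (simp add: X_def sum_nonneg)
  have eq: "mixed_norm n m b y 1 1 = (\<Sum>j<n. y j * sqrt (X j))"
    by (simp add: mixed_norm_def sum_tuples_1 X_def powr_half_sqrt sum_nonneg y)
  have bound: "mixed_norm n m b y 1 1 \<le> sqrt 2 ^ (m - 1) * (grid_distortion (m - 1) N ^ n * (exp 1 * M))" if N: "m < N" for N
  proof -
    define c where "c j z = tuple_poly n (m - 1) (\<lambda>v. b (j # v)) (\<lambda>i. of_real (y i) * z i)" for j z
    define \<kappa> where "\<kappa> = grid_distortion (m - 1) N ^ n"
    have \<kappa>: "\<kappa> \<ge> 0" by (simp add: \<kappa>_def grid_distortion_def)
    have N': "m - 1 < N" using N by simp
    have "sqrt (X j) \<le> sqrt 2 ^ (m - 1) * (\<kappa> * torus_avg N n (\<lambda>z. cmod (c j z)))" for j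
    proof (rule real_le_lsqrt)
      show "0 \<le> sqrt 2 ^ (m - 1) * (\<kappa> * torus_avg N n (\<lambda>z. cmod (c j z)))"
        using \<kappa> by (intro mult_nonneg_nonneg torus_avg_nonneg) auto
      have "X j = torus_avg N n (\<lambda>z. (cmod (c j z))\<^sup>2)"
        unfolding X_def c_def by (rule parseval_dilated[OF symmetric_Cons[OF b] N', symmetric])
      also have "\<dots> \<le> 2 ^ (m - 1) * (\<kappa> * torus_avg N n (\<lambda>z. cmod (c j z)))\<^sup>2"
        unfolding c_def tuple_poly_dilate \<kappa>_def by (rule L1_L2_inequality[OF N'])
      also have "(2::real) ^ (m - 1) = (sqrt 2 ^ (m - 1))\<^sup>2"
        by (simp add: power_mult[symmetric] mult.commute[of _ 2]) (simp add: power_mult)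
      finally show "X j \<le> (sqrt 2 ^ (m - 1) * (\<kappa> * torus_avg N n (\<lambda>z. cmod (c j z))))\<^sup>2"
        by (simp add: power_mult_distrib)
    qed
    then have "mixed_norm n m b y 1 1 \<le> (\<Sum>j<n. y j * (sqrt 2 ^ (m - 1) * (\<kappa> * torus_avg N n (\<lambda>z. cmod (c j z)))))"
      unfolding eq using y by (intro sum_mono mult_left_mono) auto
    also have "\<dots> = sqrt 2 ^ (m - 1) * (\<kappa> * torus_avg N n (\<lambda>z. \<Sum>j<n. y j * cmod (c j z)))"
      unfolding torus_avg_sum torus_avg_mult_left by (simp add: sum_distrib_left mult_ac)
    also have "torus_avg N n (\<lambda>z. \<Sum>j<n. y j * cmod (c j z)) \<le> exp 1 * M"
    proof (rule torus_avg_le_const)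
      fix z :: "nat \<Rightarrow> complex" assume z: "\<And>j. cmod (z j) = 1"
      define w where "w j = of_real (y j) * cnj (sgn (c j z))" for j
      have "of_real (\<Sum>j<n. y j * cmod (c j z)) = (\<Sum>j<n. w j * c j z)"
        unfolding w_def of_real_sum
      proof (intro sum.cong refl)
        fix j
        have "cnj (sgn x) * x = of_real (cmod x)" for x
        proof (cases "x = 0")
          case False
          then have "cnj (sgn x) * x = x * cnj x / of_real (cmod x)" by (simp add: sgn_eq)
          also have "\<dots> = of_real (cmod x)" using False
            by (simp add: complex_norm_square[symmetric] power2_eq_square del: of_real_power)
          finally show ?thesis .
        qed simp
        then show "complex_of_real (y j * cmod (c j z)) = of_real (y j) * cnj (sgn (c j z)) * c j z"
          by (simp add: mult.assoc)
      qed
      also have "cmod (\<Sum>j<n. w j * c j z) \<le> exp 1 * M"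
        unfolding c_def
      proof (rule polarization_step[OF b])
        show "in_ball (\<lambda>i. of_real (y i) * z i)" using y z by (intro in_ball_dilate) auto
        show "in_ball w" unfolding w_def using y by (intro in_ball_dilate) (auto simp: norm_sgn)
        show "cmod (tuple_poly n (Suc (m - 1)) b z) \<le> M" if "in_ball z" for z using M[OF that] m by simp
      qed
      finally show "(\<Sum>j<n. y j * cmod (c j z)) \<le> exp 1 * M"
        by (simp only: norm_of_real)
    qed (use N in simp)
    finally show ?thesis using \<kappa> by (simp add: \<kappa>_def mult_left_mono)
  qed
  have "mixed_norm n m b y 1 1 \<le> sqrt 2 ^ (m - 1) * (1 ^ n * (exp 1 * M))"
  proof (rule tendsto_lowerbound)
    show "(\<lambda>N. sqrt 2 ^ (m - 1) * (grid_distortion (m - 1) N ^ n * (exp 1 * M))) \<longlonglongrightarrow> sqrt 2 ^ (m - 1) * (1 ^ n * (exp 1 * M))"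
      by (intro tendsto_intros grid_distortion_tendsto)
    show "\<forall>\<^sub>F N in sequentially. mixed_norm n m b y 1 1 \<le> sqrt 2 ^ (m - 1) * (grid_distortion (m - 1) N ^ n * (exp 1 * M))"
      using eventually_gt_at_top[of m] by eventually_elim (rule bound)
  qed simp
  then show ?thesis by (simp add: mult_ac)
qed

text \<open>
  The same argument with \<open>L\<^sup>\<rho>\<close> in place of \<open>L\<^sup>1\<close>.  At each point of the torus the first \<open>k\<close> letters form a
  polynomial of the fixed degree \<open>k\<close> on the polydisc, whose coefficients are controlled by an
  arbitrary Bohnenblust-Hille constant \<open>A\<close> for that degree.
\<close>

lemma mixed_norm_k_bound:
  assumes b: "symmetric b" and k: "1 \<le> k" "k \<le> m" and \<rho>: "\<rho> = 2 * real k / (real k + 1)"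
    and M: "\<And>z. in_ball z \<Longrightarrow> cmod (tuple_poly n m b z) \<le> M"
    and y: "y \<in> K" "\<And>j. 0 \<le> y j"
    and A: "A \<ge> 0"
    and BH: "\<And>c M. symmetric c \<Longrightarrow> (\<And>w. (\<And>j. cmod (w j) \<le> 1) \<Longrightarrow> cmod (tuple_poly n k c w) \<le> M) \<Longrightarrow>
               (\<Sum>u\<in>tuples n k. cmod (c u) powr \<rho>) \<le> (A * M) powr \<rho>"
  shows "mixed_norm n m b y k \<rho> \<le> (2 powr (real m / k) * A * exp k * M) powr \<rho>"
proof -
  define N where "N = 2 * m + 1"
  define c where "c u z = tuple_poly n (m - k) (\<lambda>v. b (u @ v)) (\<lambda>i. of_real (y i) * z i)" for u z
  define C where "C = 2 powr (real (m - k) * \<rho> / k)"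
  have N: "m - k < N" "2 * (m - k) < N" by (auto simp: N_def)
  have \<rho>0: "\<rho> > 0" using k by (simp add: \<rho>)
  have "in_ball (\<lambda>j. of_real (y j) * 0)" using y by (intro in_ball_dilate) auto
  from order_trans[OF norm_ge_zero M[OF this]] have M0: "M \<ge> 0" .
  have "mixed_norm n m b y k \<rho> = (\<Sum>u\<in>tuples n k. prod_list (map y u) powr \<rho> *
        torus_avg N n (\<lambda>z. (cmod (c u z))\<^sup>2) powr (\<rho> / 2))"
    unfolding mixed_norm_def c_def parseval_dilated[OF symmetric_append[OF b] N(1)] ..
  also have "\<dots> \<le> (\<Sum>u\<in>tuples n k. prod_list (map y u) powr \<rho> * (C * torus_avg N n (\<lambda>z. cmod (c u z) powr \<rho>)))"
    unfolding c_def tuple_poly_dilate C_def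
    by (intro sum_mono mult_left_mono Lrho_L2_inequality[OF N(2) k(1) \<rho>]) auto
  also have "\<dots> = C * torus_avg N n (\<lambda>z. \<Sum>u\<in>tuples n k. prod_list (map y u) powr \<rho> * cmod (c u z) powr \<rho>)"
    unfolding torus_avg_sum torus_avg_mult_left by (simp add: sum_distrib_left mult_ac)
  also have "\<dots> \<le> C * (A * (exp k * M)) powr \<rho>"
  proof (intro mult_left_mono torus_avg_le_const)
    fix z :: "nat \<Rightarrow> complex" assume z: "\<And>j. cmod (z j) = 1"
    define d where "d u = of_real (prod_list (map y u)) * c u z" for u
    have "symmetric d"
      unfolding symmetric_def
    proof (intro allI impI)
      fix xs ys :: "nat list" assume xy: "mset xs = mset ys"
      have "b (xs @ v) = b (ys @ v)" for v using xy by (intro symmetricD[OF b]) simp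
      moreover have "prod_list (map y xs) = prod_list (map y ys)"
        using symmetricD[OF symmetric_prod_list xy] .
      ultimately show "d xs = d ys" by (simp add: d_def c_def)
    qed
    moreover have "cmod (tuple_poly n k d w) \<le> exp k * M" if w: "\<And>j. cmod (w j) \<le> 1" for w
    proof -
      have "tuple_poly n k d w = (\<Sum>u\<in>tuples n k. prod_list (map (\<lambda>j. of_real (y j) * w j) u) * c u z)"
        unfolding tuple_poly_def d_def prod_list_map_mult prod_list_map_of_real by (simp add: mult_ac)
      also have "cmod \<dots> \<le> exp k * M"
        unfolding c_def
      proof (rule polarization[OF b])
        show "in_ball (\<lambda>j. of_real (y j) * w j)" using y w by (intro in_ball_dilate) auto
        show "in_ball (\<lambda>j. of_real (y j) * z j)" using y z by (intro in_ball_dilate) auto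
        show "cmod (tuple_poly n (k + (m - k)) b z) \<le> M" if "in_ball z" for z using M[OF that] k by simp
      qed
      finally show ?thesis .
    qed
    ultimately have "(\<Sum>u\<in>tuples n k. cmod (d u) powr \<rho>) \<le> (A * (exp k * M)) powr \<rho>" by (rule BH)
    then show "(\<Sum>u\<in>tuples n k. prod_list (map y u) powr \<rho> * cmod (c u z) powr \<rho>) \<le> (A * (exp k * M)) powr \<rho>"
      by (simp add: d_def norm_mult powr_mult abs_of_nonneg[OF prod_list_nonneg] y)
  qed (auto simp: N_def C_def)
  also have "\<dots> \<le> 2 powr (real m * \<rho> / k) * (A * (exp k * M)) powr \<rho>"
    unfolding C_def using \<rho>0 by (intro mult_right_mono powr_mono divide_right_mono) auto
  also have "2 powr (real m * \<rho> / k) = (2 powr (real m / k)) powr \<rho>"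
    by (simp add: powr_powr)
  also have "\<dots> * (A * (exp k * M)) powr \<rho> = (2 powr (real m / k) * A * exp k * M) powr \<rho>"
    using A M0 by (simp add: powr_mult mult_ac)
  finally show ?thesis .
qed

end

section \<open>From mixed norms to coefficients by entropy\<close>

text \<open>
  The sum of the \<open>q\<close>-th powers of the coefficients of a symmetric \<open>tuple_poly\<close>: each monomial is
  counted by its \<open>orderings\<close> many words, each with the share
  \<open>(orderings * \<bar>b\<bar>) powr q / orderings\<close>.
\<close>

definition coeff_mass :: "nat \<Rightarrow> nat \<Rightarrow> (nat list \<Rightarrow> complex) \<Rightarrow> real \<Rightarrow> real" where
  "coeff_mass n m b q = (\<Sum>xs\<in>tuples n m. real (orderings xs) powr (q - 1) * cmod (b xs) powr q)"

locale coefficient_law =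
  fixes n m :: nat and b :: "nat list \<Rightarrow> complex" and q s :: real
  assumes b: "symmetric b" and m: "m \<ge> 1" and q: "q > 0" and mass: "coeff_mass n m b q > 0"
begin

definition law :: "nat list \<Rightarrow> real" where
  "law xs = real (orderings xs) powr (q - 1) * cmod (b xs) powr q / coeff_mass n m b q"

sublocale symmetric_law n m law
proof
  show "0 \<le> law xs" for xs using mass by (simp add: law_def)
  show "(\<Sum>xs\<in>tuples n m. law xs) = 1"
    unfolding law_def sum_divide_distrib[symmetric] using mass by (simp add: coeff_mass_def)
  show "symmetric law"
    unfolding symmetric_def law_def
  proof (intro allI impI)
    fix xs ys :: "nat list" assume xy: "mset xs = mset ys"
    show "real (orderings xs) powr (q - 1) * cmod (b xs) powr q / coeff_mass n m b q =
          real (orderings ys) powr (q - 1) * cmod (b ys) powr q / coeff_mass n m b q"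
      using orderings_cong[OF xy] symmetricD[OF b xy] by simp
  qed
qed

text \<open>
  The test vector.  For \<open>s = 1 / p\<close> its \<open>p\<close>-th powers are the frequencies of the letters, so it lies on the
  unit sphere of \<open>l\<^sub>p\<close>; for \<open>s = 0\<close> its entries are \<open>1\<close> on the letters that occur and \<open>0\<close> elsewhere.
\<close>

definition weight :: "nat \<Rightarrow> real" where
  "weight j = marginal n m law 1 [j] powr s"

text \<open>
  The part of the entropy of the random word that is due to the random order of its letters;
  the rest is the entropy of the random monomial.
\<close>

definition ordering_entropy :: real where
  "ordering_entropy = (\<Sum>xs\<in>tuples n m. law xs * ln (real (orderings xs)))"

lemma weight_nonneg: "0 \<le> weight j"
  by (simp add: weight_def)

lemma weight_pos: "0 < marginal n m law 1 [j] \<Longrightarrow> 0 < weight j"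
  by (simp add: weight_def)

lemma marginal_letter_pos:
  "k \<le> m \<Longrightarrow> u \<in> tuples n k \<Longrightarrow> 0 < marginal n m law k u \<Longrightarrow> j \<in> set u \<Longrightarrow> 0 < marginal n m law 1 [j]"
proof -
  assume k: "k \<le> m" and u: "u \<in> tuples n k" and pos: "0 < marginal n m law k u" and j: "j \<in> set u"
  from j obtain us vs where us: "u = us @ j # vs" by (meson split_list)
  have "k \<noteq> 0" using u j by (auto simp: tuples_def)
  have vs: "us @ vs \<in> tuples n (k - 1)" using u unfolding us tuples_def by auto
  have "marginal n m law k u = marginal n m law (1 + (k - 1)) ([j] @ (us @ vs))"
    using \<open>k \<noteq> 0\<close> by (simp add: us) (rule symmetricD[OF marginal_symmetric], simp)
  then show ?thesis
    using pos k \<open>k \<noteq> 0\<close> by (intro marginal_prefix_pos[of 1 "k - 1" "us @ vs" "[j]"] vs) auto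
qed

lemma prod_weight:
  assumes "\<And>j. j \<in> set u \<Longrightarrow> 0 < marginal n m law 1 [j]"
  shows "0 < prod_list (map weight u) \<and> ln (prod_list (map weight u)) = sum_list (map (\<lambda>j. s * ln (marginal n m law 1 [j])) u)"
  using assms
proof (induction u)
  case Nil then show ?case by simp
next
  case (Cons j u)
  then have "0 < weight j" using weight_pos[of j] by simp
  moreover have "ln (weight j) = s * ln (marginal n m law 1 [j])"
    using Cons.prems[of j] by (simp add: weight_def ln_powr)
  moreover have "0 < prod_list (map weight u)"
    "ln (prod_list (map weight u)) = sum_list (map (\<lambda>j. s * ln (marginal n m law 1 [j])) u)"
    using Cons by auto
  ultimately show ?case by (simp add: ln_mult_pos)
qed

lemma law_pos_letter: "xs \<in> tuples n m \<Longrightarrow> 0 < law xs \<Longrightarrow> j \<in> set xs \<Longrightarrow> 0 < marginal n m law 1 [j]"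
  using marginal_letter_pos[of m xs j] by (simp add: marginal_full)

lemma entropy_1: "H 1 = - (\<Sum>j<n. marginal n m law 1 [j] * ln (marginal n m law 1 [j]))"
  unfolding entropy_def One_nat_def sum_tuples_1 ..

lemma entropy_m: "H m = - (\<Sum>xs\<in>tuples n m. law xs * ln (law xs))"
  unfolding entropy_def marginal_full ..

lemma entropy_le: "H m \<le> m * H 1"
  using entropy_blocks[of 0 0 m] by simp

lemma ordering_entropy_nonneg: "0 \<le> ordering_entropy"
  unfolding ordering_entropy_def
proof (intro sum_nonneg mult_nonneg_nonneg nonneg)
  fix xs :: "nat list"
  have "1 \<le> real (orderings xs)" using orderings_pos[of xs] by linarith
  then show "0 \<le> ln (real (orderings xs))" by simp
qed

text \<open>
  Insert into \<open>mixed_norm_lower_bound\<close> that \<open>ln \<bar>b\<bar>\<close> is an affine function of the logarithms of the law and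
  of the multinomial coefficient, and that \<open>ln (weight j)\<close> is \<open>s\<close> times the logarithm of a letter
  frequency, so that its expected sum over the letters of a word is \<open>- m s H\<^sub>1\<close>.
\<close>

lemma mixed_norm_entropy_bound:
  assumes k: "1 \<le> k" "k \<le> m" and \<rho>: "\<rho> > 0" and C: "C \<ge> 0"
    and le: "mixed_norm n m b weight k \<rho> \<le> C powr \<rho>"
  shows "0 < C"
    and "ln (coeff_mass n m b q) / q + (1 / 2 - 1 / q) * (H m - ordering_entropy) - m * s * H 1
       + (1 / \<rho> - 1 / 2) * H k - k / 2 * ln m \<le> ln C"
proof -
  define S where "S = coeff_mass n m b q"
  have S: "S > 0" using mass by (simp add: S_def)
  define g where "g u = prod_list (map weight u)" for u
  define c where "c xs v = real (orderings v) * (cmod (b xs))\<^sup>2 * (g v)\<^sup>2" for xs v :: "nat list"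
  have g0: "0 \<le> g u" for u unfolding g_def by (intro prod_list_nonneg weight_nonneg)
  have c0: "0 \<le> c (u @ v) v" for u v by (simp add: c_def)
  have bpos: "b xs \<noteq> 0" if "0 < law xs" for xs using that by (auto simp: law_def)
  have gpos: "0 < g u" if "u \<in> tuples n k" "0 < \<phi> k u" for u
    unfolding g_def using prod_weight marginal_letter_pos[OF k(2) that] by blast
  have gpos': "0 < g u \<and> 0 < g v \<and> ln (g u) + ln (g v) = sum_list (map (\<lambda>j. s * ln (\<phi> 1 [j])) (u @ v))"
    if "u \<in> tuples n k" "v \<in> tuples n (m - k)" "0 < law (u @ v)" for u v
  proof -
    have uv: "u @ v \<in> tuples n m" using append_in_tuples[OF that(1,2)] k by simp
    have "0 < \<phi> 1 [j]" if j: "j \<in> set (u @ v)" for j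
      using law_pos_letter[OF uv \<open>0 < law (u @ v)\<close> j] .
    then have "0 < \<phi> 1 [j]" if "j \<in> set u \<or> j \<in> set v" for j using that by auto
    then show ?thesis unfolding g_def using prod_weight[of u] prod_weight[of v] by auto
  qed
  have cpos: "0 < c (u @ v) v" if "u \<in> tuples n k" "v \<in> tuples n (m - k)" "0 < law (u @ v)" for u v
    using gpos'[OF that] bpos[OF that(3)] orderings_pos[of v] by (simp add: c_def)
  define Z where "Z = (\<Sum>u\<in>tuples n k. g u powr \<rho> * (\<Sum>v\<in>tuples n (m - k). c (u @ v) v) powr (\<rho> / 2))"
  have Zeq: "Z = mixed_norm n m b weight k \<rho>" by (simp add: Z_def mixed_norm_def c_def g_def)
  have Z: "Z > 0" unfolding Z_def by (rule mixed_norm_positive[where c = c and g = g, OF k(2) c0 g0 cpos gpos])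
  have "Z \<le> C powr \<rho>" using le Zeq by simp
  with Z have "C powr \<rho> > 0" by linarith
  then show Cpos: "0 < C" using C by (cases "C = 0") auto
  have "ln Z \<le> \<rho> * ln C" using \<open>Z \<le> C powr \<rho>\<close> Z Cpos by (metis ln_mono ln_powr less_numeral_extra(3))
  then have lnZ: "ln Z / \<rho> \<le> ln C" using \<rho> by (simp add: field_simps)
  have main: "(\<Sum>u\<in>tuples n k. \<phi> k u * ln (g u))
      + (\<Sum>u\<in>tuples n k. \<Sum>v\<in>tuples n (m - k). law (u @ v) * ln (c (u @ v) v)) / 2 + H m / 2 + (1 / \<rho> - 1 / 2) * H k
     \<le> ln Z / \<rho>"
    unfolding Z_def by (rule mixed_norm_lower_bound[where c = c and g = g, OF k(2) \<rho> c0 g0 cpos gpos])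
  define f where "f xs = law xs * sum_list (map (\<lambda>j. s * ln (\<phi> 1 [j])) xs)
      + (law xs * ln (law xs) / q + law xs * (ln S / q) - (1 / 2 - 1 / q) * (law xs * ln (real (orderings xs))) - law xs * (k / 2 * ln m))" for xs
  have f_le: "f (u @ v) \<le> law (u @ v) * ln (g u) + law (u @ v) * ln (c (u @ v) v) / 2"
    if u: "u \<in> tuples n k" and v: "v \<in> tuples n (m - k)" for u v
  proof (cases "law (u @ v) = 0")
    case True then show ?thesis by (simp add: f_def)
  next
    case False
    then have p: "0 < law (u @ v)" using nonneg[of "u @ v"] by simp
    note g' = gpos'[OF u v p]
    have o: "real (orderings (u @ v)) > 0" "real (orderings v) > 0" using orderings_pos by auto
    have b0: "cmod (b (u @ v)) > 0" using bpos[OF p] by simp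
    have "ln (law (u @ v)) = (q - 1) * ln (real (orderings (u @ v))) + q * ln (cmod (b (u @ v))) - ln S"
      unfolding law_def S_def[symmetric] using o b0 S by (simp add: ln_mult ln_div ln_powr)
    then have "ln (cmod (b (u @ v))) * q = ln (law (u @ v)) + ln S - (q - 1) * ln (real (orderings (u @ v)))"
      by (simp add: mult.commute)
    then have "ln (cmod (b (u @ v))) = (ln (law (u @ v)) + ln S - (q - 1) * ln (real (orderings (u @ v)))) / q"
      using q by (simp add: eq_divide_eq)
    then have lb: "ln (cmod (b (u @ v))) = ln (law (u @ v)) / q + ln S / q - (1 - 1 / q) * ln (real (orderings (u @ v)))"
      using q by (simp add: add_divide_distrib diff_divide_distrib left_diff_distrib)
    have len: "length u = k" "length u + length v = m" using u v k by (auto simp: tuples_def)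
    have "real (orderings (u @ v)) \<le> real (m ^ k * orderings v)"
      using orderings_append_le[of u v] len by (intro of_nat_mono) simp
    then have "ln (real (orderings (u @ v))) \<le> ln (real m ^ k * real (orderings v))"
      using o by (intro ln_mono) auto
    also have "\<dots> = k * ln m + ln (real (orderings v))"
      using o m by (simp add: ln_mult ln_realpow)
    finally have lo: "ln (real (orderings (u @ v))) \<le> k * ln m + ln (real (orderings v))" .
    have lc: "ln (c (u @ v) v) = ln (real (orderings v)) + 2 * ln (cmod (b (u @ v))) + 2 * ln (g v)"
      unfolding c_def using o b0 g' by (simp add: ln_mult ln_realpow)
    have "ln (g u) + ln (c (u @ v) v) / 2 \<ge> sum_list (map (\<lambda>j. s * ln (\<phi> 1 [j])) (u @ v))
        + (ln (law (u @ v)) / q + ln S / q - (1 / 2 - 1 / q) * ln (real (orderings (u @ v))) - k / 2 * ln m)"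
    proof -
      define L where "L = ln (real (orderings (u @ v)))"
      have e: "(1 - 1 / q) * L = L - L / q" "(1 / 2 - 1 / q) * L = L / 2 - L / q"
        using left_diff_distrib[of 1 "1 / q" L] left_diff_distrib[of "1 / 2" "1 / q" L] by auto
      have "sum_list (map (\<lambda>j. s * ln (\<phi> 1 [j])) (u @ v)) = ln (g u) + ln (g v)" using g' by simp
      moreover have "ln (cmod (b (u @ v))) = ln (law (u @ v)) / q + ln S / q - (L - L / q)"
        using lb[folded L_def] unfolding e .
      ultimately show ?thesis using lo lc unfolding L_def[symmetric] e by linarith
    qed
    then have "law (u @ v) * (sum_list (map (\<lambda>j. s * ln (\<phi> 1 [j])) (u @ v))
        + (ln (law (u @ v)) / q + ln S / q - (1 / 2 - 1 / q) * ln (real (orderings (u @ v))) - k / 2 * ln m))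
       \<le> law (u @ v) * (ln (g u) + ln (c (u @ v) v) / 2)"
      using p by (intro mult_left_mono) auto
    then show ?thesis by (simp add: f_def algebra_simps)
  qed
  have "(\<Sum>xs\<in>tuples n m. f xs) = (\<Sum>u\<in>tuples n k. \<Sum>v\<in>tuples n (m - k). f (u @ v))"
    using sum_tuples_append[of f n k "m - k"] k by simp
  also have "\<dots> \<le> (\<Sum>u\<in>tuples n k. \<Sum>v\<in>tuples n (m - k). law (u @ v) * ln (g u) + law (u @ v) * ln (c (u @ v) v) / 2)"
    by (intro sum_mono f_le)
  also have "\<dots> = (\<Sum>u\<in>tuples n k. \<phi> k u * ln (g u))
      + (\<Sum>u\<in>tuples n k. \<Sum>v\<in>tuples n (m - k). law (u @ v) * ln (c (u @ v) v)) / 2"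
    by (simp add: sum.distrib marginal_def sum_distrib_right sum_divide_distrib)
  finally have sum_f: "(\<Sum>xs\<in>tuples n m. f xs) + H m / 2 + (1 / \<rho> - 1 / 2) * H k \<le> ln C"
    using main lnZ by linarith
  have "(\<Sum>xs\<in>tuples n m. law xs * sum_list (map (\<lambda>j. s * ln (\<phi> 1 [j])) xs)) = m * (\<Sum>j<n. \<phi> 1 [j] * (s * ln (\<phi> 1 [j])))"
    using expectation_sum_list[of m "\<lambda>j. s * ln (\<phi> 1 [j])"] by (simp add: marginal_full)
  also have "\<dots> = - (m * s * H 1)"
    unfolding entropy_1 by (simp add: sum_distrib_left mult_ac)
  finally have 1: "(\<Sum>xs\<in>tuples n m. law xs * sum_list (map (\<lambda>j. s * ln (\<phi> 1 [j])) xs)) = - (m * s * H 1)" .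
  have "(\<Sum>xs\<in>tuples n m. f xs) = - (m * s * H 1) + (- (H m) / q + ln S / q - (1 / 2 - 1 / q) * ordering_entropy - k / 2 * ln m)"
    unfolding f_def sum.distrib sum_subtractf 1 entropy_m ordering_entropy_def
    using total by (simp add: sum_divide_distrib[symmetric] sum_distrib_left[symmetric] sum_distrib_right[symmetric])
  with sum_f show "ln (coeff_mass n m b q) / q + (1 / 2 - 1 / q) * (H m - ordering_entropy) - m * s * H 1
       + (1 / \<rho> - 1 / 2) * H k - k / 2 * ln m \<le> ln C"
    by (simp add: S_def algebra_simps)
qed

text \<open>
  Given the monomial, its first letter takes at most \<open>m\<close> values.  In quantitative form: a letter of a word
  has at least \<open>1 / m\<close> times the probability of the whole monomial.
\<close>

lemma letter_entropy_le: "H 1 - ln m \<le> H m - ordering_entropy"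
proof -
  have m1: "1 + (m - 1) = m" using m by simp
  have pt: "law (j # v) * ln (law (j # v)) + law (j # v) * ln (real (orderings (j # v)))
      \<le> law (j # v) * ln (\<phi> 1 [j]) + law (j # v) * ln m"
    if j: "j < n" and v: "v \<in> tuples n (m - 1)" for j v
  proof (cases "law (j # v) = 0")
    case True then show ?thesis by simp
  next
    case False
    then have p: "0 < law (j # v)" using nonneg[of "j # v"] by simp
    have o: "real (orderings (j # v)) > 0" using orderings_pos by simp
    have len: "Suc (length v) = m" using v m by (simp add: tuples_def)
    have "real (orderings (j # v)) \<le> real (m * orderings v)"
      by (intro of_nat_mono orderings_Cons_le[of j v, unfolded len])
    then have "law (j # v) * real (orderings (j # v)) \<le> m * (orderings v * law (j # v))"
      using p by (simp add: mult_ac)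
    also have "orderings v * law (j # v) = (\<Sum>w\<in>{w. mset w = mset v}. law (j # w))"
    proof -
      have "(\<Sum>w\<in>{w. mset w = mset v}. law (j # w)) = (\<Sum>w\<in>{w. mset w = mset v}. law (j # v))"
        by (intro sum.cong refl symmetricD[OF sym]) simp
      then show ?thesis by (simp add: orderings_def)
    qed
    also have "\<dots> \<le> \<phi> 1 [j]"
      unfolding marginal_def using v
      by (intro order_trans[OF sum_mono2[of "tuples n (m - 1)" "{w. mset w = mset v}" "\<lambda>w. law (j # w)"]])
         (auto intro: mset_eq_in_tuples[OF HOL.sym] nonneg)
    finally have le: "law (j # v) * real (orderings (j # v)) \<le> m * \<phi> 1 [j]" using m by simp
    then have "0 < m * \<phi> 1 [j]" using p o by (meson less_le_trans mult_pos_pos)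
    then have phi: "\<phi> 1 [j] > 0" using m by (simp add: zero_less_mult_iff)
    have "ln (law (j # v) * real (orderings (j # v))) \<le> ln (m * \<phi> 1 [j])" using le p o by (intro ln_mono) auto
    then have "ln (law (j # v)) + ln (real (orderings (j # v))) \<le> ln (\<phi> 1 [j]) + ln m"
      using p o phi m by (simp add: ln_mult)
    then have "law (j # v) * (ln (law (j # v)) + ln (real (orderings (j # v)))) \<le> law (j # v) * (ln (\<phi> 1 [j]) + ln m)"
      using p by (intro mult_left_mono) auto
    then show ?thesis by (simp add: distrib_left)
  qed
  have split: "(\<Sum>xs\<in>tuples n m. F xs) = (\<Sum>j<n. \<Sum>v\<in>tuples n (m - 1). F (j # v))" for F :: "nat list \<Rightarrow> real"
    using sum_tuples_Suc[of F n "m - 1"] m by simp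
  have marg: "(\<Sum>v\<in>tuples n (m - 1). law (j # v)) = \<phi> 1 [j]" for j by (simp add: marginal_def)
  have "(\<Sum>xs\<in>tuples n m. law xs * ln (law xs)) + ordering_entropy
     \<le> (\<Sum>j<n. \<Sum>v\<in>tuples n (m - 1). law (j # v) * ln (\<phi> 1 [j]) + law (j # v) * ln m)"
    unfolding ordering_entropy_def split sum.distrib[symmetric] by (intro sum_mono pt) auto
  also have "\<dots> = (\<Sum>j<n. (\<Sum>v\<in>tuples n (m - 1). law (j # v)) * ln (\<phi> 1 [j])) + (\<Sum>xs\<in>tuples n m. law xs) * ln m"
    unfolding split by (simp add: sum.distrib sum_distrib_right)
  also have "\<dots> = - H 1 + ln m" unfolding marg entropy_1 total by simp
  finally show ?thesis unfolding entropy_m by linarith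
qed

text \<open>
  This is the range \<open>p \<ge> 2m\<close>, where \<open>s = 1 / p\<close>.  The entropies combine to
  \<open>(1/2 - m s) (H\<^sub>1 - H\<^sub>m / m)\<close>, a product of two nonnegative factors.
\<close>

lemma coeff_norm_bound_large:
  assumes s: "0 \<le> s" "2 * real m * s \<le> 1" and qs: "1 / q = 1 / 2 + 1 / (2 * real m) - s"
    and C: "C \<ge> 0" "mixed_norm n m b weight 1 1 \<le> C"
  shows "C > 0" "ln (coeff_mass n m b q) / q \<le> ln C + ln m / 2"
proof -
  have le: "mixed_norm n m b weight 1 1 \<le> C powr 1" using C by simp
  note B = mixed_norm_entropy_bound[OF _ m _ C(1) le, simplified]
  show "C > 0" by (rule B)
  have coef: "1 / 2 - 1 / q = s - 1 / (2 * real m)" using qs by simp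
  have neg: "s - 1 / (2 * real m) \<le> 0" using s m by (simp add: field_simps)
  have "(s - 1 / (2 * real m)) * H m \<le> (s - 1 / (2 * real m)) * (H m - ordering_entropy)"
    using neg ordering_entropy_nonneg by (intro mult_left_mono_neg) auto
  moreover have "0 \<le> (1 / 2 - m * s) * (H 1 - H m / m)"
    using s entropy_le m by (intro mult_nonneg_nonneg) (auto simp: field_simps)
  moreover have "(1 / 2 - m * s) * (H 1 - H m / m) = (s - 1 / (2 * real m)) * H m - m * s * H 1 + H 1 / 2"
    using m by (simp add: field_simps)
  ultimately show "ln (coeff_mass n m b q) / q \<le> ln C + ln m / 2"
    using B(2) unfolding coef by simp
qed

text \<open>
  This is the range \<open>m < p \<le> 2m\<close>, where \<open>s = 1 / p\<close>.  Here \<open>q \<ge> 2\<close>, so that only the entropy of the random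
  monomial can be used, without that of the order of its letters.  The entropies combine to the
  nonnegative multiple \<open>m s - 1/2\<close> of the difference between the entropies of the monomial and of a letter,
  which is at least \<open>- ln m\<close> by \<open>letter_entropy_le\<close>.
\<close>

lemma coeff_norm_bound_small:
  assumes s: "1 \<le> 2 * real m * s" "m * s \<le> 1" and qs: "1 / q = 1 - m * s"
    and C: "C \<ge> 0" "mixed_norm n m b weight 1 1 \<le> C"
  shows "C > 0" "ln (coeff_mass n m b q) / q \<le> ln C + ln m"
proof -
  have le: "mixed_norm n m b weight 1 1 \<le> C powr 1" using C by simp
  note B = mixed_norm_entropy_bound[OF _ m _ C(1) le, simplified]
  show "C > 0" by (rule B)
  have coef: "1 / 2 - 1 / q = m * s - 1 / 2" using qs by simp
  have "(m * s - 1 / 2) * (H 1 - ln m) \<le> (m * s - 1 / 2) * (H m - ordering_entropy)"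
    using s letter_entropy_le by (intro mult_left_mono) auto
  moreover have "m * s * ln m \<le> 1 * ln m" using s m by (intro mult_right_mono) auto
  ultimately show "ln (coeff_mass n m b q) / q \<le> ln C + ln m"
    using B(2) unfolding coef by (simp add: algebra_simps)
qed

text \<open>
  A geometric mean of the estimates with \<open>k\<close> free letters and with one free letter.  Writing
  \<open>m = a k + r\<close> and \<open>\<tau> = 2 m s\<close>, the weight \<open>w = (1 - \<tau>) a k / m\<close> is dictated by two requirements: the
  entropies \<open>H\<^sub>k\<close> and \<open>H\<^sub>1\<close> must appear in the proportion \<open>a : r\<close> of the block decomposition of \<open>H\<^sub>m\<close>, and the
  further share \<open>\<tau>\<close> of \<open>H\<^sub>1\<close> has to pay for the term \<open>m s H\<^sub>1\<close> caused by the test vector.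
\<close>

lemma coeff_norm_bound_blocks:
  assumes s: "0 \<le> s" "2 * real m * s \<le> 1" and qs: "1 / q = 1 / 2 + 1 / (2 * real m) - s"
    and k: "1 \<le> k" "k \<le> m" and \<rho>: "\<rho> = 2 * real k / (real k + 1)"
    and C: "C \<ge> 0" "mixed_norm n m b weight 1 1 \<le> C"
    and D: "D \<ge> 0" "mixed_norm n m b weight k \<rho> \<le> D powr \<rho>"
  defines "w \<equiv> (1 - 2 * real m * s) * ((m div k) * k / m)"
  shows "C > 0" "D > 0"
    "ln (coeff_mass n m b q) / q \<le> w * (ln D + k / 2 * ln m) + (1 - w) * (ln C + ln m / 2)"
proof -
  have le: "mixed_norm n m b weight 1 1 \<le> C powr 1" using C by simp
  note B1 = mixed_norm_entropy_bound[OF _ m _ C(1) le, simplified]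
  have \<rho>0: "\<rho> > 0" using k by (simp add: \<rho>)
  note Bk = mixed_norm_entropy_bound[OF k \<rho>0 D]
  show "C > 0" "D > 0" by (rule B1 Bk)+
  define x where "x = ln (coeff_mass n m b q) / q"
  have coef: "1 / 2 - 1 / q = s - 1 / (2 * real m)" using qs by simp
  have neg: "s - 1 / (2 * real m) \<le> 0" using s m by (simp add: field_simps)
  have G: "(s - 1 / (2 * real m)) * H m \<le> (s - 1 / (2 * real m)) * (H m - ordering_entropy)"
    using neg ordering_entropy_nonneg by (intro mult_left_mono_neg) auto
  define base where "base = x + (s - 1 / (2 * real m)) * H m - m * s * H 1"
  have 1: "base + H 1 / 2 \<le> ln C + ln m / 2"
    using B1(2) G unfolding coef base_def x_def by simp
  have "1 / \<rho> - 1 / 2 = 1 / (2 * k)" using k by (simp add: \<rho> field_simps)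
  then have 2: "base + H k / (2 * k) \<le> ln D + k / 2 * ln m"
    using Bk(2) G unfolding coef base_def x_def by simp
  define a where "a = m div k"
  define r where "r = m mod k"
  have mk: "m = a * k + r" by (simp add: a_def r_def)
  have Hm: "H m \<le> a * H k + r * H 1" using entropy_blocks[of a k r] mk by simp
  define \<tau> where "\<tau> = 2 * real m * s"
  have \<tau>: "0 \<le> \<tau>" "\<tau> \<le> 1" using s by (auto simp: \<tau>_def)
  have w: "w = (1 - \<tau>) * (a * k / m)" by (simp add: w_def \<tau>_def a_def)
  have ak: "a * k / m \<le> (1::real)" "0 \<le> a * k / (m::real)"
    using mk m by (auto simp: divide_le_eq simp flip: of_nat_mult)
  have "(1 - \<tau>) * (a * k / m) \<le> 1 * 1" using \<tau> ak by (intro mult_mono) auto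
  then have w01: "0 \<le> w" "w \<le> 1" unfolding w using \<tau> ak by auto
  have "w * (base + H k / (2 * k)) + (1 - w) * (base + H 1 / 2)
     \<le> w * (ln D + k / 2 * ln m) + (1 - w) * (ln C + ln m / 2)"
    by (rule add_mono[OF mult_left_mono[OF 2 w01(1)] mult_left_mono[OF 1]]) (use w01 in simp)
  moreover have "x \<le> w * (base + H k / (2 * k)) + (1 - w) * (base + H 1 / 2)"
  proof -
    have mr: "real m = a * k + r" using mk by (metis of_nat_add of_nat_mult)
    have m0: "real m > 0" using m by simp
    have "(1 - \<tau>) * (H m / (2 * real m)) \<le> (1 - \<tau>) * ((a * H k + r * H 1) / (2 * real m))"
      using \<tau> Hm m0 by (intro mult_left_mono divide_right_mono) auto
    also have "\<dots> = w * (H k / (2 * k)) + (1 - \<tau>) * (r / m) * (H 1 / 2)"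
      using k m0 by (simp add: w field_simps)
    also have "(1 - \<tau>) * (r / m) = 1 - w - \<tau>"
    proof -
      have "r / m = 1 - a * k / m" using mr m0 by (simp add: field_simps)
      moreover have "(1 - t) * (1 - X) = 1 - (1 - t) * X - t" for t X :: real by (simp add: algebra_simps)
      ultimately show ?thesis unfolding w by presburger
    qed
    also have "(1 - w - \<tau>) * (H 1 / 2) = (1 - w) * (H 1 / 2) - \<tau> * (H 1 / 2)"
      by (rule left_diff_distrib)
    finally have 3: "(1 - \<tau>) * (H m / (2 * real m)) + \<tau> * (H 1 / 2) \<le> w * (H k / (2 * k)) + (1 - w) * (H 1 / 2)"
      by simp
    have sH: "s * H m = \<tau> * (H m / (2 * real m))" "m * s * H 1 = \<tau> * (H 1 / 2)"
      using m0 by (auto simp: \<tau>_def)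
    have "base = x - (1 - \<tau>) * (H m / (2 * real m)) - \<tau> * (H 1 / 2)"
    proof -
      define h where "h = H m / (2 * real m)"
      have "base = x + (s * H m - h) - m * s * H 1" by (simp add: base_def left_diff_distrib h_def)
      moreover have "(1 - \<tau>) * h = h - \<tau> * h" by (simp add: left_diff_distrib)
      ultimately show ?thesis using sH unfolding h_def[symmetric] by linarith
    qed
    with 3 have "x \<le> base + w * (H k / (2 * k)) + (1 - w) * (H 1 / 2)" by linarith
    also have "\<dots> = w * (base + H k / (2 * k)) + (1 - w) * (base + H 1 / 2)" by (simp add: algebra_simps)
    finally show ?thesis .
  qed
  ultimately show "ln (coeff_mass n m b q) / q \<le> w * (ln D + k / 2 * ln m) + (1 - w) * (ln C + ln m / 2)"
    by (simp add: x_def)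
qed

end

section \<open>The Bohnenblust-Hille inequality of fixed degree\<close>

lemma tuple_poly_cong: "(\<And>j. j < n \<Longrightarrow> z j = w j) \<Longrightarrow> tuple_poly n m b z = tuple_poly n m b w"
proof -
  assume eq: "\<And>j. j < n \<Longrightarrow> z j = w j"
  have "map z xs = map w xs" if "xs \<in> tuples n m" for xs
    using that eq by (auto simp: tuples_def)
  then have "b xs * prod_list (map z xs) = b xs * prod_list (map w xs)" if "xs \<in> tuples n m" for xs
    using that by metis
  then show ?thesis unfolding tuple_poly_def by (rule sum.cong[OF refl])
qed

lemma le_powr_of_ln_le:
  fixes S q C :: real
  assumes "0 < S" "0 < q" "0 < C" "ln S / q \<le> ln C"
  shows "S \<le> C powr q"
proof -
  have "ln S \<le> ln (C powr q)" using assms by (simp add: ln_powr field_simps)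
  then show ?thesis using assms by (subst (asm) ln_le_cancel_iff) auto
qed

text \<open>
  Any constant depending on the degree alone would serve for \<open>k\<close> fixed; this one is also
  the cost of the one-letter estimate in degree \<open>m\<close>.
\<close>

definition bh_const :: "nat \<Rightarrow> real" where
  "bh_const k = sqrt k * exp 1 * sqrt 2 ^ (k - 1)"

text \<open>
  The case \<open>s = 0\<close> of \<open>coeff_norm_bound_large\<close>.
\<close>

lemma bohnenblust_hille_tuple:
  assumes c: "symmetric c" and k: "k \<ge> 1" and \<rho>: "\<rho> = 2 * real k / (real k + 1)"
    and M: "\<And>w. (\<And>j. cmod (w j) \<le> 1) \<Longrightarrow> cmod (tuple_poly n k c w) \<le> M"
  shows "(\<Sum>u\<in>tuples n k. cmod (c u) powr \<rho>) \<le> (bh_const k * M) powr \<rho>"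
proof -
  interpret solid_convex n "{y. \<forall>j<n. \<bar>y j\<bar> \<le> 1}"
  proof
    fix x y :: "nat \<Rightarrow> real" and t :: real
    assume x: "x \<in> {y. \<forall>j<n. \<bar>y j\<bar> \<le> 1}" and y: "y \<in> {y. \<forall>j<n. \<bar>y j\<bar> \<le> 1}" and t: "0 \<le> t" "t \<le> 1"
    have "\<bar>(1 - t) * x j + t * y j\<bar> \<le> 1" if "j < n" for j
    proof -
      have "\<bar>(1 - t) * x j + t * y j\<bar> \<le> (1 - t) * \<bar>x j\<bar> + t * \<bar>y j\<bar>"
        using t by (intro order_trans[OF abs_triangle_ineq]) (simp add: abs_mult)
      also have "\<dots> \<le> (1 - t) * 1 + t * 1"
        using x y t that by (intro add_mono mult_left_mono) auto
      finally show ?thesis by simp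
    qed
    then show "(\<lambda>j. (1 - t) * x j + t * y j) \<in> {y. \<forall>j<n. \<bar>y j\<bar> \<le> 1}" by simp
  qed (auto intro: order_trans)
  have \<rho>1: "\<rho> \<ge> 1" using k by (simp add: \<rho> field_simps)
  have M0: "M \<ge> 0" using order_trans[OF norm_ge_zero M[of "\<lambda>_. 0"]] by simp
  have Mball: "cmod (tuple_poly n k c z) \<le> M" if "in_ball z" for z
  proof -
    have "tuple_poly n k c z = tuple_poly n k c (\<lambda>j. if j < n then z j else 0)"
      by (rule tuple_poly_cong) simp
    then show ?thesis using that M[of "\<lambda>j. if j < n then z j else 0"] by (simp add: in_ball_def)
  qed
  have "(\<Sum>u\<in>tuples n k. cmod (c u) powr \<rho>) \<le> coeff_mass n k c \<rho>"
    unfolding coeff_mass_def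
  proof (intro sum_mono)
    fix u :: "nat list"
    have "1 \<le> real (orderings u)" using orderings_pos[of u] by linarith
    then have "1 \<le> real (orderings u) powr (\<rho> - 1)" using \<rho>1 by (intro ge_one_powr_ge_zero) auto
    then have "1 * cmod (c u) powr \<rho> \<le> real (orderings u) powr (\<rho> - 1) * cmod (c u) powr \<rho>"
      by (intro mult_right_mono) auto
    then show "cmod (c u) powr \<rho> \<le> real (orderings u) powr (\<rho> - 1) * cmod (c u) powr \<rho>" by simp
  qed
  also have "\<dots> \<le> (bh_const k * M) powr \<rho>"
  proof (cases "coeff_mass n k c \<rho> > 0")
    case True
    then interpret coefficient_law n k c \<rho> 0
      using c k \<rho>1 by unfold_locales auto
    have "mixed_norm n k c weight 1 1 \<le> exp 1 * sqrt 2 ^ (k - 1) * M"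
      by (rule mixed_norm_1_bound[OF c k Mball]) (auto simp: weight_nonneg, simp add: weight_def)
    from coeff_norm_bound_large[OF _ _ _ _ this] have C: "exp 1 * sqrt 2 ^ (k - 1) * M > 0"
      and ln: "ln (coeff_mass n k c \<rho>) / \<rho> \<le> ln (exp 1 * sqrt 2 ^ (k - 1) * M) + ln k / 2"
      using k M0 by (auto simp: \<rho> field_simps)
    have eq: "bh_const k * M = sqrt k * (exp 1 * sqrt 2 ^ (k - 1) * M)" by (simp add: bh_const_def)
    have "0 < sqrt (real k)" using k by simp
    from mult_pos_pos[OF this C] have pos: "bh_const k * M > 0" by (simp only: eq)
    have "ln (exp 1 * sqrt 2 ^ (k - 1) * M) + ln k / 2 = ln (bh_const k * M)"
      unfolding eq using C k by (simp only: ln_mult_pos real_sqrt_gt_zero of_nat_0_less_iff ln_sqrt)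
    then show ?thesis
      using True ln \<rho>1 pos by (intro le_powr_of_ln_le) auto
  next
    case False
    then show ?thesis by (intro order_trans[OF _ powr_ge_zero]) auto
  qed
  finally show ?thesis .
qed

section \<open>Balls of finite-dimensional lp spaces\<close>

definition lp_ball :: "nat \<Rightarrow> ereal \<Rightarrow> (nat \<Rightarrow> real) set" where
  "lp_ball n p = {y. lp_norm n p y \<le> 1}"

lemma lp_ball_infinity: "n \<ge> 1 \<Longrightarrow> y \<in> lp_ball n \<infinity> \<longleftrightarrow> (\<forall>j<n. \<bar>y j\<bar> \<le> 1)"
  by (auto simp: lp_ball_def lp_norm_def Max_le_iff lessThan_empty_iff)

lemma lp_ball_real:
  assumes "r > 0"
  shows "y \<in> lp_ball n (ereal r) \<longleftrightarrow> (\<Sum>j<n. \<bar>y j\<bar> powr r) \<le> 1"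
proof -
  define S where "S = (\<Sum>j<n. \<bar>y j\<bar> powr r)"
  have "S \<ge> 0" by (simp add: S_def sum_nonneg)
  then have "S powr (1 / r) \<le> 1 \<longleftrightarrow> S \<le> 1"
  proof (cases "S \<le> 1")
    case True
    then show ?thesis using powr_le1[of "1 / r" S] \<open>S \<ge> 0\<close> assms by simp
  next
    case False
    then have "1 < S powr (1 / r)" using assms by (intro gr_one_powr) auto
    then show ?thesis using False by simp
  qed
  then show ?thesis by (simp add: lp_ball_def lp_norm_def S_def)
qed

lemma lp_ball_cases:
  fixes p :: ereal
  assumes "1 \<le> p"
  obtains "p = \<infinity>" | r where "p = ereal r" "r \<ge> 1"
  using assms by (cases p) auto

lemma lp_ball_solid:
  assumes n: "n \<ge> 1" and p: "1 \<le> p" and y: "y \<in> lp_ball n p" and le: "\<And>j. j < n \<Longrightarrow> \<bar>x j\<bar> \<le> \<bar>y j\<bar>"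
  shows "x \<in> lp_ball n p"
proof (cases rule: lp_ball_cases[OF p])
  case 1
  then show ?thesis using y le n by (force simp: lp_ball_infinity)
next
  case (2 r)
  have "(\<Sum>j<n. \<bar>x j\<bar> powr r) \<le> (\<Sum>j<n. \<bar>y j\<bar> powr r)"
    using 2 le by (intro sum_mono powr_mono2) auto
  then show ?thesis using 2 y by (simp add: lp_ball_real)
qed

lemma lp_ball_bounded:
  assumes n: "n \<ge> 1" and p: "1 \<le> p" and y: "y \<in> lp_ball n p" and j: "j < n"
  shows "\<bar>y j\<bar> \<le> 1"
proof (cases rule: lp_ball_cases[OF p])
  case 1
  then show ?thesis using y j n by (simp add: lp_ball_infinity)
next
  case (2 r)
  show ?thesis
  proof (rule ccontr)
    assume "\<not> \<bar>y j\<bar> \<le> 1"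
    then have "1 < \<bar>y j\<bar> powr r" using 2 by (intro gr_one_powr) auto
    also have "\<dots> \<le> (\<Sum>j<n. \<bar>y j\<bar> powr r)" using j by (intro member_le_sum) auto
    also have "\<dots> \<le> 1" using 2 y by (simp add: lp_ball_real)
    finally show False by simp
  qed
qed

text \<open>
  When one of the points is \<open>0\<close>, the claim reduces to \<open>(c * x) powr r \<le> c * x powr r\<close> for \<open>c \<le> 1\<close>.
\<close>

lemma powr_convex_nonneg:
  fixes a b t r :: real
  assumes r: "r \<ge> 1" and ab: "0 \<le> a" "0 \<le> b" and t: "0 \<le> t" "t \<le> 1"
  shows "((1 - t) * a + t * b) powr r \<le> (1 - t) * a powr r + t * b powr r"
proof -
  have scale: "(c * x) powr r \<le> c * x powr r" if "0 \<le> c" "c \<le> 1" "0 \<le> x" for c x :: real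
  proof (cases "c = 0")
    case False
    then have "c powr r \<le> c powr 1" using that r by (intro powr_mono') auto
    then have "c powr r \<le> c" using False that by simp
    then show ?thesis using that by (simp add: powr_mult mult_right_mono)
  qed simp
  show ?thesis
  proof (cases "a = 0 \<or> b = 0")
    case True
    then show ?thesis using scale[of t b] scale[of "1 - t" a] t ab r by auto
  next
    case False
    then have "a \<in> {0<..}" "b \<in> {0<..}" using ab by auto
    then show ?thesis using convex_onD[OF powr_convex[OF r] t] by simp
  qed
qed

lemma lp_ball_solid_convex:
  assumes n: "n \<ge> 1" and p: "1 \<le> p"
  shows "solid_convex n (lp_ball n p)"
proof
  fix x y :: "nat \<Rightarrow> real" and t :: real
  assume x: "x \<in> lp_ball n p" and y: "y \<in> lp_ball n p" and t: "0 \<le> t" "t \<le> 1"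
  have tri: "\<bar>(1 - t) * x j + t * y j\<bar> \<le> (1 - t) * \<bar>x j\<bar> + t * \<bar>y j\<bar>" for j
    using t by (intro order_trans[OF abs_triangle_ineq]) (simp add: abs_mult)
  show "(\<lambda>j. (1 - t) * x j + t * y j) \<in> lp_ball n p"
  proof (cases rule: lp_ball_cases[OF p])
    case 1
    have "\<bar>(1 - t) * x j + t * y j\<bar> \<le> 1" if "j < n" for j
    proof -
      note tri[of j]
      also have "(1 - t) * \<bar>x j\<bar> + t * \<bar>y j\<bar> \<le> (1 - t) * 1 + t * 1"
        using lp_ball_bounded[OF n p x that] lp_ball_bounded[OF n p y that] t by (intro add_mono mult_left_mono) auto
      finally show ?thesis by simp
    qed
    then show ?thesis using 1 n by (simp add: lp_ball_infinity)
  next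
    case (2 r)
    have "(\<Sum>j<n. \<bar>(1 - t) * x j + t * y j\<bar> powr r) \<le> (\<Sum>j<n. ((1 - t) * \<bar>x j\<bar> + t * \<bar>y j\<bar>) powr r)"
      using 2 tri by (intro sum_mono powr_mono2) auto
    also have "\<dots> \<le> (\<Sum>j<n. (1 - t) * \<bar>x j\<bar> powr r + t * \<bar>y j\<bar> powr r)"
      using 2 t by (intro sum_mono powr_convex_nonneg) auto
    also have "\<dots> = (1 - t) * (\<Sum>j<n. \<bar>x j\<bar> powr r) + t * (\<Sum>j<n. \<bar>y j\<bar> powr r)"
      by (simp add: sum.distrib sum_distrib_left)
    also have "\<dots> \<le> (1 - t) * 1 + t * 1"
      using 2 x y t by (intro add_mono mult_left_mono) (auto simp: lp_ball_real)
    finally show ?thesis using 2 by (simp add: lp_ball_real)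
  qed
qed (rule lp_ball_solid[OF n p])

definition reciprocal :: "ereal \<Rightarrow> real" where
  "reciprocal p = (if p = \<infinity> then 0 else 1 / real_of_ereal p)"

lemma weights_in_lp_ball:
  assumes n: "n \<ge> 1" and p: "1 \<le> p" and M: "\<And>j. 0 \<le> M j" "(\<Sum>j<n. M j) = 1"
  shows "(\<lambda>j. M j powr reciprocal p) \<in> lp_ball n p"
proof (cases rule: lp_ball_cases[OF p])
  case 1
  then show ?thesis using n by (simp add: lp_ball_infinity reciprocal_def)
next
  case (2 r)
  then show ?thesis using M by (simp add: lp_ball_real reciprocal_def powr_powr)
qed

section \<open>Real polynomials and their complexification\<close>

text \<open>
  The symmetric tensor of the polynomial with coefficient family \<open>a\<close>.
\<close>

definition spread :: "((nat \<Rightarrow> nat) \<Rightarrow> real) \<Rightarrow> nat list \<Rightarrow> complex" where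
  "spread a xs = of_real (a (count_list xs)) / of_nat (orderings xs)"

lemma symmetric_spread: "symmetric (spread a)"
  unfolding symmetric_def spread_def
  using count_list_eq_iff_mset orderings_cong by metis

lemma count_list_replicate: "count_list (replicate k i) j = (if i = j then k else 0)"
  by (induction k) auto

lemma tuple_with_exponent:
  assumes "\<alpha> \<in> multi_indices m n"
  obtains xs where "xs \<in> tuples n m" "count_list xs = \<alpha>"
proof -
  define xs where "xs = concat (map (\<lambda>i. replicate (\<alpha> i) i) [0..<n])"
  have "count_list (concat (map (\<lambda>i. replicate (\<alpha> i) i) [0..<k])) j = (if j < k then \<alpha> j else 0)" for j k
    by (induction k) (auto simp: count_list_replicate)
  then have c: "count_list xs = \<alpha>"
    using assms by (auto simp: xs_def multi_indices_def fun_eq_iff)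
  have "length xs = m"
    using assms by (simp add: xs_def length_concat o_def multi_indices_def sum_list_sum_nth atLeast0LessThan)
  moreover have "set xs \<subseteq> {..<n}" by (auto simp: xs_def)
  ultimately show ?thesis using c that by (auto simp: tuples_def)
qed

lemma multi_indices_subset_ebox: "multi_indices m n \<subseteq> ebox m n"
proof
  fix \<alpha> assume \<alpha>: "\<alpha> \<in> multi_indices m n"
  then obtain xs where "xs \<in> tuples n m" "count_list xs = \<alpha>" by (rule tuple_with_exponent)
  then show "\<alpha> \<in> ebox m n" using count_list_tuple(1) by blast
qed

lemma finite_multi_indices [simp]: "finite (multi_indices m n)"
  by (rule finite_subset[OF multi_indices_subset_ebox]) simp

lemma count_list_in_multi_indices: "xs \<in> tuples n m \<Longrightarrow> count_list xs \<in> multi_indices m n"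
  using count_list_tuple[of xs n m] by (auto simp: multi_indices_def box_below_def)

lemma collected_spread:
  assumes "\<alpha> \<in> multi_indices m n"
  shows "collected n m (spread a) \<alpha> = of_real (a \<alpha>)"
proof -
  from assms obtain xs where xs: "xs \<in> tuples n m" "count_list xs = \<alpha>" by (rule tuple_with_exponent)
  then show ?thesis
    using collected_symmetric[OF symmetric_spread xs(1), of a] orderings_pos[of xs] by (simp add: spread_def)
qed

lemma tuple_poly_spread: "tuple_poly n m (spread a) (\<lambda>j. of_real (x j)) = of_real (hom_poly m n a x)"
proof -
  have "tuple_poly n m (spread a) (\<lambda>j. of_real (x j)) = (\<Sum>\<alpha>\<in>multi_indices m n. collected n m (spread a) \<alpha> * monomial n \<alpha> (\<lambda>j. of_real (x j)))"
    unfolding tuple_poly_eq_box_poly box_poly_def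
  proof (rule sum.mono_neutral_right[OF finite_box_below multi_indices_subset_ebox], rule ballI)
    fix \<alpha> assume "\<alpha> \<in> ebox m n - multi_indices m n"
    then have "(\<Sum>i<n. \<alpha> i) \<noteq> m" by (auto simp: multi_indices_def box_below_def)
    then show "collected n m (spread a) \<alpha> * monomial n \<alpha> (\<lambda>j. of_real (x j)) = 0"
      by (simp add: collected_eq_0)
  qed
  also have "\<dots> = of_real (hom_poly m n a x)"
    by (simp add: hom_poly_def collected_spread monomial_def)
  finally show ?thesis .
qed

lemma coeff_mass_spread:
  assumes q: "q > 0"
  shows "coeff_mass n m (spread a) q = (\<Sum>\<alpha>\<in>multi_indices m n. \<bar>a \<alpha>\<bar> powr q)"
proof -
  have term_eq: "real (orderings xs) powr (q - 1) * cmod (spread a xs) powr q = \<bar>a (count_list xs)\<bar> powr q / orderings xs" for xs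
    using orderings_pos[of xs] by (simp add: spread_def norm_divide powr_divide powr_diff)
  have "coeff_mass n m (spread a) q = (\<Sum>\<alpha>\<in>ebox m n. \<Sum>xs\<in>{xs \<in> tuples n m. count_list xs = \<alpha>}. \<bar>a (count_list xs)\<bar> powr q / orderings xs)"
    unfolding coeff_mass_def term_eq sum_tuples_by_exponent ..
  also have "\<dots> = (\<Sum>\<alpha>\<in>multi_indices m n. \<Sum>xs\<in>{xs \<in> tuples n m. count_list xs = \<alpha>}. \<bar>a (count_list xs)\<bar> powr q / orderings xs)"
    using multi_indices_subset_ebox[of m n] count_list_in_multi_indices
    by (intro sum.mono_neutral_right) (auto intro!: sum.neutral)
  also have "\<dots> = (\<Sum>\<alpha>\<in>multi_indices m n. \<bar>a \<alpha>\<bar> powr q)"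
  proof (intro sum.cong refl)
    fix \<alpha> assume "\<alpha> \<in> multi_indices m n"
    then obtain xs where xs: "xs \<in> tuples n m" "count_list xs = \<alpha>" by (rule tuple_with_exponent)
    have "(\<Sum>ys\<in>{ys \<in> tuples n m. count_list ys = \<alpha>}. \<bar>a (count_list ys)\<bar> powr q / orderings ys)
       = (\<Sum>ys\<in>{ys. mset ys = mset xs}. \<bar>a \<alpha>\<bar> powr q / orderings xs)"
      unfolding xs(2)[symmetric] tuple_fibre[OF xs(1)]
    proof (intro sum.cong refl)
      fix ys assume "ys \<in> {ys. mset ys = mset xs}"
      then have e: "mset ys = mset xs" by simp
      then show "\<bar>a (count_list ys)\<bar> powr q / orderings ys = \<bar>a (count_list xs)\<bar> powr q / orderings xs"
        using orderings_cong[OF e] e[folded count_list_eq_iff_mset] by simp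
    qed
    also have "\<dots> = \<bar>a \<alpha>\<bar> powr q"
      using orderings_pos[of xs] by (simp only: sum_constant orderings_def[symmetric]) simp
    finally show "(\<Sum>ys\<in>{ys \<in> tuples n m. count_list ys = \<alpha>}. \<bar>a (count_list ys)\<bar> powr q / orderings ys) = \<bar>a \<alpha>\<bar> powr q" .
  qed
  finally show ?thesis .
qed

lemma hom_poly_le_sup_norm:
  assumes n: "n \<ge> 1" and p: "1 \<le> p" and x: "x \<in> lp_ball n p"
  shows "\<bar>hom_poly m n a x\<bar> \<le> poly_sup_norm m n p a"
  unfolding poly_sup_norm_def
proof (rule cSUP_upper)
  show "x \<in> {x. lp_norm n p x \<le> 1}" using x by (simp add: lp_ball_def)
  show "bdd_above ((\<lambda>x. \<bar>hom_poly m n a x\<bar>) ` {x. lp_norm n p x \<le> 1})"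
  proof (intro bdd_aboveI2)
    fix x assume "x \<in> {x. lp_norm n p x \<le> 1}"
    then have x: "\<bar>x i\<bar> \<le> 1" if "i < n" for i using lp_ball_bounded[OF n p _ that] by (simp add: lp_ball_def)
    have "\<bar>hom_poly m n a x\<bar> \<le> (\<Sum>\<alpha>\<in>multi_indices m n. \<bar>a \<alpha>\<bar> * (\<Prod>i<n. \<bar>x i\<bar> ^ \<alpha> i))"
      unfolding hom_poly_def by (intro order_trans[OF sum_abs]) (simp add: abs_mult abs_prod power_abs)
    also have "\<dots> \<le> (\<Sum>\<alpha>\<in>multi_indices m n. \<bar>a \<alpha>\<bar> * 1)"
      by (intro sum_mono mult_left_mono prod_le_1) (auto simp: x power_le_one)
    finally show "\<bar>hom_poly m n a x\<bar> \<le> (\<Sum>\<alpha>\<in>multi_indices m n. \<bar>a \<alpha>\<bar> * 1)" .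
  qed
qed

text \<open>
  The polynomial \<open>t \<mapsto> P (z + t * cnj z)\<close> takes the value in question at \<open>t = 0\<close>.  On the unit circle,
  \<open>t = \<zeta>\<^sup>2\<close>, its argument is \<open>2 \<zeta>\<close> times the real vector \<open>Re (cnj \<zeta> * z)\<close>, which lies in the ball because
  its entries are dominated by those of \<open>z\<close>.  The maximum principle gives the factor \<open>2 ^ m\<close>.
\<close>

lemma complexification_bound:
  assumes n: "n \<ge> 1" and p: "1 \<le> p" and z: "(\<lambda>j. cmod (z j)) \<in> lp_ball n p"
  shows "cmod (tuple_poly n m (spread a) z) \<le> 2 ^ m * poly_sup_norm m n p a"
proof -
  define f where "f t = tuple_poly n m (spread a) (\<lambda>j. z j + t * cnj (z j))" for t
  have holo: "f holomorphic_on A" for A unfolding f_def by (rule tuple_poly_line_holomorphic)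
  have bound: "cmod (f t) \<le> 2 ^ m * poly_sup_norm m n p a" if t: "cmod (0 - t) = 1" for t
  proof -
    define \<zeta> where "\<zeta> = csqrt t"
    have sq: "\<zeta> * \<zeta> = t" using power2_csqrt[of t] by (simp add: \<zeta>_def power2_eq_square)
    have "cmod \<zeta> * cmod \<zeta> = 1" using t by (simp add: sq flip: norm_mult)
    then have n\<zeta>: "cmod \<zeta> = 1" by (metis abs_norm_cancel power2_eq_1_iff power2_eq_square abs_1 abs_minus_cancel)
    then have inv: "\<zeta> * cnj \<zeta> = 1" using complex_norm_square[of \<zeta>] by simp
    have "z j + t * cnj (z j) = (2 * \<zeta>) * of_real (Re (cnj \<zeta> * z j))" for j
    proof -
      have "(2 * \<zeta>) * of_real (Re (cnj \<zeta> * z j)) = \<zeta> * (cnj \<zeta> * z j + cnj (cnj \<zeta> * z j))"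
        by (simp only: complex_add_cnj of_real_mult of_real_numeral mult_ac)
      also have "\<dots> = (\<zeta> * cnj \<zeta>) * z j + (\<zeta> * \<zeta>) * cnj (z j)" by (simp add: algebra_simps)
      finally show ?thesis by (simp add: inv sq)
    qed
    then have "f t = (2 * \<zeta>) ^ m * of_real (hom_poly m n a (\<lambda>j. Re (cnj \<zeta> * z j)))"
      by (simp only: f_def tuple_poly_scale tuple_poly_spread)
    then have "cmod (f t) = 2 ^ m * \<bar>hom_poly m n a (\<lambda>j. Re (cnj \<zeta> * z j))\<bar>"
      by (simp add: norm_mult norm_power n\<zeta>)
    also have "\<dots> \<le> 2 ^ m * poly_sup_norm m n p a"
    proof (intro mult_left_mono hom_poly_le_sup_norm[OF n p])
      show "(\<lambda>j. Re (cnj \<zeta> * z j)) \<in> lp_ball n p"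
      proof (rule lp_ball_solid[OF n p z])
        show "\<bar>Re (cnj \<zeta> * z j)\<bar> \<le> \<bar>cmod (z j)\<bar>" for j
          using abs_Re_le_cmod[of "cnj \<zeta> * z j"] n\<zeta> by (simp add: norm_mult)
      qed
    qed simp
    finally show ?thesis .
  qed
  have "cmod ((deriv ^^ 0) f 0) \<le> fact 0 * (2 ^ m * poly_sup_norm m n p a) / 1 ^ 0"
    by (intro Cauchy_inequality holo holomorphic_on_imp_continuous_on bound) auto
  then show ?thesis by (simp add: f_def)
qed

section \<open>Upper bounds for the Hardy-Littlewood constants\<close>

lemma hl_exponent_large:
  assumes m: "m \<ge> 1" and p: "ereal (2 * real m) \<le> p"
  shows "hl_exponent m p > 0" "1 / hl_exponent m p = 1 / 2 + 1 / (2 * real m) - reciprocal p"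
    "0 \<le> reciprocal p" "2 * real m * reciprocal p \<le> 1"
proof -
  have "hl_exponent m p > 0 \<and> 1 / hl_exponent m p = 1 / 2 + 1 / (2 * real m) - reciprocal p
     \<and> 0 \<le> reciprocal p \<and> 2 * real m * reciprocal p \<le> 1"
  proof (cases "p = \<infinity>")
    case True
    then show ?thesis using m by (simp add: hl_exponent_def reciprocal_def field_simps)
  next
    case False
    then obtain r where r: "p = ereal r" "2 * real m \<le> r" using p by (cases p) auto
    have r0: "r > 0" "real m > 0" using r m by auto
    have "real m * r + r - 2 * real m > 0" using r0 r by (smt (verit) mult_pos_pos)
    then show ?thesis using r r0
      by (simp add: hl_exponent_def reciprocal_def Let_def) (simp add: field_simps)
  qed
  then show "hl_exponent m p > 0" "1 / hl_exponent m p = 1 / 2 + 1 / (2 * real m) - reciprocal p"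
    "0 \<le> reciprocal p" "2 * real m * reciprocal p \<le> 1" by blast+
qed

lemma hl_exponent_small:
  assumes m: "m \<ge> 1" and p: "ereal (real m) < p" "\<not> ereal (2 * real m) \<le> p"
  shows "hl_exponent m p > 0" "1 / hl_exponent m p = 1 - real m * reciprocal p"
    "1 \<le> 2 * real m * reciprocal p" "real m * reciprocal p \<le> 1"
proof -
  obtain r where r: "p = ereal r" "real m < r" "r < 2 * real m" using p by (cases p) auto
  then have "hl_exponent m p > 0 \<and> 1 / hl_exponent m p = 1 - real m * reciprocal p
    \<and> 1 \<le> 2 * real m * reciprocal p \<and> real m * reciprocal p \<le> 1"
    using m by (simp add: hl_exponent_def reciprocal_def Let_def field_simps)
  then show "hl_exponent m p > 0" "1 / hl_exponent m p = 1 - real m * reciprocal p"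
    "1 \<le> 2 * real m * reciprocal p" "real m * reciprocal p \<le> 1" by blast+
qed

lemma hl_exponent_pos: "m \<ge> 1 \<Longrightarrow> ereal (real m) < p \<Longrightarrow> hl_exponent m p > 0"
  using hl_exponent_large(1) hl_exponent_small(1) by blast

lemma poly_sup_norm_nonneg:
  assumes "n \<ge> 1" "1 \<le> p"
  shows "0 \<le> poly_sup_norm m n p a"
proof -
  have "(\<lambda>_. 0) \<in> lp_ball n p"
    by (cases rule: lp_ball_cases[OF assms(2)]) (use assms in \<open>auto simp: lp_ball_infinity lp_ball_real\<close>)
  from hom_poly_le_sup_norm[OF assms this] show ?thesis using order_trans[OF abs_ge_zero] by blast
qed

lemma le_exp_of_ln_le:
  fixes S :: real
  assumes "0 < S" "0 < q" "ln S / q \<le> x"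
  shows "S powr (1 / q) \<le> exp x"
  using assms by (simp add: powr_def)

lemma poly_coeff_norm_eq:
  "q > 0 \<Longrightarrow> poly_coeff_norm m n q a = coeff_mass n m (spread a) q powr (1 / q)"
  by (simp add: poly_coeff_norm_def coeff_mass_spread)

lemma coeff_mass_nonneg: "0 \<le> coeff_mass n m b q"
  by (simp add: coeff_mass_def sum_nonneg)

lemma ge_1_of_gt: "m \<ge> 1 \<Longrightarrow> ereal (real m) < p \<Longrightarrow> 1 \<le> p"
  by (cases p) auto

text \<open>
  Growth rate \<open>2 * sqrt 2\<close> for every \<open>p > m\<close>: the factor \<open>2 ^ m\<close> is the complexification, the factor
  \<open>sqrt 2 ^ (m - 1)\<close> the passage from \<open>L\<^sup>2\<close> to \<open>L\<^sup>1\<close>.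
\<close>

lemma hardy_littlewood_uniform:
  assumes n: "n \<ge> 1" and m: "m \<ge> 1" and p: "ereal (real m) < p"
  shows "poly_coeff_norm m n (hl_exponent m p) a \<le> (real m * exp 1 * sqrt 2 ^ (m - 1) * 2 ^ m) * poly_sup_norm m n p a"
proof -
  define q where "q = hl_exponent m p"
  define M where "M = 2 ^ m * poly_sup_norm m n p a"
  have p1: "1 \<le> p" by (rule ge_1_of_gt[OF m p])
  have q: "q > 0" unfolding q_def by (rule hl_exponent_pos[OF m p])
  have M0: "M \<ge> 0" unfolding M_def using poly_sup_norm_nonneg[OF n p1] by simp
  show ?thesis
  proof (cases "coeff_mass n m (spread a) q > 0")
    case True
    interpret solid_convex n "lp_ball n p" by (rule lp_ball_solid_convex[OF n p1])
    interpret coefficient_law n m "spread a" q "reciprocal p"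
      using m q True symmetric_spread by unfold_locales auto
    define C where "C = exp 1 * sqrt 2 ^ (m - 1) * M"
    have C0: "C \<ge> 0" using M0 by (simp add: C_def)
    have w: "weight \<in> lp_ball n p"
      unfolding weight_def using marginal_total[of 1] m
      by (intro weights_in_lp_ball[OF n p1] marginal_nonneg) (simp add: sum_tuples_1)
    have mix: "mixed_norm n m (spread a) weight 1 1 \<le> C"
      unfolding C_def M_def
      by (rule mixed_norm_1_bound[OF symmetric_spread m _ w weight_nonneg])
         (auto simp: in_ball_def intro: complexification_bound[OF n p1])
    have lnm: "0 \<le> ln (real m)" using m by simp
    have "C > 0 \<and> ln (coeff_mass n m (spread a) q) / q \<le> ln C + ln m"
    proof (cases "ereal (2 * real m) \<le> p")
      case True
      note E = hl_exponent_large[OF m True, folded q_def]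
      from coeff_norm_bound_large[OF E(3,4,2) C0 mix] lnm show ?thesis by auto
    next
      case False
      note E = hl_exponent_small[OF m p False, folded q_def]
      from coeff_norm_bound_small[OF E(3,4,2) C0 mix] show ?thesis by auto
    qed
    then have "coeff_mass n m (spread a) q powr (1 / q) \<le> exp (ln C + ln m)" and "C > 0"
      using True q by (auto intro: le_exp_of_ln_le)
    then show ?thesis
      using m q by (simp add: poly_coeff_norm_eq q_def[symmetric] exp_add C_def M_def mult_ac)
  next
    case False
    then have "coeff_mass n m (spread a) q = 0" using coeff_mass_nonneg[of n m "spread a" q] by linarith
    then show ?thesis using q poly_sup_norm_nonneg[OF n p1]
      by (simp add: poly_coeff_norm_eq q_def[symmetric])
  qed
qed

text \<open>
  The cost of the estimate with \<open>k\<close> free letters.  For fixed \<open>k\<close> its \<open>m\<close>-th root tends to \<open>2 powr (1 / k)\<close>.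
\<close>

definition block_const :: "nat \<Rightarrow> nat \<Rightarrow> real" where
  "block_const m k = 2 powr (real m / k) * bh_const k * exp k * m powr (k / 2)"

lemma bh_const_ge_1: "k \<ge> 1 \<Longrightarrow> bh_const k \<ge> 1"
proof -
  assume k: "k \<ge> 1"
  have "1 * 1 * 1 \<le> sqrt k * exp 1 * sqrt 2 ^ (k - 1)"
    using k by (intro mult_mono one_le_power) auto
  then show ?thesis by (simp add: bh_const_def)
qed

lemma block_const_ge_1:
  assumes "k \<ge> 1" "m \<ge> 1"
  shows "block_const m k \<ge> 1"
proof -
  have "1 * 1 * 1 * 1 \<le> 2 powr (real m / k) * bh_const k * exp k * m powr (k / 2)"
    using assms bh_const_ge_1[of k] by (intro mult_mono ge_one_powr_ge_zero) auto
  then show ?thesis by (simp add: block_const_def)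
qed

text \<open>
  The estimate with one free letter costs \<open>bh_const m\<close>, which is exponential in \<open>m\<close>, but it enters
  only with an exponent that is at most \<open>2 m / p + k / m\<close>.
\<close>

lemma hardy_littlewood_blocks:
  assumes n: "n \<ge> 1" and k: "1 \<le> k" "k \<le> m" and p: "ereal (real m) < p" "ereal (2 * real m) \<le> p"
  shows "poly_coeff_norm m n (hl_exponent m p) a
     \<le> (2 ^ m * block_const m k * (bh_const m) powr (2 * real m * reciprocal p + real k / m)) * poly_sup_norm m n p a"
proof -
  have m: "m \<ge> 1" using k by simp
  define q where "q = hl_exponent m p"
  define M where "M = 2 ^ m * poly_sup_norm m n p a"
  define \<rho> where "\<rho> = 2 * real k / (real k + 1)"
  have p1: "1 \<le> p" by (rule ge_1_of_gt[OF m p(1)])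
  have q: "q > 0" unfolding q_def by (rule hl_exponent_pos[OF m p(1)])
  have M0: "M \<ge> 0" unfolding M_def using poly_sup_norm_nonneg[OF n p1] by simp
  show ?thesis
  proof (cases "coeff_mass n m (spread a) q > 0")
    case True
    interpret solid_convex n "lp_ball n p" by (rule lp_ball_solid_convex[OF n p1])
    interpret coefficient_law n m "spread a" q "reciprocal p"
      using m q True symmetric_spread by unfold_locales auto
    define C where "C = exp 1 * sqrt 2 ^ (m - 1) * M"
    define D where "D = 2 powr (real m / k) * bh_const k * exp k * M"
    have bh0: "bh_const j > 0" if "j \<ge> 1" for j using bh_const_ge_1[OF that] by linarith
    have C0: "C \<ge> 0" using M0 by (simp add: C_def)
    have D0: "D \<ge> 0" using M0 bh0[OF k(1)] by (simp add: D_def)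
    have w: "weight \<in> lp_ball n p"
      unfolding weight_def using marginal_total[of 1] m
      by (intro weights_in_lp_ball[OF n p1] marginal_nonneg) (simp add: sum_tuples_1)
    have Mb: "cmod (tuple_poly n m (spread a) z) \<le> M" if "in_ball z" for z
      using that unfolding in_ball_def M_def by (rule complexification_bound[OF n p1])
    have mix1: "mixed_norm n m (spread a) weight 1 1 \<le> C"
      unfolding C_def by (rule mixed_norm_1_bound[OF symmetric_spread m Mb w weight_nonneg])
    have mixk: "mixed_norm n m (spread a) weight k \<rho> \<le> D powr \<rho>"
      unfolding D_def
    proof (rule mixed_norm_k_bound[OF symmetric_spread k \<rho>_def _ w weight_nonneg])
      show "0 \<le> bh_const k" using bh0[OF k(1)] by simp
      fix c M' assume "symmetric c" "\<And>w. (\<And>j. cmod (w j) \<le> 1) \<Longrightarrow> cmod (tuple_poly n k c w) \<le> M'"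
      then show "(\<Sum>u\<in>tuples n k. cmod (c u) powr \<rho>) \<le> (bh_const k * M') powr \<rho>"
        by (rule bohnenblust_hille_tuple[OF _ k(1) \<rho>_def])
    qed (rule Mb)
    define v where "v = (1 - 2 * real m * reciprocal p) * ((m div k) * k / m)"
    note E = hl_exponent_large[OF m p(2), folded q_def]
    note B = coeff_norm_bound_blocks[OF E(3,4,2) k \<rho>_def C0 mix1 D0 mixk, folded v_def]
    have Mpos: "M > 0" using B(1) M0 by (cases "M = 0") (auto simp: C_def)
    have "sqrt m * C = bh_const m * M" by (simp add: C_def bh_const_def)
    then have lnC: "ln C + ln m / 2 = ln (bh_const m) + ln M"
      using B(1) m Mpos bh0[OF m] ln_mult[of "sqrt m" C] ln_mult[of "bh_const m" M] by (simp add: ln_sqrt)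
    have "m powr (k / 2) * D = block_const m k * M" by (simp add: D_def block_const_def)
    moreover have bc: "block_const m k \<ge> 1" by (rule block_const_ge_1[OF k(1) m])
    ultimately have lnD: "ln D + k / 2 * ln m = ln (block_const m k) + ln M"
      using B(2) m Mpos ln_mult[of "m powr (k / 2)" D] ln_mult[of "block_const m k" M] by (simp add: ln_powr)
    have t: "0 \<le> 2 * real m * reciprocal p" "2 * real m * reciprocal p \<le> 1" using E m by auto
    (* The exponent 1 - v of the expensive estimate is small: integer division loses at most k / m. *)
    have v1: "v \<le> 1" "1 - v \<le> 2 * real m * reciprocal p + k / m"
    proof -
      have m0: "real m > 0" using m by simp
      have mk: "real m = (m div k) * k + m mod k" by (metis of_nat_add of_nat_mult div_mult_mod_eq)
      have up: "(m div k) * k / real m \<le> 1" "0 \<le> (m div k) * k / real m"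
        using mk m0 by (auto simp: divide_le_eq simp flip: of_nat_mult)
      have "real (m mod k) \<le> k" using k mod_less_divisor[of k m] by (simp add: less_imp_le)
      then have "real m - k \<le> (m div k) * k" using mk by linarith
      then have "(real m - k) / m \<le> (m div k) * k / real m" using m0 by (intro divide_right_mono) auto
      then have lo: "1 - k / m \<le> (m div k) * k / real m" using m0 by (simp add: diff_divide_distrib)
      have "(1 - 2 * real m * reciprocal p) * ((m div k) * k / m) \<le> 1 * 1" using t up by (intro mult_mono) auto
      then show "v \<le> 1" by (simp add: v_def)
      have "2 * real m * reciprocal p * ((m div k) * k / m) \<le> 2 * real m * reciprocal p * 1" using t up by (intro mult_left_mono) auto
      then show "1 - v \<le> 2 * real m * reciprocal p + k / m" using lo unfolding v_def left_diff_distrib by simp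
    qed
    have "ln (coeff_mass n m (spread a) q) / q \<le> v * (ln (block_const m k) + ln M) + (1 - v) * (ln (bh_const m) + ln M)"
      using B(3) unfolding lnC lnD .
    also have "\<dots> = v * ln (block_const m k) + (1 - v) * ln (bh_const m) + ln M" by (simp add: algebra_simps)
    also have "\<dots> \<le> 1 * ln (block_const m k) + (2 * real m * reciprocal p + k / m) * ln (bh_const m) + ln M"
      using v1 bc bh_const_ge_1[OF m] by (intro add_mono mult_right_mono) auto
    finally have "coeff_mass n m (spread a) q powr (1 / q) \<le> exp (1 * ln (block_const m k) + (2 * real m * reciprocal p + k / m) * ln (bh_const m) + ln M)"
      by (rule le_exp_of_ln_le[OF True q])
    also have "\<dots> = block_const m k * (bh_const m) powr (2 * real m * reciprocal p + k / m) * M"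
      using bc bh0[OF m] Mpos by (simp add: exp_add powr_def)
    finally show ?thesis
      using q by (simp add: poly_coeff_norm_eq q_def[symmetric] M_def mult_ac)
  next
    case False
    then have "coeff_mass n m (spread a) q = 0" using coeff_mass_nonneg[of n m "spread a" q] by linarith
    moreover have "bh_const m \<ge> 1" "block_const m k \<ge> 1" using bh_const_ge_1 block_const_ge_1 k m by auto
    ultimately show ?thesis using q poly_sup_norm_nonneg[OF n p1]
      by (simp add: poly_coeff_norm_eq q_def[symmetric])
  qed
qed

section \<open>The lower bound: squares of variables in a Vandermonde determinant\<close>

text \<open>
  The Chebyshev polynomials of the interval \<open>[0, 1]\<close>.  Since \<open>y\<close> stands for the square of a variable,
  these are the even Chebyshev polynomials of \<open>[-1, 1]\<close>.
\<close>

fun shifted_chebyshev :: "nat \<Rightarrow> real poly" where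
  "shifted_chebyshev 0 = 1"
| "shifted_chebyshev (Suc 0) = [:-1, 2:]"
| "shifted_chebyshev (Suc (Suc l)) = [:-2, 4:] * shifted_chebyshev (Suc l) - shifted_chebyshev l"

lemma poly_shifted_chebyshev: "poly (shifted_chebyshev l) ((cos \<theta>)\<^sup>2) = cos (2 * real l * \<theta>)"
proof (induction l rule: shifted_chebyshev.induct)
  case 1 then show ?case by simp
next
  case 2 then show ?case using cos_double_cos[of \<theta>] by simp
next
  case (3 l)
  have "cos (2 * real (Suc (Suc l)) * \<theta>) + cos (2 * real l * \<theta>) = 2 * cos (2 * \<theta>) * cos (2 * real (Suc l) * \<theta>)"
  proof -
    have "2 * real (Suc (Suc l)) * \<theta> = 2 * real (Suc l) * \<theta> + 2 * \<theta>" "2 * real l * \<theta> = 2 * real (Suc l) * \<theta> - 2 * \<theta>"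
      by (simp_all add: algebra_simps)
    then show ?thesis by (simp only: cos_add cos_diff) simp
  qed
  moreover have "-2 + 4 * (cos \<theta>)\<^sup>2 = 2 * cos (2 * \<theta>)" by (simp add: cos_double_cos)
  moreover have "poly (shifted_chebyshev (Suc (Suc l))) y
      = (-2 + 4 * y) * poly (shifted_chebyshev (Suc l)) y - poly (shifted_chebyshev l) y" for y
    by (simp add: algebra_simps)
  ultimately show ?case by (simp only: 3)
qed

lemma shifted_chebyshev_bounded:
  assumes "0 \<le> y" "y \<le> 1"
  shows "\<bar>poly (shifted_chebyshev l) y\<bar> \<le> 1"
proof -
  have "y = (cos (arccos (sqrt y)))\<^sup>2" using assms by (subst cos_arccos) (auto intro: order_trans[of _ 0])
  then have "poly (shifted_chebyshev l) y = cos (2 * real l * arccos (sqrt y))"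
    using poly_shifted_chebyshev by metis
  then show ?thesis by simp
qed

lemma degree_shifted_chebyshev: "degree (shifted_chebyshev l) \<le> l"
proof (induction l rule: shifted_chebyshev.induct)
  case (3 l)
  have "degree ([:-2, 4:] * shifted_chebyshev (Suc l)) \<le> 1 + Suc l"
    using 3 by (intro order_trans[OF degree_mult_le] add_mono) auto
  then show ?case using 3 by (auto intro!: degree_diff_le)
qed auto

lemma coeff_shifted_chebyshev_above: "l < k \<Longrightarrow> coeff (shifted_chebyshev l) k = 0"
  by (rule coeff_eq_0) (rule order_le_less_trans[OF degree_shifted_chebyshev])

lemma lead_shifted_chebyshev: "coeff (shifted_chebyshev (Suc l)) (Suc l) = 2 * 4 ^ l"
proof (induction l)
  case 0 then show ?case by simp
next
  case (Suc l)
  have "coeff (shifted_chebyshev (Suc (Suc l))) (Suc k) = - 2 * coeff (shifted_chebyshev (Suc l)) (Suc k)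
     + 4 * coeff (shifted_chebyshev (Suc l)) k - coeff (shifted_chebyshev l) (Suc k)" for k
    by simp
  from this[of "Suc l"] show ?case
    using Suc coeff_shifted_chebyshev_above[of "Suc l" "Suc (Suc l)"] coeff_shifted_chebyshev_above[of l "Suc (Suc l)"]
    by (simp del: shifted_chebyshev.simps)
qed

lemma prod_lead_shifted_chebyshev: "(\<Prod>l<Suc M. coeff (shifted_chebyshev l) l) = 2 ^ (M\<^sup>2)"
proof (induction M)
  case 0 then show ?case by simp
next
  case (Suc M)
  have "(2::real) * 4 ^ M = 2 ^ (2 * M + 1)" by (simp add: power_mult)
  then have "(\<Prod>l<Suc (Suc M). coeff (shifted_chebyshev l) l) = 2 ^ (M\<^sup>2) * 2 ^ (2 * M + 1)"
    using Suc by (simp add: lead_shifted_chebyshev)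
  also have "\<dots> = 2 ^ ((Suc M)\<^sup>2)" by (simp add: power_add[symmetric] power2_eq_square)
  finally show ?case .
qed

definition vandermonde :: "nat \<Rightarrow> (nat \<Rightarrow> real) \<Rightarrow> real" where
  "vandermonde N y = (\<Sum>\<sigma> | \<sigma> permutes {0..<N}. signof \<sigma> * (\<Prod>i=0..<N. y i ^ \<sigma> i))"

text \<open>
  Multiply the Vandermonde matrix by the triangular matrix of Chebyshev coefficients.  The determinant
  of the latter is \<open>2 ^ M\<^sup>2\<close>, and the product has entries in \<open>[-1, 1]\<close>.
\<close>

lemma vandermonde_bound:
  assumes y: "\<And>i. i < Suc M \<Longrightarrow> 0 \<le> y i \<and> y i \<le> 1"
  shows "\<bar>vandermonde (Suc M) y\<bar> \<le> fact (Suc M) / 2 ^ (M\<^sup>2)"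
proof -
  define N where "N = Suc M"
  define V where "V = Matrix.mat N N (\<lambda>(i, j). y i ^ j)"
  define U where "U = Matrix.mat N N (\<lambda>(k, l). coeff (shifted_chebyshev l) k)"
  define T where "T = Matrix.mat N N (\<lambda>(i, l). poly (shifted_chebyshev l) (y i))"
  have V: "V \<in> carrier_mat N N" and U: "U \<in> carrier_mat N N" and T: "T \<in> carrier_mat N N"
    by (auto simp: V_def U_def T_def)
  have VU: "V * U = T"
  proof (rule eq_matI)
    fix i l assume il: "i < dim_row T" "l < dim_col T"
    then have i: "i < N" "l < N" using T by auto
    have "(V * U) $$ (i, l) = (\<Sum>k = 0..<N. y i ^ k * coeff (shifted_chebyshev l) k)"
      using i by (simp add: V_def U_def scalar_prod_def)
    also have "\<dots> = poly (shifted_chebyshev l) (y i)"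
      unfolding poly_altdef using i degree_shifted_chebyshev[of l]
      by (intro sum.mono_neutral_cong_right) (auto simp: coeff_eq_0 mult.commute)
    finally show "(V * U) $$ (i, l) = T $$ (i, l)" using i by (simp add: T_def)
  qed (auto simp: V_def U_def T_def)
  have "Determinant.det V = vandermonde N y"
    unfolding vandermonde_def det_def'[OF V]
    by (intro sum.cong refl arg_cong2[of _ _ _ _ "(*)"] prod.cong) (auto simp: V_def permutes_in_image)
  moreover have "Determinant.det U = 2 ^ (M\<^sup>2)"
  proof -
    have "upper_triangular U"
      unfolding upper_triangular_def by (auto simp: U_def coeff_shifted_chebyshev_above)
    then have "Determinant.det U = prod_list (diag_mat U)" by (rule det_upper_triangular[OF _ U])
    also have "diag_mat U = map (\<lambda>l. coeff (shifted_chebyshev l) l) [0..<N]"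
      unfolding diag_mat_def by (simp add: U_def)
    also have "prod_list \<dots> = (\<Prod>l<N. coeff (shifted_chebyshev l) l)"
      by (simp add: prod.distinct_set_conv_list[symmetric] atLeast0LessThan)
    finally show ?thesis unfolding N_def prod_lead_shifted_chebyshev .
  qed
  moreover have "\<bar>Determinant.det T\<bar> \<le> fact N"
  proof -
    have "\<bar>Determinant.det T\<bar> \<le> (\<Sum>\<sigma> | \<sigma> permutes {0..<N}. 1)"
      unfolding det_def'[OF T]
    proof (intro order_trans[OF sum_abs] sum_mono)
      fix \<sigma> assume "\<sigma> \<in> {\<sigma>. \<sigma> permutes {0..<N}}"
      then have \<sigma>: "\<sigma> i < N" if "i < N" for i using that permutes_in_image[of \<sigma> "{0..<N}" i] by simp
      have "(\<Prod>i = 0..<N. \<bar>T $$ (i, \<sigma> i)\<bar>) \<le> 1"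
        using \<sigma> y by (intro prod_le_1) (auto simp: T_def N_def intro!: shifted_chebyshev_bounded)
      moreover have "\<bar>signof \<sigma> :: real\<bar> = 1" by (simp add: sign_def)
      ultimately show "\<bar>signof \<sigma> * (\<Prod>i = 0..<N. T $$ (i, \<sigma> i))\<bar> \<le> 1" by (simp add: abs_mult abs_prod)
    qed
    also have "\<dots> = fact N" by (simp add: card_permutations)
    finally show ?thesis .
  qed
  ultimately have "\<bar>vandermonde N y\<bar> * 2 ^ (M\<^sup>2) \<le> fact N"
    using det_mult[OF V U] unfolding VU by (simp add: abs_mult)
  then show ?thesis by (simp add: N_def field_simps)
qed

text \<open>
  The extra power \<open>r\<close> of the variable \<open>0\<close> serves to reach degrees that are not of the form
  \<open>N * (N - 1)\<close>.
\<close>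

definition vandermonde_exponent :: "nat \<Rightarrow> nat \<Rightarrow> (nat \<Rightarrow> nat) \<Rightarrow> nat \<Rightarrow> nat" where
  "vandermonde_exponent N r \<sigma> i = (if i < N then 2 * \<sigma> i + (if i = 0 then r else 0) else 0)"

text \<open>
  Distinct permutations give distinct monomials, so all coefficients are \<open>0\<close>, \<open>1\<close> or \<open>-1\<close>; the sum form
  makes the regrouping by permutations immediate.
\<close>

definition vandermonde_coeff :: "nat \<Rightarrow> nat \<Rightarrow> (nat \<Rightarrow> nat) \<Rightarrow> real" where
  "vandermonde_coeff N r \<alpha> = (\<Sum>\<sigma>\<in>{\<sigma> \<in> {\<sigma>. \<sigma> permutes {0..<N}}. vandermonde_exponent N r \<sigma> = \<alpha>}. signof \<sigma>)"

lemma vandermonde_exponent_in: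
  assumes N: "N \<ge> 1" and m: "m = N * (N - 1) + r" and \<sigma>: "\<sigma> permutes {0..<N}"
  shows "vandermonde_exponent N r \<sigma> \<in> multi_indices m N"
proof -
  have "(\<Sum>i<N. vandermonde_exponent N r \<sigma> i) = (\<Sum>i<N. 2 * \<sigma> i) + (\<Sum>i<N. if i = 0 then r else 0)"
    unfolding sum.distrib[symmetric] by (intro sum.cong) (auto simp: vandermonde_exponent_def)
  also have "(\<Sum>i<N. 2 * \<sigma> i) = 2 * (\<Sum>i\<in>{0..<N}. i)"
    using sum.permute[OF \<sigma>, of "\<lambda>i. i"] by (simp add: sum_distrib_left[symmetric] atLeast0LessThan o_def)
  also have "\<dots> = N * (N - 1)" using gauss_sum_nat[of "N - 1"] N
    by (cases N) (auto simp: atLeast0LessThan lessThan_Suc_atMost atLeast0AtMost)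
  also have "(\<Sum>i<N. if i = 0 then r else 0) = r" using N by simp
  finally show ?thesis by (simp add: multi_indices_def vandermonde_exponent_def m)
qed

lemma vandermonde_exponent_inj:
  assumes "\<sigma> permutes {0..<N}" "\<tau> permutes {0..<N}" "vandermonde_exponent N r \<sigma> = vandermonde_exponent N r \<tau>"
  shows "\<sigma> = \<tau>"
proof
  fix i
  show "\<sigma> i = \<tau> i"
  proof (cases "i < N")
    case True
    then show ?thesis using fun_cong[OF assms(3), of i] by (simp add: vandermonde_exponent_def split: if_splits)
  next
    case False
    then show ?thesis using assms by (simp add: permutes_not_in)
  qed
qed

lemma hom_poly_vandermonde:
  assumes N: "N \<ge> 1" and m: "m = N * (N - 1) + r"
  shows "hom_poly m N (vandermonde_coeff N r) x = x 0 ^ r * vandermonde N (\<lambda>i. (x i)\<^sup>2)"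
proof -
  let ?P = "{\<sigma>. \<sigma> permutes {0..<N}}"
  have mon: "(\<Prod>i<N. x i ^ vandermonde_exponent N r \<sigma> i) = x 0 ^ r * (\<Prod>i=0..<N. ((x i)\<^sup>2) ^ \<sigma> i)" for \<sigma>
  proof -
    have "(\<Prod>i<N. x i ^ vandermonde_exponent N r \<sigma> i) = (\<Prod>i<N. (if i = 0 then x 0 ^ r else 1) * ((x i)\<^sup>2) ^ \<sigma> i)"
      by (intro prod.cong) (auto simp: vandermonde_exponent_def power_add power_mult)
    also have "\<dots> = x 0 ^ r * (\<Prod>i=0..<N. ((x i)\<^sup>2) ^ \<sigma> i)"
      using N by (simp add: prod.distrib atLeast0LessThan)
    finally show ?thesis .
  qed
  have "hom_poly m N (vandermonde_coeff N r) x
    = (\<Sum>\<alpha>\<in>multi_indices m N. \<Sum>\<sigma>\<in>{\<sigma> \<in> ?P. vandermonde_exponent N r \<sigma> = \<alpha>}. signof \<sigma> * (\<Prod>i<N. x i ^ vandermonde_exponent N r \<sigma> i))"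
    unfolding hom_poly_def vandermonde_coeff_def sum_distrib_right by (intro sum.cong refl) auto
  also have "\<dots> = (\<Sum>\<sigma>\<in>?P. signof \<sigma> * (\<Prod>i<N. x i ^ vandermonde_exponent N r \<sigma> i))"
    using vandermonde_exponent_in[OF N m]
    by (intro sum.group) (auto simp: finite_permutations)
  also have "\<dots> = x 0 ^ r * vandermonde N (\<lambda>i. (x i)\<^sup>2)"
    unfolding mon vandermonde_def by (simp add: sum_distrib_left mult_ac)
  finally show ?thesis .
qed

lemma vandermonde_coeff_norm:
  assumes N: "N \<ge> 1" and m: "m = N * (N - 1) + r" and q: "q > 0"
  shows "1 \<le> poly_coeff_norm m N q (vandermonde_coeff N r)"
proof -
  define \<alpha> where "\<alpha> = vandermonde_exponent N r id"
  have id: "id permutes {0..<N}" by (rule permutes_id)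
  have "{\<sigma> \<in> {\<sigma>. \<sigma> permutes {0..<N}}. vandermonde_exponent N r \<sigma> = \<alpha>} = {id}"
    using id vandermonde_exponent_inj unfolding \<alpha>_def by blast
  then have "vandermonde_coeff N r \<alpha> = 1" by (simp add: vandermonde_coeff_def)
  then have "1 = \<bar>vandermonde_coeff N r \<alpha>\<bar> powr q" by simp
  also have "\<dots> \<le> (\<Sum>\<alpha>\<in>multi_indices m N. \<bar>vandermonde_coeff N r \<alpha>\<bar> powr q)"
    using vandermonde_exponent_in[OF N m id] by (intro member_le_sum) (auto simp: \<alpha>_def)
  finally show ?thesis unfolding poly_coeff_norm_def using q by (intro ge_one_powr_ge_zero) auto
qed

text \<open>
  The \<open>l\<^sub>p\<close> ball is contained in the cube, so the same polynomial and the same bound serve all exponents.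
\<close>

lemma admissible_constant_lower_bound:
  assumes p: "1 \<le> p" and m: "m = Suc M * M + r" and q: "q > 0"
    and C: "\<And>a. poly_coeff_norm m (Suc M) q a \<le> C * poly_sup_norm m (Suc M) p a"
  shows "2 ^ (M\<^sup>2) / fact (Suc M) \<le> C"
proof -
  define a where "a = vandermonde_coeff (Suc M) r"
  have m': "m = Suc M * (Suc M - 1) + r" using m by simp
  have "poly_sup_norm m (Suc M) p a \<le> fact (Suc M) / 2 ^ (M\<^sup>2)"
    unfolding poly_sup_norm_def
  proof (rule cSUP_least)
    have "(\<lambda>_. 0) \<in> lp_ball (Suc M) p"
      by (cases rule: lp_ball_cases[OF p]) (auto simp: lp_ball_infinity lp_ball_real)
    then show "{x. lp_norm (Suc M) p x \<le> 1} \<noteq> {}" by (auto simp: lp_ball_def)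
  next
    fix x assume "x \<in> {x. lp_norm (Suc M) p x \<le> 1}"
    then have x: "\<bar>x i\<bar> \<le> 1" if "i < Suc M" for i
      using lp_ball_bounded[of "Suc M" p x i] p that by (simp add: lp_ball_def)
    have "\<bar>hom_poly m (Suc M) a x\<bar> = \<bar>x 0\<bar> ^ r * \<bar>vandermonde (Suc M) (\<lambda>i. (x i)\<^sup>2)\<bar>"
      unfolding a_def hom_poly_vandermonde[OF le_add2[of 1 M, unfolded Suc_eq_plus1[symmetric]] m']
      by (simp only: abs_mult power_abs)
    also have "\<dots> \<le> 1 * (fact (Suc M) / 2 ^ (M\<^sup>2))"
    proof (intro mult_mono vandermonde_bound power_le_one)
      show "0 \<le> (x i)\<^sup>2 \<and> (x i)\<^sup>2 \<le> 1" if "i < Suc M" for i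
        using x[OF that] by (simp add: abs_square_le_1)
      show "\<bar>x 0\<bar> \<le> 1" by (rule x) simp
    qed simp_all
    finally show "\<bar>hom_poly m (Suc M) a x\<bar> \<le> fact (Suc M) / 2 ^ (M\<^sup>2)" by simp
  qed
  moreover have "1 \<le> poly_coeff_norm m (Suc M) q a"
    unfolding a_def by (rule vandermonde_coeff_norm[OF _ m' q]) simp
  moreover have "0 \<le> poly_sup_norm m (Suc M) p a" by (rule poly_sup_norm_nonneg) (use p in auto)
  moreover note C[of a]
  ultimately have 1: "1 \<le> C * poly_sup_norm m (Suc M) p a" "0 \<le> poly_sup_norm m (Suc M) p a"
    "poly_sup_norm m (Suc M) p a \<le> fact (Suc M) / 2 ^ (M\<^sup>2)" by linarith+
  have "C \<ge> 0"
  proof (rule ccontr)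
    assume "\<not> C \<ge> 0"
    then have "C * poly_sup_norm m (Suc M) p a \<le> 0" using 1 by (intro mult_nonpos_nonneg) auto
    then show False using 1(1) by linarith
  qed
  then have "C * poly_sup_norm m (Suc M) p a \<le> C * (fact (Suc M) / 2 ^ (M\<^sup>2))" using 1(3) by (intro mult_left_mono)
  then have le: "1 \<le> C * (fact (Suc M) / 2 ^ (M\<^sup>2))" using 1(1) by linarith
  have "c / d \<le> C" if "1 \<le> C * (d / c)" "c > 0" "d > 0" for c d :: real
    using that by (simp add: field_simps)
  from this[OF le] show ?thesis by simp
qed

section \<open>Growth rates\<close>

lemma hl_pol_const_lower:
  assumes m: "m \<ge> 1" "m = Suc M * M + r" and p: "ereal (real m) < p"
  shows "2 ^ (M\<^sup>2) / fact (Suc M) \<le> hl_pol_const m p"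
  unfolding hl_pol_const_def
proof (rule cInf_greatest)
  show "{C. \<forall>n\<ge>1. \<forall>a. poly_coeff_norm m n (hl_exponent m p) a \<le> C * poly_sup_norm m n p a} \<noteq> {}"
    using hardy_littlewood_uniform[OF _ m(1) p] by blast
  fix C assume "C \<in> {C. \<forall>n\<ge>1. \<forall>a. poly_coeff_norm m n (hl_exponent m p) a \<le> C * poly_sup_norm m n p a}"
  then show "2 ^ (M\<^sup>2) / fact (Suc M) \<le> C"
    by (intro admissible_constant_lower_bound[OF ge_1_of_gt[OF m(1) p] m(2) hl_exponent_pos[OF m(1) p]]) auto
qed

lemma hl_pol_const_upper:
  assumes m: "m \<ge> 1" and p: "ereal (real m) < p"
    and C: "\<And>n a. n \<ge> 1 \<Longrightarrow> poly_coeff_norm m n (hl_exponent m p) a \<le> C * poly_sup_norm m n p a"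
  shows "hl_pol_const m p \<le> C"
  unfolding hl_pol_const_def
proof (rule cInf_lower)
  show "C \<in> {C. \<forall>n\<ge>1. \<forall>a. poly_coeff_norm m n (hl_exponent m p) a \<le> C * poly_sup_norm m n p a}"
    using C by blast
  have "m = Suc 0 * 0 + m" by simp
  from admissible_constant_lower_bound[OF ge_1_of_gt[OF m p] this hl_exponent_pos[OF m p]]
  show "bdd_below {C. \<forall>n\<ge>1. \<forall>a. poly_coeff_norm m n (hl_exponent m p) a \<le> C * poly_sup_norm m n p a}"
    by (intro bdd_belowI[of _ 1]) auto
qed

lemma le_root_of_exp_le:
  assumes "m \<ge> 1" "exp (real m * x) \<le> H"
  shows "exp x \<le> root m H"
proof -
  have "root m (exp (real m * x)) = exp x"
    using assms by (simp add: exp_of_nat_mult real_root_power_cancel)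
  then show ?thesis using real_root_le_mono[of m "exp (real m * x)" H] assms by simp
qed

lemma root_le_of_le_exp:
  assumes "m \<ge> 1" "H \<le> exp (real m * x)"
  shows "root m H \<le> exp x"
proof -
  have "root m (exp (real m * x)) = exp x"
    using assms by (simp add: exp_of_nat_mult real_root_power_cancel)
  then show ?thesis using real_root_le_mono[of m H "exp (real m * x)"] assms by simp
qed

text \<open>
  A lower estimate of the \<open>m\<close>-th root of \<open>2 ^ M\<^sup>2 / (M + 1)!\<close>, where \<open>M\<close> is about \<open>sqrt m - 1\<close>.
\<close>

definition lower_rate :: "nat \<Rightarrow> real" where
  "lower_rate m = exp (((sqrt m - 2)\<^sup>2 * ln 2 - sqrt m * ln (sqrt m)) / m)"

lemma lower_rate_tendsto: "lower_rate \<longlonglongrightarrow> 2"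
proof -
  have "((\<lambda>x::real. ((sqrt x - 2)\<^sup>2 * ln 2 - sqrt x * ln (sqrt x)) / x) \<longlongrightarrow> ln 2) at_top" by real_asymp
  from filterlim_compose[OF this filterlim_real_sequentially]
  have "lower_rate \<longlonglongrightarrow> exp (ln 2)" unfolding lower_rate_def[abs_def] by (rule tendsto_exp)
  then show ?thesis by simp
qed

lemma lower_rate_le:
  assumes m: "m \<ge> 4" and p: "ereal (real m) < p"
  shows "lower_rate m \<le> root m (hl_pol_const m p)"
proof -
  define s where "s = sqrt (real m)"
  have s2: "s \<ge> 2" unfolding s_def using m real_sqrt_le_mono[of 4 "real m"] by simp
  have sm: "s * s = real m" by (simp add: s_def)
  (* The number of variables is the integer part of sqrt m, so that (M + 1) M does not exceed m. *)
  define M where "M = nat (\<lfloor>s\<rfloor>) - 1"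
  have fl: "\<lfloor>s\<rfloor> \<ge> 2" using s2 by (simp add: le_floor_iff)
  then have M: "real (Suc M) = of_int \<lfloor>s\<rfloor>" by (simp add: M_def)
  then have Mle: "real (Suc M) \<le> s" and Mge: "s - 2 \<le> real M" by linarith+
  have "real (Suc M * M) \<le> s * s" unfolding of_nat_mult using Mle by (intro mult_mono) auto
  then have "Suc M * M \<le> m" unfolding sm by (simp only: of_nat_le_iff)
  then obtain r where r: "m = Suc M * M + r" using le_Suc_ex by blast
  have "(s - 2)\<^sup>2 \<le> (real M)\<^sup>2" using s2 Mge by (intro power_mono) auto
  then have 1: "(s - 2)\<^sup>2 * ln 2 \<le> (real M)\<^sup>2 * ln 2" by (intro mult_right_mono) auto
  have "(fact (Suc M) :: real) \<le> real (Suc M ^ Suc M)" by (rule fact_le_power)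
  then have "fact (Suc M) \<le> real (Suc M) ^ Suc M" by (simp only: of_nat_power)
  then have "ln (fact (Suc M) :: real) \<le> ln (real (Suc M) ^ Suc M)" by (rule ln_mono) (rule fact_gt_zero)
  also have "\<dots> = real (Suc M) * ln (real (Suc M))" by (rule ln_realpow)
  also have "\<dots> \<le> s * ln s" using Mle s2 by (intro mult_mono ln_mono) auto
  finally have 2: "ln (fact (Suc M) :: real) \<le> s * ln s" .
  have "exp (real m * (((s - 2)\<^sup>2 * ln 2 - s * ln s) / m)) = exp ((s - 2)\<^sup>2 * ln 2 - s * ln s)"
    using m by simp
  also have "\<dots> \<le> exp ((real M)\<^sup>2 * ln 2 - ln (fact (Suc M)))"
    unfolding exp_le_cancel_iff using 1 2 by linarith
  also have "\<dots> = 2 ^ (M\<^sup>2) / fact (Suc M)"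
  proof -
    have "(real M)\<^sup>2 * ln 2 = real (M\<^sup>2) * ln 2" by simp
    then have "exp ((real M)\<^sup>2 * ln 2) = exp (ln 2) ^ (M\<^sup>2)" by (simp only: exp_of_nat_mult)
    moreover have "exp (ln (fact (Suc M))) = (fact (Suc M) :: real)" by (rule exp_ln) (rule fact_gt_zero)
    ultimately show ?thesis by (simp add: exp_diff del: fact_Suc)
  qed
  also have "\<dots> \<le> hl_pol_const m p" by (rule hl_pol_const_lower[OF _ r p]) (use m in simp)
  finally show ?thesis unfolding lower_rate_def s_def[symmetric] using m by (intro le_root_of_exp_le) auto
qed

definition upper_rate :: "nat \<Rightarrow> real" where
  "upper_rate m = exp ((ln m + 1) / m + (ln 2 / 2 + ln 2))"

lemma exp_half_ln_2: "exp (ln 2 / 2) = sqrt (2::real)"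
proof -
  have "ln (sqrt (2::real)) = ln 2 / 2" by (rule ln_sqrt) simp
  then have "exp (ln 2 / 2) = exp (ln (sqrt (2::real)))" by (simp only:)
  also have "\<dots> = sqrt 2" by (rule exp_ln) simp
  finally show ?thesis .
qed

lemma upper_rate_tendsto: "upper_rate \<longlonglongrightarrow> 2 * sqrt 2"
proof -
  have "((\<lambda>x::real. (ln x + 1) / x) \<longlongrightarrow> 0) at_top" by real_asymp
  from filterlim_compose[OF this filterlim_real_sequentially]
  have "(\<lambda>m. exp ((ln (real m) + 1) / real m + (ln 2 / 2 + ln 2))) \<longlonglongrightarrow> exp (0 + (ln 2 / 2 + ln 2))"
    by (intro tendsto_intros)
  also have "exp (0 + (ln 2 / 2 + ln 2)) = exp (ln 2 / 2) * exp (ln (2::real))" by (simp only: exp_add add_0_left)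
  also have "\<dots> = 2 * sqrt 2" by (simp only: exp_half_ln_2) simp
  finally show ?thesis by (simp add: upper_rate_def[abs_def])
qed

lemma le_upper_rate:
  assumes m: "m \<ge> 1" and p: "ereal (real m) < p"
  shows "root m (hl_pol_const m p) \<le> upper_rate m"
proof -
  have "hl_pol_const m p \<le> real m * exp 1 * sqrt 2 ^ (m - 1) * 2 ^ m"
    by (rule hl_pol_const_upper[OF m p hardy_littlewood_uniform[OF _ m p]])
  also have "\<dots> \<le> real m * exp 1 * sqrt 2 ^ m * 2 ^ m"
    by (intro mult_right_mono mult_left_mono power_increasing) auto
  also have "\<dots> = exp (ln m) * exp 1 * exp (real m * (ln 2 / 2)) * exp (real m * ln 2)"
    unfolding exp_of_nat_mult exp_half_ln_2 using m by simp
  also have "\<dots> = exp (real m * ((ln m + 1) / m + (ln 2 / 2 + ln 2)))"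
  proof -
    have "real m * (X / real m) = X" for X using m by simp
    then show ?thesis by (simp only: exp_add[symmetric] distrib_left add_ac)
  qed
  finally show ?thesis unfolding upper_rate_def by (rule root_le_of_le_exp[OF m])
qed

definition block_rate :: "nat \<Rightarrow> (nat \<Rightarrow> real) \<Rightarrow> nat \<Rightarrow> real" where
  "block_rate k R m = exp (ln 2 + ln 2 / k + (ln (bh_const k) + k + k / 2 * ln m) / m + 2 * (2 / R m + k / m))"

lemma block_rate_tendsto:
  assumes R: "filterlim R at_top sequentially"
  shows "block_rate k R \<longlonglongrightarrow> exp (ln 2 + ln 2 / k)"
proof -
  have "((\<lambda>x::real. (ln (bh_const k) + k + k / 2 * ln x) / x) \<longlongrightarrow> 0) at_top" by real_asymp
  note l1 = filterlim_compose[OF this filterlim_real_sequentially]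
  have "((\<lambda>x::real. real k / x) \<longlongrightarrow> 0) at_top" by real_asymp
  note l2 = filterlim_compose[OF this filterlim_real_sequentially]
  have "((\<lambda>x::real. 2 / x) \<longlongrightarrow> 0) at_top" by real_asymp
  note l3 = filterlim_compose[OF this R]
  have "(\<lambda>m. exp (ln 2 + ln 2 / k + (ln (bh_const k) + k + k / 2 * ln m) / m + 2 * (2 / R m + k / m)))
    \<longlonglongrightarrow> exp (ln 2 + ln 2 / k + 0 + 2 * (0 + 0))"
    by (intro tendsto_intros l1 l2 l3)
  then show ?thesis by (simp add: block_rate_def[abs_def])
qed

text \<open>
  The assumption \<open>p \<ge> m R\<close> makes the exponent \<open>2 m / p\<close> of the one-letter estimate at most \<open>2 / R\<close>, and
  \<open>bh_const m\<close> is at most \<open>exp (2 m)\<close>.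
\<close>

lemma le_block_rate:
  assumes k: "1 \<le> k" "k \<le> m" and p: "ereal (real m) < p" "ereal (real m * R m) \<le> p" and R: "R m \<ge> 2"
  shows "root m (hl_pol_const m p) \<le> block_rate k R m"
proof -
  have m: "m \<ge> 1" using k by simp
  have m0: "real m > 0" using m by simp
  have "2 * real m \<le> real m * R m" using R m0 by (simp add: mult.commute)
  then have p2: "ereal (2 * real m) \<le> p" by (intro order_trans[OF _ p(2)]) simp
  define t where "t = 2 * real m * reciprocal p + k / m"
  have rec: "2 * real m * reciprocal p \<le> 2 / R m"
  proof (cases "p = \<infinity>")
    case True then show ?thesis using R by (simp add: reciprocal_def)
  next
    case False
    then obtain x where x: "p = ereal x" "real m * R m \<le> x" using p by (cases p) auto
    then have "x > 0" using p(1) m0 by simp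
    then show ?thesis using x R by (simp add: reciprocal_def field_simps)
  qed
  have t0: "0 \<le> t" using hl_exponent_large(3)[OF m p2] by (simp add: t_def)
  have bh: "bh_const k \<ge> 1" "bh_const m \<ge> 1" using bh_const_ge_1 k m by auto
  have "ln (bh_const m) \<le> 2 * m"
  proof -
    have "ln (bh_const m) = ln m / 2 + 1 + (real m - 1) * (ln 2 / 2)"
      using m by (simp add: bh_const_def ln_mult ln_sqrt ln_realpow of_nat_diff)
    also have "\<dots> \<le> (real m - 1) / 2 + 1 + (real m - 1) * (1 / 2)"
      using m ln_le_minus_one[of "real m"] ln_le_minus_one[of "2::real"]
      by (intro add_mono mult_left_mono divide_right_mono) auto
    also have "\<dots> \<le> 2 * m" using m by (simp add: field_simps)
    finally show ?thesis .
  qed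
  then have bhm: "bh_const m \<le> exp (2 * m)" 
  proof -
    assume "ln (bh_const m) \<le> 2 * m"
    then have "exp (ln (bh_const m)) \<le> exp (2 * m)" by simp
    then show ?thesis using bh by simp
  qed
  have "hl_pol_const m p \<le> 2 ^ m * block_const m k * bh_const m powr t"
    unfolding t_def by (rule hl_pol_const_upper[OF m p(1) hardy_littlewood_blocks[OF _ k p(1) p2]])
  also have "\<dots> \<le> 2 ^ m * block_const m k * exp (2 * m) powr t"
    using t0 bh bhm block_const_ge_1[OF k(1) m] by (intro mult_left_mono powr_mono2) auto
  also have "exp (2 * m) powr t = exp (2 * m * t)" by (simp add: powr_def mult.commute)
  also have "block_const m k = exp (m * (ln 2 / k) + (ln (bh_const k) + k + k / 2 * ln m))"
    using bh m by (simp add: block_const_def powr_def exp_add mult_ac)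
  also have "(2::real) ^ m = exp (m * ln 2)" by (simp add: exp_of_nat_mult)
  also have "exp (m * ln 2) * exp (m * (ln 2 / k) + (ln (bh_const k) + k + k / 2 * ln m)) * exp (2 * m * t)
      = exp (m * (ln 2 + ln 2 / k + (ln (bh_const k) + k + k / 2 * ln m) / m + 2 * t))"
  proof -
    have 1: "real m * (X / real m) = X" for X using m0 by simp
    have "real m * (a + b + X / m + 2 * t) = real m * a + (real m * b + X) + 2 * m * t" for a b X
      by (simp only: distrib_left 1 add_ac mult_ac)
    then show ?thesis by (simp only: exp_add[symmetric])
  qed
  also have "\<dots> \<le> exp (m * (ln 2 + ln 2 / k + (ln (bh_const k) + k + k / 2 * ln m) / m + 2 * (2 / R m + k / m)))"
    using m0 rec by (simp add: t_def)
  finally show ?thesis unfolding block_rate_def by (rule root_le_of_le_exp[OF m])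
qed

theorem theoremB:
  shows "(2 \<le> liminf (\<lambda>m. INF p\<in>{p. ereal (real m) < p}. ereal (root m (hl_pol_const m p))) \<and>
          liminf (\<lambda>m. INF p\<in>{p. ereal (real m) < p}. ereal (root m (hl_pol_const m p)))
            \<le> limsup (\<lambda>m. SUP p\<in>{p. ereal (real m) < p}. ereal (root m (hl_pol_const m p))) \<and>
          limsup (\<lambda>m. SUP p\<in>{p. ereal (real m) < p}. ereal (root m (hl_pol_const m p)))
            \<le> ereal (2 * sqrt 2)) \<and>
         (\<forall>R :: nat \<Rightarrow> real. filterlim R at_top sequentially \<longrightarrow>
            (\<lambda>m. SUP p\<in>{p. ereal (real m) < p \<and> ereal (real m * R m) \<le> p}.
                   ereal \<bar>root m (hl_pol_const m p) - 2\<bar>) \<longlonglongrightarrow> 0)"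
proof (intro conjI allI impI)
  let ?inf = "\<lambda>m. INF p\<in>{p. ereal (real m) < p}. ereal (root m (hl_pol_const m p))"
  let ?sup = "\<lambda>m. SUP p\<in>{p. ereal (real m) < p}. ereal (root m (hl_pol_const m p))"
  have "(\<lambda>m. ereal (lower_rate m)) \<longlonglongrightarrow> ereal 2" using lower_rate_tendsto by simp
  then have "liminf (\<lambda>m. ereal (lower_rate m)) = ereal 2" by (intro lim_imp_Liminf) auto
  moreover have "liminf (\<lambda>m. ereal (lower_rate m)) \<le> liminf ?inf"
  proof (rule Liminf_mono)
    show "\<forall>\<^sub>F m in sequentially. ereal (lower_rate m) \<le> ?inf m"
      using eventually_ge_at_top[of 4]
      by eventually_elim (intro INF_greatest, simp add: lower_rate_le)
  qed
  ultimately show "2 \<le> liminf ?inf" by simp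
  have "(\<lambda>m. ereal (upper_rate m)) \<longlonglongrightarrow> ereal (2 * sqrt 2)" using upper_rate_tendsto by simp
  then have "limsup (\<lambda>m. ereal (upper_rate m)) = ereal (2 * sqrt 2)" by (intro lim_imp_Limsup) auto
  moreover have "limsup ?sup \<le> limsup (\<lambda>m. ereal (upper_rate m))"
  proof (rule Limsup_mono)
    show "\<forall>\<^sub>F m in sequentially. ?sup m \<le> ereal (upper_rate m)"
      using eventually_ge_at_top[of 1]
      by eventually_elim (intro SUP_least, simp add: le_upper_rate)
  qed
  ultimately show "limsup ?sup \<le> ereal (2 * sqrt 2)" by simp
  have "?inf m \<le> ?sup m" for m
  proof (rule INF_le_SUP)
    have "\<infinity> \<in> {p. ereal (real m) < p}" by simp
    then show "{p. ereal (real m) < p} \<noteq> {}" by blast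
  qed
  then have "liminf ?inf \<le> liminf ?sup" by (intro Liminf_mono always_eventually) auto
  also have "\<dots> \<le> limsup ?sup" by (intro Liminf_le_Limsup) auto
  finally show "liminf ?inf \<le> limsup ?sup" .
next
  fix R :: "nat \<Rightarrow> real"
  assume R: "filterlim R at_top sequentially"
  let ?P = "\<lambda>m. {p. ereal (real m) < p \<and> ereal (real m * R m) \<le> p}"
  let ?dev = "\<lambda>m. SUP p\<in>?P m. ereal \<bar>root m (hl_pol_const m p) - 2\<bar>"
  show "?dev \<longlonglongrightarrow> 0"
  proof (rule order_tendstoI)
    fix a :: ereal assume a: "a < 0"
    have "0 \<le> ?dev m" for m by (rule SUP_upper2[of \<infinity>]) auto
    then show "\<forall>\<^sub>F m in sequentially. a < ?dev m" 
      using less_le_trans[OF a] by (intro always_eventually allI) blast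
  next
    fix a :: ereal assume "0 < a"
    then obtain \<epsilon>' where \<epsilon>': "0 < \<epsilon>'" "\<epsilon>' < a" using dense by blast
    then obtain \<epsilon> where \<epsilon>: "\<epsilon>' = ereal \<epsilon>" "\<epsilon> > 0" by (cases \<epsilon>') auto
    (* The number k of free letters is fixed by the tolerance before m tends to infinity. *)
    have "((\<lambda>x::real. ln 2 + ln 2 / x) \<longlongrightarrow> ln 2) at_top" by real_asymp
    from tendsto_exp[OF filterlim_compose[OF this filterlim_real_sequentially]]
    have "(\<lambda>k. exp (ln 2 + ln 2 / real k)) \<longlonglongrightarrow> 2" by simp
    then have "\<forall>\<^sub>F k in sequentially. exp (ln 2 + ln 2 / real k) < 2 + \<epsilon>" using \<epsilon> by (intro order_tendstoD) auto
    then have "\<forall>\<^sub>F k in sequentially. exp (ln 2 + ln 2 / real k) < 2 + \<epsilon> \<and> k \<ge> 1"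
      using eventually_ge_at_top[of 1] by eventually_elim simp
    then obtain k where k: "exp (ln 2 + ln 2 / real k) < 2 + \<epsilon>" "k \<ge> 1" 
      using eventually_happens'[OF sequentially_bot] by blast
    have "\<forall>\<^sub>F m in sequentially. block_rate k R m < 2 + \<epsilon>"
      using block_rate_tendsto[OF R, of k] k by (intro order_tendstoD) auto
    moreover have "\<forall>\<^sub>F m in sequentially. 2 - \<epsilon> < lower_rate m"
      using lower_rate_tendsto \<epsilon> by (intro order_tendstoD) auto
    moreover have "\<forall>\<^sub>F m in sequentially. R m \<ge> 2" using R by (auto simp: filterlim_at_top)
    ultimately show "\<forall>\<^sub>F m in sequentially. ?dev m < a"
      using eventually_ge_at_top[of "max 4 k"]
    proof eventually_elim
      case (elim m)
      have "?dev m \<le> ereal \<epsilon>"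
      proof (rule SUP_least)
        fix p assume "p \<in> ?P m"
        then have p: "ereal (real m) < p" "ereal (real m * R m) \<le> p" by auto
        have "lower_rate m \<le> root m (hl_pol_const m p)" by (rule lower_rate_le) (use elim p in auto)
        moreover have "root m (hl_pol_const m p) \<le> block_rate k R m" by (rule le_block_rate) (use elim p k in auto)
        ultimately show "ereal \<bar>root m (hl_pol_const m p) - 2\<bar> \<le> ereal \<epsilon>" using elim by simp
      qed
      also have "\<dots> < a" using \<epsilon>' \<epsilon> by simp
      finally show ?case .
    qed
  qed
qed

end
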